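(* Let $G$ be a finite group of order $g$, let $\beta$ be the Noether number of $G$, and let $m=d_1+\cdots+d_n$ be the sum of the degrees $d_1,\ldots,d_n$ of the irreducible complex representations of $G$ (one for each isomorphism class). For an integer $p\ge 1$ put $\delta_p=(\beta-1)g-(m-1)\beta p$. Then for every integer $p\ge 1$ and every finite dimensional complex representation $V$ of $G$, $$s_p(V)\le \beta^2 m p+\delta_p .$$
   Context: Fix a finite group $G$ of order $g$. For a finite dimensional complex representation $V$ of $G$, let $R=\mathrm{Sym}(V)^G$ be the ring of invariants in the symmetric algebra of $V$, graded by the usual grading in which $V$ has degree $1$. For a homogeneous (graded) vector subspace $E\subset R$, contained in the positive degree part of $R$ and generating $R$ as a $\mathbf{C}$-algebra, put $S=\mathrm{Sym}(E)$, graded so that elements of $E$ keep their degree in $R$; the inclusion $E\subset R$ induces a surjection $S\to R$ of graded algebras, making $R$ a graded $S$-module. Regard $\mathbf{C}$ as the graded $S$-module $S/S_{+}$, where $S_+$ is the ideal generated by $E$. Then $\mathrm{Tor}^S_p(R,\mathbf{C})$ is a graded vector space, and $s_p(V;E)$ denotes the maximal degree in which it is nonzero (with the convention $s_p(V;E)=-\infty$ if it vanishes). The value $s_p(V;E)$ is independent of $E$ if $E$ is chosen to be minimal (i.e. minimal among homogeneous generating subspaces); this common value is denoted $s_p(V)$. For a representation $V$, $\beta(V)$ is the minimal integer such that $R=\mathrm{Sym}(V)^G$ is generated as a $\mathbf{C}$-algebra by elements of degree $\le\beta(V)$. The Noether number $\beta$ of $G$ is the maximum of $\beta(V)$ over all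 finite dimensional complex representations $V$ of $G$ (it is finite, and $\beta\le g$ by Noether's theorem). *)

theory Defs
  imports
    "HOL-Library.Poly_Mapping"
    "HOL-Library.Extended_Real"
    "HOL-Algebra.Coset"
    "Jordan_Normal_Form.Matrix"
    Complex_Main
begin

section \<open>Polynomials over the complex numbers\<close>

text \<open>Polynomials in commuting variables taken from an arbitrary type. The symmetric algebra of
  a vector space with basis \<open>B\<close> is the subring \<open>polys B\<close> of polynomials in the variables \<open>B\<close>.\<close>

type_synonym 'x cpoly = "('x \<Rightarrow>\<^sub>0 nat) \<Rightarrow>\<^sub>0 complex"

definition var :: "'x \<Rightarrow> 'x cpoly" where
  "var x = Poly_Mapping.single (Poly_Mapping.single x 1) 1"

definition cscale :: "complex \<Rightarrow> 'x cpoly \<Rightarrow> 'x cpoly" where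
  "cscale c f = Poly_Mapping.map ((*) c) f"

lemma lookup_cscale: "Poly_Mapping.lookup (cscale c f) m = c * Poly_Mapping.lookup f m"
  by (simp add: cscale_def Poly_Mapping.map.rep_eq when_def)

global_interpretation cpoly: vector_space "cscale :: complex \<Rightarrow> 'x cpoly \<Rightarrow> 'x cpoly"
  by unfold_locales (auto intro!: poly_mapping_eqI simp: lookup_cscale lookup_add algebra_simps)

definition polys :: "'x set \<Rightarrow> 'x cpoly set" where
  "polys B = {f. \<forall>m\<in>Poly_Mapping.keys f. Poly_Mapping.keys m \<subseteq> B}"

definition monom_deg :: "('x \<Rightarrow> nat) \<Rightarrow> ('x \<Rightarrow>\<^sub>0 nat) \<Rightarrow> nat" where
  "monom_deg w m = (\<Sum>x\<in>Poly_Mapping.keys m. w x * Poly_Mapping.lookup m x)"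

definition homogeneous :: "('x \<Rightarrow> nat) \<Rightarrow> nat \<Rightarrow> 'x cpoly \<Rightarrow> bool" where
  "homogeneous w d f \<longleftrightarrow> (\<forall>m\<in>Poly_Mapping.keys f. monom_deg w m = d)"

definition homog_part :: "('x \<Rightarrow> nat) \<Rightarrow> nat \<Rightarrow> 'x cpoly \<Rightarrow> 'x cpoly" where
  "homog_part w d f = (\<Sum>m | m \<in> Poly_Mapping.keys f \<and> monom_deg w m = d.
     Poly_Mapping.single m (Poly_Mapping.lookup f m))"

text \<open>The usual grading gives every variable degree 1.\<close>

abbreviation std :: "'x \<Rightarrow> nat" where
  "std \<equiv> \<lambda>_. 1"

definition total_deg :: "'x cpoly \<Rightarrow> nat" where
  "total_deg f = (if f = 0 then 0 else Max (monom_deg std ` Poly_Mapping.keys f))"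

text \<open>The algebra homomorphism sending each variable \<open>x\<close> to \<open>h x\<close>.\<close>

definition subst_poly :: "('x \<Rightarrow> 'y cpoly) \<Rightarrow> 'x cpoly \<Rightarrow> 'y cpoly" where
  "subst_poly h f = (\<Sum>m\<in>Poly_Mapping.keys f. cscale (Poly_Mapping.lookup f m)
     (\<Prod>x\<in>Poly_Mapping.keys m. h x ^ Poly_Mapping.lookup m x))"

definition subalgebra :: "'x cpoly set \<Rightarrow> bool" where
  "subalgebra A \<longleftrightarrow> cpoly.subspace A \<and> 1 \<in> A \<and> (\<forall>f\<in>A. \<forall>h\<in>A. f * h \<in> A)"

section \<open>Representations and invariants\<close>

definition GL :: "nat \<Rightarrow> complex mat monoid" where
  "GL n = units_of (ring_mat TYPE(complex) n ())"

text \<open>A representation of \<open>G\<close> on the space of column vectors of length \<open>n\<close>.\<close>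

definition representation ::
  "('g, 'b) monoid_scheme \<Rightarrow> nat \<Rightarrow> ('g \<Rightarrow> complex mat) \<Rightarrow> bool" where
  "representation G n \<rho> \<longleftrightarrow> \<rho> \<in> hom G (GL n)"

definition vec_subspace :: "nat \<Rightarrow> complex vec set \<Rightarrow> bool" where
  "vec_subspace n W \<longleftrightarrow> W \<subseteq> carrier_vec n \<and> 0\<^sub>v n \<in> W \<and>
     (\<forall>u\<in>W. \<forall>v\<in>W. u + v \<in> W) \<and> (\<forall>c. \<forall>v\<in>W. c \<cdot>\<^sub>v v \<in> W)"

definition irreducible_rep ::
  "('g, 'b) monoid_scheme \<Rightarrow> nat \<Rightarrow> ('g \<Rightarrow> complex mat) \<Rightarrow> bool" where
  "irreducible_rep G n \<rho> \<longleftrightarrow> representation G n \<rho> \<and> 0 < n \<and>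
     (\<forall>W. vec_subspace n W \<and> (\<forall>g\<in>carrier G. \<forall>v\<in>W. \<rho> g *\<^sub>v v \<in> W)
        \<longrightarrow> W = {0\<^sub>v n} \<or> W = carrier_vec n)"

definition irreps :: "('g, 'b) monoid_scheme \<Rightarrow> (nat \<times> ('g \<Rightarrow> complex mat)) set" where
  "irreps G = {(n, \<rho>). irreducible_rep G n \<rho>}"

definition iso_rel :: "('g, 'b) monoid_scheme \<Rightarrow>
    ((nat \<times> ('g \<Rightarrow> complex mat)) \<times> (nat \<times> ('g \<Rightarrow> complex mat))) set" where
  "iso_rel G = {((n, \<rho>), (n', \<sigma>)). n = n' \<and>
     (\<exists>P\<in>carrier (GL n). \<forall>g\<in>carrier G. P * \<rho> g = \<sigma> g * P)}"

text \<open>All members of an isomorphism class \<open>C\<close> have the same degree, so \<open>fst ` C\<close> is a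
  singleton.\<close>

definition sum_irrep_degrees :: "('g, 'b) monoid_scheme \<Rightarrow> nat" where
  "sum_irrep_degrees G =
     (\<Sum>C \<in> irreps G // (iso_rel G \<inter> irreps G \<times> irreps G). the_elem (fst ` C))"

text \<open>The variable \<open>j\<close> is the \<open>j\<close>-th standard basis vector of \<open>V\<close> (an element of \<open>V\<close>, not of its
  dual), so it is sent to the \<open>j\<close>-th column of \<open>\<rho> g\<close>.\<close>

definition act :: "nat \<Rightarrow> ('g \<Rightarrow> complex mat) \<Rightarrow> 'g \<Rightarrow> nat cpoly \<Rightarrow> nat cpoly" where
  "act n \<rho> g = subst_poly (\<lambda>j. \<Sum>i<n. cscale (\<rho> g $$ (i, j)) (var i))"

definition invariants ::
  "('g, 'b) monoid_scheme \<Rightarrow> nat \<Rightarrow> ('g \<Rightarrow> complex mat) \<Rightarrow> nat cpoly set" where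
  "invariants G n \<rho> = {f \<in> polys {..<n}. \<forall>g\<in>carrier G. act n \<rho> g f = f}"

definition noether_number_rep ::
  "('g, 'b) monoid_scheme \<Rightarrow> nat \<Rightarrow> ('g \<Rightarrow> complex mat) \<Rightarrow> nat" where
  "noether_number_rep G n \<rho> = (LEAST d.
     subalgebra hull {f \<in> invariants G n \<rho>. total_deg f \<le> d} = invariants G n \<rho>)"

definition noether_number :: "('g, 'b) monoid_scheme \<Rightarrow> nat" where
  "noether_number G = Max {noether_number_rep G n \<rho> | n \<rho>. representation G n \<rho>}"

section \<open>Graded modules and Tor\<close>

text \<open>Non-negatively graded modules over \<open>polys B\<close>: carrier, scalar action and homogeneous parts.\<close>

record ('x, 'm) gmod =
  gcarrier :: "'m set"
  gact :: "'x cpoly \<Rightarrow> 'm \<Rightarrow> 'm"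
  gpart :: "nat \<Rightarrow> 'm set"

definition graded_hom ::
  "'x set \<Rightarrow> ('x, 'm::ab_group_add) gmod \<Rightarrow> ('x, 'n::ab_group_add) gmod \<Rightarrow> ('m \<Rightarrow> 'n) \<Rightarrow> bool" where
  "graded_hom B M N f \<longleftrightarrow>
     (\<forall>x\<in>gcarrier M. f x \<in> gcarrier N) \<and>
     (\<forall>x\<in>gcarrier M. \<forall>y\<in>gcarrier M. f (x + y) = f x + f y) \<and>
     (\<forall>s\<in>polys B. \<forall>x\<in>gcarrier M. f (gact M s x) = gact N s (f x)) \<and>
     (\<forall>d. \<forall>x\<in>gpart M d. f x \<in> gpart N d)"

text \<open>The graded free module over \<open>polys B\<close> (with variable \<open>x\<close> in degree \<open>w x\<close>) on the generators
  \<open>J\<close>, generator \<open>j\<close> having degree \<open>a j\<close>. Countable sets of generators, finite or infinite, suffice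
  for resolving modules of countable dimension.\<close>

definition free_gmod ::
  "'x set \<Rightarrow> ('x \<Rightarrow> nat) \<Rightarrow> nat set \<Rightarrow> (nat \<Rightarrow> nat) \<Rightarrow> ('x, nat \<Rightarrow>\<^sub>0 'x cpoly) gmod" where
  "free_gmod B w J a = (let F = {x. Poly_Mapping.keys x \<subseteq> J \<and> (\<forall>j. Poly_Mapping.lookup x j \<in> polys B)} in
     \<lparr> gcarrier = F,
       gact = (\<lambda>s. Poly_Mapping.map ((*) s)),
       gpart = (\<lambda>d. {x \<in> F. \<forall>j\<in>Poly_Mapping.keys x.
                  \<forall>m\<in>Poly_Mapping.keys (Poly_Mapping.lookup x j). monom_deg w m + a j = d}) \<rparr>)"

text \<open>The ideal generated by the variables consists of the polynomials without constant term.\<close>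

definition irrelevant_ideal :: "'x set \<Rightarrow> 'x cpoly set" where
  "irrelevant_ideal B = {s \<in> polys B. Poly_Mapping.lookup s 0 = 0}"

text \<open>\<open>bdry i\<close> maps the module in position \<open>i + 1\<close> to the one in position \<open>i\<close>.\<close>

record ('x, 'm) free_complex =
  gens :: "nat \<Rightarrow> nat set"
  gen_deg :: "nat \<Rightarrow> nat \<Rightarrow> nat"
  bdry :: "nat \<Rightarrow> (nat \<Rightarrow>\<^sub>0 'x cpoly) \<Rightarrow> (nat \<Rightarrow>\<^sub>0 'x cpoly)"
  augm :: "(nat \<Rightarrow>\<^sub>0 'x cpoly) \<Rightarrow> 'm"

definition term_mod ::
  "'x set \<Rightarrow> ('x \<Rightarrow> nat) \<Rightarrow> ('x, 'm) free_complex \<Rightarrow> nat \<Rightarrow> ('x, nat \<Rightarrow>\<^sub>0 'x cpoly) gmod" where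
  "term_mod B w F i = free_gmod B w (gens F i) (gen_deg F i)"

definition graded_free_resolution ::
  "'x set \<Rightarrow> ('x \<Rightarrow> nat) \<Rightarrow> ('x, 'm::ab_group_add) gmod \<Rightarrow> ('x, 'm) free_complex \<Rightarrow> bool" where
  "graded_free_resolution B w M F \<longleftrightarrow>
     (\<forall>i. graded_hom B (term_mod B w F (Suc i)) (term_mod B w F i) (bdry F i)) \<and>
     graded_hom B (term_mod B w F 0) M (augm F) \<and>
     augm F ` gcarrier (term_mod B w F 0) = gcarrier M \<and>
     {x \<in> gcarrier (term_mod B w F 0). augm F x = 0}
        = bdry F 0 ` gcarrier (term_mod B w F 1) \<and>
     (\<forall>i. {x \<in> gcarrier (term_mod B w F (Suc i)). bdry F i x = 0}
        = bdry F (Suc i) ` gcarrier (term_mod B w F (Suc (Suc i))))"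

text \<open>\<open>S\<^sub>+ F\<^sub>i\<close> for \<open>S = polys B\<close>. Since \<open>F\<^sub>i \<otimes> S/S\<^sub>+ = F\<^sub>i / S\<^sub>+ F\<^sub>i\<close>, the
  degree \<open>d\<close> part of \<open>Tor\<^sub>p(M, S/S\<^sub>+) = H\<^sub>p(F \<otimes> S/S\<^sub>+)\<close> is the quotient of the two
  spaces \<open>tor_cycles\<close> and \<open>tor_boundaries\<close> below, both lifted to the degree \<open>d\<close> part of \<open>F\<^sub>p\<close>.\<close>

definition irrelevant_part ::
  "'x set \<Rightarrow> ('x \<Rightarrow> nat) \<Rightarrow> ('x, 'm) free_complex \<Rightarrow> nat \<Rightarrow> (nat \<Rightarrow>\<^sub>0 'x cpoly) set" where
  "irrelevant_part B w F i =
     {x \<in> gcarrier (term_mod B w F i). \<forall>j. Poly_Mapping.lookup x j \<in> irrelevant_ideal B}"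

definition tor_cycles ::
  "'x set \<Rightarrow> ('x \<Rightarrow> nat) \<Rightarrow> ('x, 'm) free_complex \<Rightarrow> nat \<Rightarrow> nat \<Rightarrow> (nat \<Rightarrow>\<^sub>0 'x cpoly) set" where
  "tor_cycles B w F p d = {x \<in> gpart (term_mod B w F p) d.
     \<forall>q. p = Suc q \<longrightarrow> bdry F q x \<in> irrelevant_part B w F q}"

definition tor_boundaries ::
  "'x set \<Rightarrow> ('x \<Rightarrow> nat) \<Rightarrow> ('x, 'm) free_complex \<Rightarrow> nat \<Rightarrow> nat \<Rightarrow> (nat \<Rightarrow>\<^sub>0 'x cpoly) set" where
  "tor_boundaries B w F p d = {x \<in> gpart (term_mod B w F p) d.
     \<exists>y\<in>gcarrier (term_mod B w F (Suc p)). x - bdry F p y \<in> irrelevant_part B w F p}"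

text \<open>Up to isomorphism the homology does not depend on the resolution.\<close>

definition tor_nonzero ::
  "'x set \<Rightarrow> ('x \<Rightarrow> nat) \<Rightarrow> ('x, 'm::ab_group_add) gmod \<Rightarrow> nat \<Rightarrow> nat \<Rightarrow> bool" where
  "tor_nonzero B w M p d \<longleftrightarrow>
     (\<exists>F. graded_free_resolution B w M F \<and> \<not> tor_cycles B w F p d \<subseteq> tor_boundaries B w F p d)"

section \<open>Degrees of syzygies\<close>

definition generating_space :: "nat cpoly set \<Rightarrow> nat cpoly set \<Rightarrow> bool" where
  "generating_space R E \<longleftrightarrow> cpoly.subspace E \<and> E \<subseteq> R \<and>
     (\<forall>f\<in>E. \<forall>d. homog_part std d f \<in> E) \<and>
     (\<forall>f\<in>E. homog_part std 0 f = 0) \<and>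
     subalgebra hull E = R"

definition minimal_generating_space :: "nat cpoly set \<Rightarrow> nat cpoly set \<Rightarrow> bool" where
  "minimal_generating_space R E \<longleftrightarrow> generating_space R E \<and>
     (\<forall>E'. generating_space R E' \<and> E' \<subseteq> E \<longrightarrow> E' = E)"

definition homogeneous_basis :: "nat cpoly set \<Rightarrow> nat cpoly set \<Rightarrow> bool" where
  "homogeneous_basis E B \<longleftrightarrow>
     cpoly.independent B \<and> cpoly.span B = E \<and> (\<forall>b\<in>B. \<exists>d. homogeneous std d b)"

text \<open>For a homogeneous basis \<open>B\<close> of \<open>E\<close>, the ring \<open>Sym(E)\<close> is \<open>polys B\<close>, whose variables are the
  elements of \<open>B\<close> themselves. It acts on \<open>R\<close> through the map sending the variable \<open>b\<close> to the
  polynomial \<open>b\<close>.\<close>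

definition invariant_gmod :: "nat cpoly set \<Rightarrow> (nat cpoly, nat cpoly) gmod" where
  "invariant_gmod R =
     \<lparr> gcarrier = R,
       gact = (\<lambda>s r. subst_poly (\<lambda>b. b) s * r),
       gpart = (\<lambda>d. {f \<in> R. homogeneous std d f}) \<rparr>"

text \<open>The supremum of the empty set is \<open>-\<infinity>\<close>.\<close>

definition syz_degree_wrt :: "nat cpoly set \<Rightarrow> nat cpoly set \<Rightarrow> nat \<Rightarrow> ereal" where
  "syz_degree_wrt R E p = Sup {ereal (real d) | d B.
     homogeneous_basis E B \<and> tor_nonzero B total_deg (invariant_gmod R) p d}"

text \<open>All minimal \<open>E\<close> give the same value; the supremum is that common value.\<close>

definition syz_degree ::
  "('g, 'b) monoid_scheme \<Rightarrow> nat \<Rightarrow> ('g \<Rightarrow> complex mat) \<Rightarrow> nat \<Rightarrow> ereal" where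
  "syz_degree G n \<rho> p =
     (SUP E \<in> {E. minimal_generating_space (invariants G n \<rho>) E}.
        syz_degree_wrt (invariants G n \<rho>) E p)"

end

theory Submission
  imports Defs "HOL-Library.Function_Algebras"
begin

text \<open>By a zigzag through a free resolution, Tor is the Koszul homology of the ring of invariants
  \<open>R\<close> with respect to a minimal space of generators. This is a retract of the Koszul homology of
  \<open>A = Sym(V)\<close> with respect to the Reynolds images of all words of length at most \<open>\<beta>\<close>.

  Let \<open>N = dim V\<close>. Every \<open>x\<^sub>i\<^sup>g\<close> lies in the ideal generated by the invariants of degree at most
  \<open>\<beta>\<close>, so it is the differential of a chain \<open>c\<^sub>i\<close>. For a cycle \<open>z\<close> of degree greater than
  \<open>N(\<beta> - 1) + p\<beta>\<close> the chain \<open>z \<and> c\<^sub>1 \<and> \<dots> \<and> c\<^sub>N\<close> vanishes modulo \<open>(x\<^sub>1\<^sup>g, \<dots>, x\<^sub>N\<^sup>g)\<close>, since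
  its coefficients have degree greater than \<open>N(g - 1)\<close>. Cancelling the members of this regular
  sequence one by one shows that \<open>z\<close> is a boundary.

  It remains to replace \<open>N\<close> by \<open>g + \<beta>pm\<close>. Embed \<open>V\<close> into a permutation representation, which is
  unitary. A chain that is orthogonal to all boundaries is a tensor whose values are detected by one
  vector for the factor \<open>A\<close> and at most \<open>\<beta>p\<close> vectors for the generators, and the latter can be taken
  from irreducible subspaces. Together these vectors generate a submodule of dimension at most
  \<open>g + \<beta>pm\<close>, and the orthogonal projection to it reduces the claim to the case of that dimension.\<close>

section \<open>Polynomials, words and substitutions\<close>

text \<open>Cancelling powers of the variables gives a bound that grows with dim V, while the claim
  is uniform in V; the rest trades dim V for a constant. That trade needs complexes that are
  functorial in V. A basis of invariants is not, but words are: an equivariant linear map sends the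
  invariant of a word to a combination of invariants of words of the same length, whose coefficients
  are entries of its tensor power. These coefficients are constants, and conjugate transposes go to
  conjugate transposes, so orthogonal projections of V stay self-adjoint on tensors. The constants:
  a chain of degree d wedged with N one-chains of degree g has degree d + Ng, of which its p + N
  indices absorb at most (p + N) \<beta>. The coefficients have degree above N(g - 1) once d >
  N(\<beta> - 1) + p \<beta>. In N = g + \<beta> p m the summand g bounds the size of the orbit of
  one vector, and m bounds the dimension of one irreducible subspace. For this N, N(\<beta> - 1) + p
  \<beta> = \<beta>^2 m p + \<delta>_p.\<close>

abbreviation lookup where "lookup \<equiv> Poly_Mapping.lookup"
abbreviation keys where "keys \<equiv> Poly_Mapping.keys"
abbreviation single where "single \<equiv> Poly_Mapping.single"

lemma cscale_conv_mult: "cscale c f = single 0 c * f"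
  by (simp add: cscale_def mult_map_scale_conv_mult)

lemma cscale_mult_left: "cscale c f * h = cscale c (f * h)"
  and cscale_mult_right: "f * cscale c h = cscale c (f * h)"
  by (simp_all add: cscale_conv_mult mult_ac)

lemma cscale_single: "cscale c (single m a) = single m (c * a)"
  by (simp add: cscale_conv_mult mult_single)

lemma cscale_sum_right: "cscale c (sum f A) = (\<Sum>a\<in>A. cscale c (f a))"
  by (rule cpoly.scale_sum_right)

lemma cscale_uminus: "cscale c (- f) = - cscale c f" "cscale (- c) f = - cscale c f"
  by (simp_all add: cscale_conv_mult single_uminus)

lemma cscale_simps [simp]:
  "cscale 0 f = 0" "cscale 1 f = f" "cscale c 0 = 0" "cscale a (cscale b f) = cscale (a * b) f"
  by simp_all

lemma poly_as_sum: "f = (\<Sum>m\<in>keys f. single m (lookup f m))"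
proof (rule poly_mapping_eqI)
  fix k
  have "lookup (\<Sum>m\<in>keys f. single m (lookup f m)) k = (\<Sum>m\<in>keys f. if m = k then lookup f m else 0)"
    by (simp add: lookup_sum lookup_single when_def)
  also have "\<dots> = lookup f k"
    by (simp add: sum.delta in_keys_iff)
  finally show "lookup f k = lookup (\<Sum>m\<in>keys f. single m (lookup f m)) k" by simp
qed

text \<open>The values lie in an arbitrary commutative monoid, so that the rule serves polynomials
  and exponents alike.\<close>

lemma cpoly_induct [case_names single add]:
  fixes f :: "'a \<Rightarrow>\<^sub>0 'b::comm_monoid_add"
  assumes "\<And>m c. P (single m c)" "\<And>f h. P f \<Longrightarrow> P h \<Longrightarrow> P (f + h)"
  shows "P f"
proof -
  have "P (\<Sum>m\<in>A. single m (lookup f m))" if "finite A" for A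
    using that
  proof induction
    case empty
    then show ?case using assms(1)[of undefined 0] by simp
  next
    case (insert x F)
    then show ?case using assms by simp
  qed
  then show ?thesis using poly_as_sum[of f] by (metis finite_keys)
qed

lemma keys_cscale_subset: "keys (cscale c f) \<subseteq> keys f"
  by (auto simp: in_keys_iff lookup_cscale)

section \<open>Evaluation of monomials and substitution\<close>

definition mon_val :: "('x \<Rightarrow> 'a::comm_monoid_mult) \<Rightarrow> ('x \<Rightarrow>\<^sub>0 nat) \<Rightarrow> 'a" where
  "mon_val h m = (\<Prod>x\<in>keys m. h x ^ lookup m x)"

lemma mon_val_superset:
  assumes "finite A" "keys m \<subseteq> A"
  shows "mon_val h m = (\<Prod>x\<in>A. h x ^ lookup m x)"
  unfolding mon_val_def by (rule prod.mono_neutral_left) (use assms in \<open>auto simp: in_keys_iff\<close>)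

lemma mon_val_0 [simp]: "mon_val h 0 = 1"
  by (simp add: mon_val_def)

lemma mon_val_add: "mon_val h (m + m') = mon_val h m * mon_val h m'"
proof -
  have "mon_val h n = (\<Prod>x\<in>keys m \<union> keys m'. h x ^ lookup n x)"
    if "n \<in> {m, m', m + m'}" for n
    by (rule mon_val_superset) (use that keys_add[of m m'] in auto)
  then show ?thesis
    by (simp add: lookup_add power_add prod.distrib)
qed

lemma mon_val_single [simp]: "mon_val h (single x k) = h x ^ k"
  by (cases "k = 0") (simp_all add: mon_val_def)

lemma subst_poly_superset:
  assumes "finite A" "keys f \<subseteq> A"
  shows "subst_poly h f = (\<Sum>m\<in>A. cscale (lookup f m) (mon_val h m))"
  unfolding subst_poly_def mon_val_def[symmetric]
  by (rule sum.mono_neutral_left) (use assms in \<open>auto simp: in_keys_iff\<close>)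

lemma subst_poly_single: "subst_poly h (single m c) = cscale c (mon_val h m)"
  by (subst subst_poly_superset[of "{m}"]) (auto simp: keys_single)

lemma subst_poly_add: "subst_poly h (f + g) = subst_poly h f + subst_poly h g"
proof -
  have "subst_poly h n = (\<Sum>m\<in>keys f \<union> keys g. cscale (lookup n m) (mon_val h m))"
    if "n \<in> {f, g, f + g}" for n
    by (rule subst_poly_superset) (use that keys_add[of f g] in auto)
  then show ?thesis
    by (simp add: lookup_add cpoly.scale_left_distrib sum.distrib)
qed

lemma subst_poly_0 [simp]: "subst_poly h 0 = 0"
  by (simp add: subst_poly_def)

lemma subst_poly_1 [simp]: "subst_poly h 1 = 1"
  using subst_poly_single[of h 0 1] by (simp add: single_one)

lemma subst_poly_sum: "subst_poly h (\<Sum>a\<in>A. f a) = (\<Sum>a\<in>A. subst_poly h (f a))"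
  by (induction A rule: infinite_finite_induct) (simp_all add: subst_poly_add)

lemma subst_poly_mult: "subst_poly h (f * g) = subst_poly h f * subst_poly h g"
proof (induction f rule: cpoly_induct)
  case (single m c)
  show ?case
  proof (induction g rule: cpoly_induct)
    case (single n d)
    then show ?case
      by (simp add: mult_single subst_poly_single mon_val_add cscale_mult_left cscale_mult_right
          mult.commute mult.left_commute)
  qed (simp add: algebra_simps subst_poly_add)
qed (simp add: algebra_simps subst_poly_add)

lemma subst_poly_cscale: "subst_poly h (cscale c f) = cscale c (subst_poly h f)"
proof -
  have "subst_poly h (single 0 c) = single 0 c"
    by (simp add: subst_poly_single cscale_conv_mult)
  then show ?thesis by (simp add: cscale_conv_mult subst_poly_mult)
qed

lemma subst_poly_uminus: "subst_poly h (- f) = - subst_poly h f"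
  by (metis add.inverse_unique add.right_inverse subst_poly_add subst_poly_0)

lemma subst_poly_diff: "subst_poly h (f - g) = subst_poly h f - subst_poly h g"
  by (metis diff_conv_add_uminus subst_poly_add subst_poly_uminus)

lemma subst_poly_power: "subst_poly h (f ^ k) = subst_poly h f ^ k"
  by (induction k) (simp_all add: subst_poly_mult)

lemma subst_poly_prod: "subst_poly h (\<Prod>a\<in>A. f a) = (\<Prod>a\<in>A. subst_poly h (f a))"
  by (induction A rule: infinite_finite_induct) (simp_all add: subst_poly_mult)

lemma subst_poly_var [simp]: "subst_poly h (var x) = h x"
  by (simp add: var_def subst_poly_single)

lemma subst_poly_comp: "subst_poly h (subst_poly k f) = subst_poly (\<lambda>x. subst_poly h (k x)) f"
  unfolding subst_poly_def[of k] subst_poly_def[of "\<lambda>x. subst_poly h (k x)"]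
  by (simp add: subst_poly_sum subst_poly_cscale subst_poly_prod subst_poly_power)

lemma subst_poly_cong:
  assumes "f \<in> polys B" "\<And>x. x \<in> B \<Longrightarrow> h x = k x"
  shows "subst_poly h f = subst_poly k f"
  unfolding subst_poly_def
proof (rule sum.cong[OF refl])
  fix m assume m: "m \<in> keys f"
  have "(\<Prod>x\<in>keys m. h x ^ lookup m x) = (\<Prod>x\<in>keys m. k x ^ lookup m x)"
    by (rule prod.cong[OF refl]) (use assms m in \<open>force simp: polys_def\<close>)
  then show "cscale (lookup f m) (\<Prod>x\<in>keys m. h x ^ lookup m x) =
    cscale (lookup f m) (\<Prod>x\<in>keys m. k x ^ lookup m x)" by simp
qed

section \<open>Words and monomials\<close>

definition word_exponent :: "'x list \<Rightarrow> 'x \<Rightarrow>\<^sub>0 nat" where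
  "word_exponent w = sum_list (map (\<lambda>x. single x 1) w)"

definition word_poly :: "'x list \<Rightarrow> 'x cpoly" where
  "word_poly w = prod_list (map var w)"

lemma word_exponent_Nil [simp]: "word_exponent [] = 0" and word_exponent_Cons: "word_exponent (x # w) = single x 1 + word_exponent w"
  by (simp_all add: word_exponent_def)

lemma word_poly_Nil [simp]: "word_poly [] = 1" and word_poly_Cons [simp]: "word_poly (x # w) = var x * word_poly w"
  by (simp_all add: word_poly_def)

lemma word_poly_append: "word_poly (u @ v) = word_poly u * word_poly v"
  by (simp add: word_poly_def)

lemma word_poly_conv_single: "word_poly w = single (word_exponent w) 1"
  by (induction w) (simp_all add: word_exponent_Cons var_def mult_single single_one)

lemma lookup_word_exponent: "lookup (word_exponent w) x = count_list w x"
  by (induction w) (auto simp: word_exponent_Cons lookup_add lookup_single when_def)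

lemma keys_word_exponent: "keys (word_exponent w) = set w"
  by (auto simp: in_keys_iff lookup_word_exponent count_list_0_iff)

lemma ex_word_exponent: "\<exists>w. word_exponent w = m"
proof (induction m rule: cpoly_induct)
  case (single x k)
  have "word_exponent (replicate k x) = single x k"
    by (rule poly_mapping_eqI, induction k) (auto simp: word_exponent_Cons lookup_add lookup_single when_def)
  then show ?case by blast
next
  case (add f h)
  have "word_exponent (u @ v) = word_exponent u + word_exponent v" for u v :: "'a list" by (simp add: word_exponent_def)
  then show ?case using add by metis
qed

text \<open>The group acts on words as on tensors, while a polynomial only knows its monomials.
  Choosing one ordering of the letters per monomial leads from the latter to the former.\<close>

definition monom_word :: "('x \<Rightarrow>\<^sub>0 nat) \<Rightarrow> 'x list" where
  "monom_word m = (SOME w. word_exponent w = m)"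

lemma word_exponent_monom_word [simp]: "word_exponent (monom_word m) = m"
  unfolding monom_word_def by (rule someI_ex) (rule ex_word_exponent)

lemma set_monom_word [simp]: "set (monom_word m) = keys m"
  by (metis keys_word_exponent word_exponent_monom_word)

lemma monom_deg_superset:
  assumes "finite A" "keys m \<subseteq> A"
  shows "monom_deg w m = (\<Sum>x\<in>A. w x * lookup m x)"
  unfolding monom_deg_def by (rule sum.mono_neutral_left) (use assms in \<open>auto simp: in_keys_iff\<close>)

lemma monom_deg_0 [simp]: "monom_deg w 0 = 0"
  by (simp add: monom_deg_def)

lemma monom_deg_add: "monom_deg w (m + m') = monom_deg w m + monom_deg w m'"
proof -
  have "monom_deg w n = (\<Sum>x\<in>keys m \<union> keys m'. w x * lookup n x)"
    if "n \<in> {m, m', m + m'}" for n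
    by (rule monom_deg_superset) (use that keys_add[of m m'] in auto)
  then show ?thesis by (simp add: lookup_add algebra_simps sum.distrib)
qed

lemma monom_deg_single [simp]: "monom_deg w (single x k) = w x * k"
  by (cases "k = 0") (simp_all add: monom_deg_def)

lemma monom_deg_word_exponent: "monom_deg w (word_exponent u) = sum_list (map w u)"
  by (induction u) (simp_all add: word_exponent_Cons monom_deg_add)

lemma monom_deg_std_word_exponent: "monom_deg std (word_exponent u) = length u"
  by (simp add: monom_deg_word_exponent sum_list_triv)

lemmas monom_deg_std_wm' [simp] = monom_deg_std_word_exponent[unfolded One_nat_def]

lemma length_monom_word: "length (monom_word m) = monom_deg std m"
  by (metis monom_deg_std_word_exponent word_exponent_monom_word)

lemma monom_deg_std_0_iff: "monom_deg std m = 0 \<longleftrightarrow> m = 0"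
  by (metis length_0_conv length_monom_word monom_deg_0 word_exponent_Nil word_exponent_monom_word)

text \<open>Each monomial is counted at its chosen word only, so that the expansion over all words
  in \<open>poly_words\<close> has no repetitions.\<close>

definition word_coeff :: "'x cpoly \<Rightarrow> 'x list \<Rightarrow> complex" where
  "word_coeff f w = (if monom_word (word_exponent w) = w then lookup f (word_exponent w) else 0)"

lemma poly_words:
  assumes "finite W" "\<And>m. m \<in> keys f \<Longrightarrow> monom_word m \<in> W"
  shows "f = (\<Sum>w\<in>W. cscale (word_coeff f w) (word_poly w))"
proof -
  have inj: "inj_on monom_word (keys f)" by (metis inj_onI word_exponent_monom_word)
  have "(\<Sum>w\<in>W. cscale (word_coeff f w) (word_poly w)) = (\<Sum>w\<in>monom_word ` keys f. cscale (word_coeff f w) (word_poly w))"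
    by (rule sum.mono_neutral_right) (use assms in \<open>auto simp: word_coeff_def in_keys_iff\<close>, metis cscale_simps(1) in_keys_iff image_eqI)
  also have "\<dots> = (\<Sum>m\<in>keys f. cscale (word_coeff f (monom_word m)) (word_poly (monom_word m)))"
    by (simp add: sum.reindex[OF inj])
  also have "\<dots> = (\<Sum>m\<in>keys f. single m (lookup f m))"
    by (simp add: word_coeff_def word_poly_conv_single cscale_single)
  finally show ?thesis using poly_as_sum[of f] by simp
qed

lemma word_coeff_nonzeroD: "word_coeff f w \<noteq> 0 \<Longrightarrow> word_exponent w \<in> keys f"
  by (auto simp: word_coeff_def in_keys_iff split: if_splits)

definition words :: "'x set \<Rightarrow> nat \<Rightarrow> 'x list set" where
  "words X d = {w. set w \<subseteq> X \<and> length w = d}"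

lemma finite_words: "finite X \<Longrightarrow> finite (words X d)"
  unfolding words_def by (rule finite_lists_length_eq)

lemma words_0 [simp]: "words X 0 = {[]}"
  by (auto simp: words_def)

lemma Cons_in_words [simp]: "x # w \<in> words X (Suc d) \<longleftrightarrow> x \<in> X \<and> w \<in> words X d"
  by (auto simp: words_def)

text \<open>Splitting off the first letter is the induction step for the sums over tensor powers
  below.\<close>

lemma sum_words_Suc: "(\<Sum>w\<in>words X (Suc d). F w) = (\<Sum>x\<in>X. \<Sum>w\<in>words X d. F (x # w))"
proof -
  have eq: "words X (Suc d) = (\<lambda>(x, w). x # w) ` (X \<times> words X d)"
    by (force simp: words_def length_Suc_conv image_def)
  have inj: "inj_on (\<lambda>(x, w). x # w) (X \<times> words X d)" by (auto simp: inj_on_def)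
  show ?thesis
    unfolding eq sum.reindex[OF inj] sum.cartesian_product by (simp add: case_prod_unfold)
qed

lemma polyI_words:
  assumes "f \<in> polys X" "homogeneous std d f" "finite X"
  shows "f = (\<Sum>w\<in>words X d. cscale (word_coeff f w) (word_poly w))"
  by (rule poly_words[OF finite_words[OF assms(3)]])
    (use assms in \<open>auto simp: words_def homogeneous_def polys_def length_monom_word\<close>)

text \<open>Besides homogeneous parts this yields the part of fixed degree in one variable and the
  part in prescribed variables.\<close>

definition restrict_monoms :: "(('x \<Rightarrow>\<^sub>0 nat) \<Rightarrow> bool) \<Rightarrow> 'x cpoly \<Rightarrow> 'x cpoly" where
  "restrict_monoms Q f = (\<Sum>m | m \<in> keys f \<and> Q m. single m (lookup f m))"

lemma lookup_restrict_monoms: "lookup (restrict_monoms Q f) m = (if Q m then lookup f m else 0)"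
proof -
  have "lookup (restrict_monoms Q f) m = (\<Sum>n | n \<in> keys f \<and> Q n. if n = m then lookup f n else 0)"
    by (simp add: restrict_monoms_def lookup_sum lookup_single when_def)
  then show ?thesis by (auto simp: sum.delta in_keys_iff)
qed

lemma keys_restrict_monoms: "keys (restrict_monoms Q f) = {m \<in> keys f. Q m}"
  by (auto simp: in_keys_iff lookup_restrict_monoms split: if_splits)

lemma restrict_monoms_add: "restrict_monoms Q (f + g) = restrict_monoms Q f + restrict_monoms Q g"
  by (rule poly_mapping_eqI) (simp add: lookup_restrict_monoms lookup_add)

lemma restrict_monoms_uminus: "restrict_monoms Q (- f) = - restrict_monoms Q f"
  by (rule poly_mapping_eqI) (simp add: lookup_restrict_monoms)

lemma restrict_monoms_0 [simp]: "restrict_monoms Q 0 = 0"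
  by (rule poly_mapping_eqI) (simp add: lookup_restrict_monoms)

lemma restrict_monoms_sum: "restrict_monoms Q (sum f A) = (\<Sum>a\<in>A. restrict_monoms Q (f a))"
  by (induction A rule: infinite_finite_induct) (simp_all add: restrict_monoms_add)

lemma restrict_monoms_cscale: "restrict_monoms Q (cscale c f) = cscale c (restrict_monoms Q f)"
  by (rule poly_mapping_eqI) (simp add: lookup_restrict_monoms lookup_cscale)

lemma restrict_monoms_id: "(\<And>m. m \<in> keys f \<Longrightarrow> Q m) \<Longrightarrow> restrict_monoms Q f = f"
  by (rule poly_mapping_eqI) (auto simp: lookup_restrict_monoms in_keys_iff)

lemma restrict_monoms_single: "restrict_monoms Q (single m c) = (if Q m then single m c else 0)"
  by (rule poly_mapping_eqI) (simp add: lookup_restrict_monoms lookup_single when_def)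

lemma restrict_monoms_single_mult: "restrict_monoms Q (single n c * f) = single n c * restrict_monoms (\<lambda>m. Q (n + m)) f"
proof (induction f rule: cpoly_induct)
  case (single m c)
  then show ?case by (simp add: mult_single restrict_monoms_single)
qed (simp add: algebra_simps restrict_monoms_add)

section \<open>Homogeneous polynomials and homogeneous parts\<close>

lemma homog_part_conv_restrict_monoms: "homog_part w d = restrict_monoms (\<lambda>m. monom_deg w m = d)"
  by (rule ext) (simp add: homog_part_def restrict_monoms_def)

lemma homogeneous_homog_part: "homogeneous w d (homog_part w d f)"
  by (simp add: homog_part_conv_restrict_monoms homogeneous_def keys_restrict_monoms)

lemma homogeneous_add: "homogeneous w d f \<Longrightarrow> homogeneous w d g \<Longrightarrow> homogeneous w d (f + g)"
  using keys_add[of f g] by (auto simp: homogeneous_def)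

lemma homogeneous_0 [simp]: "homogeneous w d 0"
  by (simp add: homogeneous_def)

lemma homogeneous_sum: "(\<And>a. a \<in> A \<Longrightarrow> homogeneous w d (f a)) \<Longrightarrow> homogeneous w d (sum f A)"
  by (induction A rule: infinite_finite_induct) (simp_all add: homogeneous_add)

lemma homogeneous_cscale: "homogeneous w d f \<Longrightarrow> homogeneous w d (cscale c f)"
  using keys_cscale_subset by (fastforce simp: homogeneous_def)

lemma homogeneous_mult:
  "homogeneous w d f \<Longrightarrow> homogeneous w e g \<Longrightarrow> homogeneous w (d + e) (f * g)"
  using keys_mult[of f g] by (fastforce simp: homogeneous_def monom_deg_add)

lemma homogeneous_word_poly: "homogeneous std (length w) (word_poly w)"
  by (simp add: word_poly_conv_single homogeneous_def)

lemma sum_homog_parts: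
  assumes "finite D" "\<And>m. m \<in> keys f \<Longrightarrow> monom_deg w m \<in> D"
  shows "f = (\<Sum>d\<in>D. homog_part w d f)"
proof (rule poly_mapping_eqI)
  fix m
  have "lookup (\<Sum>d\<in>D. homog_part w d f) m = (\<Sum>d\<in>D. if monom_deg w m = d then lookup f m else 0)"
    by (simp add: lookup_sum homog_part_conv_restrict_monoms lookup_restrict_monoms)
  then show "lookup f m = lookup (\<Sum>d\<in>D. homog_part w d f) m"
    using assms by (auto simp: sum.delta in_keys_iff)
qed

section \<open>Polynomials in prescribed variables\<close>

lemma polys_0 [simp]: "0 \<in> polys X"
  by (simp add: polys_def)

lemma polys_add: "f \<in> polys X \<Longrightarrow> g \<in> polys X \<Longrightarrow> f + g \<in> polys X"
  using keys_add[of f g] by (auto simp: polys_def)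

lemma polys_sum: "(\<And>a. a \<in> A \<Longrightarrow> f a \<in> polys X) \<Longrightarrow> sum f A \<in> polys X"
  by (induction A rule: infinite_finite_induct) (simp_all add: polys_add)

lemma polys_cscale: "f \<in> polys X \<Longrightarrow> cscale c f \<in> polys X"
  using keys_cscale_subset by (fastforce simp: polys_def)

lemma polys_mult: "f \<in> polys X \<Longrightarrow> g \<in> polys X \<Longrightarrow> f * g \<in> polys X"
proof -
  assume f: "f \<in> polys X" and g: "g \<in> polys X"
  have "keys m \<subseteq> X" if m: "m \<in> keys (f * g)" for m
  proof -
    obtain a b where ab: "a \<in> keys f" "b \<in> keys g" "m = a + b" using m keys_mult[of f g] by blast
    then show ?thesis using f g keys_add[of a b] unfolding polys_def by blast
  qed
  then show ?thesis by (simp add: polys_def)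
qed

lemma polys_1 [simp]: "1 \<in> polys X"
  by (simp add: polys_def)

lemma polys_power: "f \<in> polys X \<Longrightarrow> f ^ k \<in> polys X"
  by (induction k) (simp_all add: polys_mult)

lemma polys_prod: "(\<And>a. a \<in> A \<Longrightarrow> f a \<in> polys X) \<Longrightarrow> prod f A \<in> polys X"
  by (induction A rule: infinite_finite_induct) (simp_all add: polys_mult)

lemma polys_var: "x \<in> X \<Longrightarrow> var x \<in> polys X"
  by (simp add: polys_def var_def)

lemma polys_word_poly: "set w \<subseteq> X \<Longrightarrow> word_poly w \<in> polys X"
  by (simp add: word_poly_conv_single polys_def keys_word_exponent)

lemma polys_restrict_monoms: "f \<in> polys X \<Longrightarrow> restrict_monoms Q f \<in> polys X"
  by (simp add: polys_def keys_restrict_monoms)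

lemma polys_subst_poly:
  assumes "\<And>x. h x \<in> polys X"
  shows "subst_poly h f \<in> polys X"
  unfolding subst_poly_def by (intro polys_sum polys_cscale polys_prod polys_power assms)

section \<open>Linear substitutions and tensor powers of matrices\<close>

definition lin_subst :: "('y \<Rightarrow> 'x \<Rightarrow> complex) \<Rightarrow> 'y set \<Rightarrow> 'x cpoly \<Rightarrow> 'y cpoly" where
  "lin_subst a Y = subst_poly (\<lambda>j. \<Sum>i\<in>Y. cscale (a i j) (var i))"

lemmas lin_subst_simps = subst_poly_add[of "\<lambda>j. \<Sum>i\<in>Y. cscale (a i j) (var i)" for a Y, folded lin_subst_def]
  subst_poly_mult[of "\<lambda>j. \<Sum>i\<in>Y. cscale (a i j) (var i)" for a Y, folded lin_subst_def]
  subst_poly_sum[of "\<lambda>j. \<Sum>i\<in>Y. cscale (a i j) (var i)" for a Y, folded lin_subst_def]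
  subst_poly_cscale[of "\<lambda>j. \<Sum>i\<in>Y. cscale (a i j) (var i)" for a Y, folded lin_subst_def]
  subst_poly_uminus[of "\<lambda>j. \<Sum>i\<in>Y. cscale (a i j) (var i)" for a Y, folded lin_subst_def]
  subst_poly_diff[of "\<lambda>j. \<Sum>i\<in>Y. cscale (a i j) (var i)" for a Y, folded lin_subst_def]
  subst_poly_0[of "\<lambda>j. \<Sum>i\<in>Y. cscale (a i j) (var i)" for a Y, folded lin_subst_def]
  subst_poly_1[of "\<lambda>j. \<Sum>i\<in>Y. cscale (a i j) (var i)" for a Y, folded lin_subst_def]

lemma lin_subst_var: "lin_subst a Y (var j) = (\<Sum>i\<in>Y. cscale (a i j) (var i))"
  by (simp add: lin_subst_def)

lemma polys_lin_subst: "lin_subst a Y f \<in> polys Y"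
  unfolding lin_subst_def by (rule polys_subst_poly) (intro polys_sum polys_cscale polys_var)

text \<open>The entries of the tensor powers of \<open>a\<close> in the basis of words; entries
  between words of different lengths are 0.\<close>

primrec word_mat :: "('y \<Rightarrow> 'x \<Rightarrow> complex) \<Rightarrow> 'y list \<Rightarrow> 'x list \<Rightarrow> complex" where
  "word_mat a [] v = (if v = [] then 1 else 0)"
| "word_mat a (i # u) v = (case v of [] \<Rightarrow> 0 | j # v' \<Rightarrow> a i j * word_mat a u v')"

lemma word_mat_length: "length u \<noteq> length v \<Longrightarrow> word_mat a u v = 0"
  by (induction u arbitrary: v) (auto split: list.split)

text \<open>The product of the images of the letters is multiplied out without collecting equal
  monomials. The coefficients therefore are entries of a tensor power, which is functorial in
  \<open>a\<close>.\<close>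

lemma lin_subst_word_poly: "lin_subst a Y (word_poly w) = (\<Sum>u\<in>words Y (length w). cscale (word_mat a u w) (word_poly u))"
proof (induction w)
  case Nil
  then show ?case by (simp add: lin_subst_simps)
next
  case (Cons j w)
  then show ?case
    by (simp add: lin_subst_simps lin_subst_var sum_words_Suc sum_product cscale_mult_left cscale_mult_right mult.commute)
qed

lemma lin_subst_cong:
  assumes "f \<in> polys X" "\<And>i j. i \<in> Y \<Longrightarrow> j \<in> X \<Longrightarrow> a i j = b i j"
  shows "lin_subst a Y f = lin_subst b Y f"
  unfolding lin_subst_def by (rule subst_poly_cong[OF assms(1)]) (simp add: assms(2))

lemma lin_subst_lin_subst:
  assumes "finite Y"
  shows "lin_subst a Z (lin_subst b Y f) = lin_subst (\<lambda>i j. \<Sum>k\<in>Y. a i k * b k j) Z f"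
proof -
  have "(\<Sum>i\<in>Y. cscale (b i j) (\<Sum>k\<in>Z. cscale (a k i) (var k))) =
      (\<Sum>i\<in>Z. cscale (\<Sum>k\<in>Y. a i k * b k j) (var i))" for j
    unfolding cscale_sum_right cpoly.scale_sum_left cscale_simps
    by (subst sum.swap) (simp add: mult.commute)
  then show ?thesis
    unfolding lin_subst_def by (simp add: subst_poly_comp subst_poly_sum subst_poly_cscale)
qed

lemma lin_subst_id:
  assumes "f \<in> polys X" "finite X" "\<And>i j. i \<in> X \<Longrightarrow> j \<in> X \<Longrightarrow> a i j = (if i = j then 1 else 0)"
  shows "lin_subst a X f = f"
proof -
  have var_id: "subst_poly var f = f"
    unfolding subst_poly_def
  proof -
    have "(\<Prod>x\<in>keys m. var x ^ lookup m x) = single m 1" for m :: "'a \<Rightarrow>\<^sub>0 nat"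
    proof -
      have "mon_val var (word_exponent w) = word_poly w" for w :: "'a list"
        by (induction w) (simp_all add: word_exponent_Cons mon_val_add)
      then show ?thesis by (metis mon_val_def word_exponent_monom_word word_poly_conv_single)
    qed
    then show "(\<Sum>m\<in>keys f. cscale (lookup f m) (\<Prod>x\<in>keys m. var x ^ lookup m x)) = f"
      by (simp add: cscale_single flip: poly_as_sum)
  qed
  have "(\<Sum>i\<in>X. cscale (a i j) (var i)) = var j" if "j \<in> X" for j
  proof -
    have "(\<Sum>i\<in>X. cscale (a i j) (var i)) = (\<Sum>i\<in>X. if i = j then var i else 0)"
      by (rule sum.cong) (use assms that in auto)
    then show ?thesis using assms that by simp
  qed
  then have "lin_subst a X f = subst_poly var f"
    unfolding lin_subst_def by (intro subst_poly_cong[OF assms(1)])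
  then show ?thesis using var_id by simp
qed

lemma homogeneous_lin_subst:
  assumes "homogeneous std d f"
  shows "homogeneous std d (lin_subst a Y f)"
proof -
  have "homogeneous std d (cscale c (lin_subst a Y (single m 1)))" if "m \<in> keys f" for m c
  proof -
    have "single m 1 = word_poly (monom_word m)" by (simp add: word_poly_conv_single)
    moreover have "length (monom_word m) = d" using assms that by (simp add: homogeneous_def length_monom_word)
    moreover have "homogeneous std d (word_poly u)" if "u \<in> words Y d" for u
      using homogeneous_word_poly[of u] that by (simp add: words_def)
    ultimately show ?thesis
      by (auto simp: lin_subst_word_poly intro!: homogeneous_cscale homogeneous_sum)
  qed
  then have "homogeneous std d (\<Sum>m\<in>keys f. cscale (lookup f m) (lin_subst a Y (single m 1)))"
    by (intro homogeneous_sum)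
  also have "(\<Sum>m\<in>keys f. cscale (lookup f m) (lin_subst a Y (single m 1))) =
      lin_subst a Y (\<Sum>m\<in>keys f. cscale (lookup f m) (single m 1))"
    by (simp only: lin_subst_simps)
  also have "\<dots> = lin_subst a Y f"
    by (simp add: cscale_single flip: poly_as_sum)
  finally show ?thesis .
qed

section \<open>Koszul complexes\<close>

text \<open>The exterior power \<open>A \<otimes> \<Lambda>\<^sup>p A\<^sup>I\<close> is encoded as alternating functions on lists over \<open>I\<close>
  of length \<open>p\<close>, vanishing elsewhere. The Koszul differential becomes contraction with \<open>f\<close> in the
  first argument, without signs.\<close>

definition alternating :: "('i list \<Rightarrow> 'm::ab_group_add) \<Rightarrow> bool" where
  "alternating z \<longleftrightarrow> (\<forall>u i j v. z (u @ i # j # v) = - z (u @ j # i # v))"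

definition koszul :: "'i set \<Rightarrow> nat \<Rightarrow> ('i list \<Rightarrow> 'm::ab_group_add) \<Rightarrow> bool" where
  "koszul I p z \<longleftrightarrow> alternating z \<and> (\<forall>l. l \<notin> words I p \<longrightarrow> z l = 0)"

definition koszul_d :: "'i set \<Rightarrow> ('i \<Rightarrow> 'a::comm_ring_1) \<Rightarrow> ('i list \<Rightarrow> 'a) \<Rightarrow> 'i list \<Rightarrow> 'a" where
  "koszul_d I f z l = (\<Sum>i\<in>I. f i * z (i # l))"

lemma alternating_Cons: "alternating z \<Longrightarrow> alternating (\<lambda>l. z (i # l))"
  unfolding alternating_def by (metis append_Cons)

lemma alternating_swap: "alternating z \<Longrightarrow> z (i # j # v) = - z (j # i # v)"
  unfolding alternating_def by (metis append_Nil)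

lemma altD: "alternating z \<Longrightarrow> z (u @ i # j # v) = - z (u @ j # i # v)"
  unfolding alternating_def by blast

lemma alternating_0 [simp]: "alternating (\<lambda>l. 0)"
  by (simp add: alternating_def)

lemma alternating_map: "alternating z \<Longrightarrow> (\<And>a. h (- a) = - h a) \<Longrightarrow> alternating (\<lambda>l. h (z l))"
  unfolding alternating_def by metis

lemma alternating_add: "alternating z \<Longrightarrow> alternating y \<Longrightarrow> alternating (\<lambda>l. z l + y l)"
  unfolding alternating_def by (metis add.inverse_distrib_swap add.commute)

lemma alternating_uminus: "alternating z \<Longrightarrow> alternating (\<lambda>l. - z l)"
  by (rule alternating_map) simp_all

lemma alternating_diff: "alternating z \<Longrightarrow> alternating y \<Longrightarrow> alternating (\<lambda>l. z l - y l)"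
  using alternating_add[OF _ alternating_uminus, of z y] by simp

lemma alternating_sum: "(\<And>a. a \<in> A \<Longrightarrow> alternating (z a)) \<Longrightarrow> alternating (\<lambda>l. \<Sum>a\<in>A. z a l)"
  by (induction A rule: infinite_finite_induct) (simp_all add: alternating_add)

lemma alternating_mult: "alternating z \<Longrightarrow> alternating (\<lambda>l. a * (z l :: 'a::ring))"
  by (rule alternating_map) simp_all

lemma koszul_alternating: "koszul I p z \<Longrightarrow> alternating z"
  by (simp add: koszul_def)

lemma koszul_outside: "koszul I p z \<Longrightarrow> l \<notin> words I p \<Longrightarrow> z l = 0"
  by (simp add: koszul_def)

lemma koszul_compose: "koszul I p z \<Longrightarrow> (\<And>a. h (- a) = - h a) \<Longrightarrow> h 0 = 0 \<Longrightarrow> koszul I p (\<lambda>l. h (z l))"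
  by (simp add: koszul_def alternating_map)

lemma koszul_add: "koszul I p z \<Longrightarrow> koszul I p y \<Longrightarrow> koszul I p (\<lambda>l. z l + y l)"
  by (simp add: koszul_def alternating_add)

lemma koszul_diff: "koszul I p z \<Longrightarrow> koszul I p y \<Longrightarrow> koszul I p (\<lambda>l. z l - y l)"
  by (simp add: koszul_def alternating_diff)

lemma koszul_koszul_d: "koszul I (Suc p) z \<Longrightarrow> koszul I p (koszul_d I f z)"
  by (auto simp: koszul_def koszul_d_def[abs_def] intro!: alternating_sum alternating_mult alternating_Cons sum.neutral)

lemma koszul_d_diff: "koszul_d I f (\<lambda>l. z l - y l) l = koszul_d I f z l - koszul_d I f y l"
  by (simp add: koszul_d_def algebra_simps sum_subtractf)

lemma koszul_d_add: "koszul_d I f (\<lambda>l. z l + y l) l = koszul_d I f z l + koszul_d I f y l"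
  by (simp add: koszul_d_def algebra_simps sum.distrib)

lemma koszul_d_mult: "koszul_d I f (\<lambda>l. a * z l) l = a * koszul_d I f z l"
  by (simp add: koszul_d_def sum_distrib_left mult_ac)

text \<open>Characteristic 0 enters here: antisymmetry implies vanishing on repeated
  indices.\<close>

lemma cpoly_eq_uminus:
  assumes "(f :: 'x cpoly) = - f"
  shows "f = 0"
proof (rule poly_mapping_eqI)
  fix k
  have "lookup f k = - lookup f k" using arg_cong[OF assms, of "\<lambda>f. lookup f k"] by simp
  then show "lookup f k = lookup 0 k" by (simp add: equation_minus_iff)
qed

text \<open>Transpositions move the first \<open>i\<close> through \<open>v\<close> until it stands
  next to the second one.\<close>

lemma alternating_repeat:
  fixes z :: "'i list \<Rightarrow> 'x cpoly"
  assumes "alternating z"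
  shows "z (u @ i # v @ i # w) = 0"
proof (induction v arbitrary: u)
  case Nil
  have "z (u @ i # i # w) = - z (u @ i # i # w)"
    using assms by (rule altD)
  then show ?case by (simp add: cpoly_eq_uminus)
next
  case (Cons j v)
  have "z (u @ i # j # v @ i # w) = - z ((u @ [j]) @ i # v @ i # w)"
    using altD[OF assms, of u i j "v @ i # w"] by simp
  then show ?case using Cons[of "u @ [j]"] by simp
qed

lemma alternating_not_distinct:
  fixes z :: "'i list \<Rightarrow> 'x cpoly"
  assumes "alternating z" "\<not> distinct l"
  shows "z l = 0"
proof -
  obtain u v w i where "l = u @ [i] @ v @ [i] @ w"
    using not_distinct_decomp[OF assms(2)] by blast
  then show ?thesis using alternating_repeat[OF assms(1)] by simp
qed

text \<open>The double sum has symmetric coefficients and an antisymmetric chain, so exchanging the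
  two summation indices shows that it is its own negative.\<close>

lemma koszul_d_koszul_d:
  fixes z :: "'i list \<Rightarrow> 'x cpoly"
  assumes "alternating z"
  shows "koszul_d I f (koszul_d I f z) l = 0"
proof (rule cpoly_eq_uminus)
  have "koszul_d I f (koszul_d I f z) l = (\<Sum>i\<in>I. \<Sum>j\<in>I. f i * f j * z (j # i # l))"
    by (simp add: koszul_d_def sum_distrib_left mult.assoc)
  also have "\<dots> = (\<Sum>j\<in>I. \<Sum>i\<in>I. f i * f j * z (j # i # l))"
    by (rule sum.swap)
  also have "\<dots> = (\<Sum>j\<in>I. \<Sum>i\<in>I. - (f j * f i * z (i # j # l)))"
    by (intro sum.cong refl) (subst alternating_swap[OF assms], simp)
  also have "\<dots> = - koszul_d I f (koszul_d I f z) l"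
    by (simp add: koszul_d_def sum_distrib_left mult.assoc sum_negf)
  finally show "koszul_d I f (koszul_d I f z) l = - koszul_d I f (koszul_d I f z) l" .
qed

text \<open>Exterior multiplication by the one-chain \<open>c\<close> from the left: each argument
  in turn is fed to \<open>c\<close> and the others to \<open>z\<close>, with alternating signs. The
  sign arises when \<open>c\<close> passes the head of the list.\<close>

primrec wedge :: "('i \<Rightarrow> 'a::comm_ring_1) \<Rightarrow> 'i list \<Rightarrow> ('i list \<Rightarrow> 'a) \<Rightarrow> 'a" where
  "wedge c [] z = 0"
| "wedge c (i # l) z = c i * z l - wedge c l (\<lambda>l. z (i # l))"

lemma wedge_0: "wedge c l (\<lambda>l. 0) = 0"
  by (induction l) simp_all

lemma wedge_add: "wedge c l (\<lambda>l. z l + y l) = wedge c l z + wedge c l y"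
  by (induction l arbitrary: z y) (simp_all add: algebra_simps)

lemma wedge_mult: "wedge c l (\<lambda>l. a * z l) = a * wedge c l z"
  by (induction l arbitrary: z) (simp_all add: algebra_simps)

lemma wedge_uminus: "wedge c l (\<lambda>l. - z l) = - wedge c l z"
  using wedge_mult[of c l "-1" z] by simp

lemma wedge_sum: "wedge c l (\<lambda>l. \<Sum>i\<in>A. f i * z i l) = (\<Sum>i\<in>A. f i * wedge c l (z i))"
  by (induction A rule: infinite_finite_induct) (simp_all add: wedge_0 wedge_add wedge_mult)

text \<open>The graded Leibniz rule. It takes a single unfolding, because contraction uses the first
  argument and \<open>wedge\<close> recurses on it.\<close>

lemma koszul_d_wedge:
  "koszul_d I f (\<lambda>l. wedge c l z) l = (\<Sum>i\<in>I. f i * c i) * z l - wedge c l (koszul_d I f z)"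
  unfolding koszul_d_def[abs_def] wedge_sum
  by (simp add: algebra_simps sum_subtractf sum_distrib_left)

lemma alternating_wedge: "alternating z \<Longrightarrow> alternating (\<lambda>l. wedge c l z)"
proof -
  have "alternating z \<Longrightarrow> wedge c (u @ i # j # v) z = - wedge c (u @ j # i # v) z" for u i j v
  proof (induction u arbitrary: z)
    case Nil
    have "wedge c v (\<lambda>l. z (i # j # l)) = - wedge c v (\<lambda>l. z (j # i # l))"
      by (simp add: alternating_swap[OF Nil, of i j] wedge_uminus)
    then show ?case by (simp add: algebra_simps)
  next
    case (Cons k u)
    have "z (u @ i # j # v) = - z (u @ j # i # v)" using Cons.prems by (rule altD)
    then show ?case using Cons.IH[OF alternating_Cons[OF Cons.prems]] by simp
  qed
  then show "alternating z \<Longrightarrow> alternating (\<lambda>l. wedge c l z)" unfolding alternating_def[of "\<lambda>l. wedge c l z"] by blast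
qed

lemma wedge_nonzeroD:
  "wedge c l z \<noteq> 0 \<Longrightarrow> \<exists>u i v. l = u @ i # v \<and> c i \<noteq> 0 \<and> z (u @ v) \<noteq> 0"
proof (induction l arbitrary: z)
  case (Cons j l)
  show ?case
  proof (cases "c j * z l = 0")
    case True
    then have "wedge c l (\<lambda>l. z (j # l)) \<noteq> 0" using Cons.prems by auto
    then obtain u i v where "l = u @ i # v" "c i \<noteq> 0" "z (j # u @ v) \<noteq> 0"
      using Cons.IH by blast
    then show ?thesis by (intro exI[of _ "j # u"]) auto
  next
    case False
    then show ?thesis by (intro exI[of _ "[]"]) auto
  qed
qed simp

lemma koszul_wedge:
  assumes "koszul I p z" "\<And>i. i \<notin> I \<Longrightarrow> c i = 0"
  shows "koszul I (Suc p) (\<lambda>l. wedge c l z)"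
proof -
  have "l \<in> words I (Suc p)" if "wedge c l z \<noteq> 0" for l
  proof -
    obtain u i v where l: "l = u @ i # v" "c i \<noteq> 0" "z (u @ v) \<noteq> 0"
      using wedge_nonzeroD[OF \<open>wedge c l z \<noteq> 0\<close>] by blast
    then have "i \<in> I" "u @ v \<in> words I p" using assms by (auto simp: koszul_def)
    then show ?thesis using l by (auto simp: words_def)
  qed
  then show ?thesis using assms(1) alternating_wedge by (auto simp: koszul_def)
qed

text \<open>Membership in the ideal generated by the powers x^k with x in \<open>X\<close>. Being a
  monomial ideal, it can be tested on monomials, which replaces computing in the quotient
  ring.\<close>

definition in_powers :: "nat \<Rightarrow> 'x set \<Rightarrow> 'x cpoly \<Rightarrow> bool" where
  "in_powers k X a \<longleftrightarrow> (\<forall>m\<in>keys a. \<exists>x\<in>X. k \<le> lookup m x)"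

lemma in_powers_0 [simp]: "in_powers k X 0"
  by (simp add: in_powers_def)

lemma in_powers_empty: "in_powers k {} a \<longleftrightarrow> a = 0"
  by (auto simp: in_powers_def)

lemma in_powers_add: "in_powers k X a \<Longrightarrow> in_powers k X b \<Longrightarrow> in_powers k X (a + b)"
  unfolding in_powers_def using keys_add[of a b] by blast

lemma in_powers_mult: "in_powers k X a \<Longrightarrow> in_powers k X (b * a)"
proof -
  assume a: "in_powers k X a"
  have "\<exists>x\<in>X. k \<le> lookup m x" if "m \<in> keys (b * a)" for m
  proof -
    obtain u v where uv: "v \<in> keys a" "m = u + v" using \<open>m \<in> keys (b * a)\<close> keys_mult[of b a] by blast
    then obtain x where "x \<in> X" "k \<le> lookup v x" using a by (auto simp: in_powers_def)
    then show ?thesis using uv by (intro bexI[of _ x]) (auto simp: lookup_add)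
  qed
  then show ?thesis by (simp add: in_powers_def)
qed

lemma in_powers_uminus: "in_powers k X a \<Longrightarrow> in_powers k X (- a)"
  by (simp add: in_powers_def in_keys_iff)

lemma in_powers_diff: "in_powers k X a \<Longrightarrow> in_powers k X b \<Longrightarrow> in_powers k X (a - b)"
  using in_powers_add[OF _ in_powers_uminus, of k X a b] by simp

lemma in_powers_sum: "(\<And>i. i \<in> A \<Longrightarrow> in_powers k X (a i)) \<Longrightarrow> in_powers k X (sum a A)"
  by (induction A rule: infinite_finite_induct) (simp_all add: in_powers_add)

lemma in_powers_mono: "in_powers k X a \<Longrightarrow> X \<subseteq> Y \<Longrightarrow> in_powers k Y a"
  by (meson in_powers_def subsetD)

lemma var_power: "var x ^ k = single (single x k) 1"
  by (induction k) (simp_all add: single_one var_def mult_single flip: single_add)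

lemma in_powers_var: "x \<in> X \<Longrightarrow> in_powers k X (var x ^ k)"
  by (auto simp: in_powers_def var_power intro!: bexI[of _ x])

lemma lookup_single_mult: "lookup (single n c * (f :: 'x cpoly)) (n + m) = c * lookup f m"
  by (induction f rule: cpoly_induct)
    (auto simp: mult_single lookup_single lookup_add algebra_simps when_def)

text \<open>Regularity of the sequence of powers: x^k is no zero divisor modulo powers of other
  variables.\<close>

lemma in_powers_cancel:
  assumes "in_powers k X (var x ^ k * a)" "x \<notin> X"
  shows "in_powers k X a"
  unfolding in_powers_def
proof
  fix m assume "m \<in> keys a"
  then have "single x k + m \<in> keys (var x ^ k * a)"
    by (simp add: var_power in_keys_iff lookup_single_mult)
  then obtain y where y: "y \<in> X" "k \<le> lookup (single x k + m) y"
    using assms(1) by (auto simp: in_powers_def)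
  then show "\<exists>y\<in>X. k \<le> lookup m y"
    using assms(2) by (auto simp: lookup_add lookup_single when_def split: if_splits)
qed

text \<open>Monomials divisible by x^k are divided by it and the others are dropped. The operation
  is additive, so it can be applied to Koszul chains value by value.\<close>

definition divide_power :: "nat \<Rightarrow> 'x \<Rightarrow> 'x cpoly \<Rightarrow> 'x cpoly" where
  "divide_power k x a = Poly_Mapping.map_key (\<lambda>m. single x k + m) a"

lemma lookup_divide_power: "lookup (divide_power k x a) m = lookup a (single x k + m)"
  unfolding divide_power_def by (subst map_key.rep_eq) (simp_all add: inj_def)

lemma divide_power_uminus: "divide_power k x (- a) = - divide_power k x a"
  by (rule poly_mapping_eqI) (simp add: lookup_divide_power)

lemma divide_power_0 [simp]: "divide_power k x 0 = 0"
  by (rule poly_mapping_eqI) (simp add: lookup_divide_power)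

text \<open>The difference consists of the monomials not divisible by x^k, and each of these must be
  divisible by one of the other powers.\<close>

lemma in_powers_divide_power:
  assumes "in_powers k (insert x X) a"
  shows "in_powers k X (a - var x ^ k * divide_power k x a)"
  unfolding in_powers_def
proof
  fix m assume m: "m \<in> keys (a - var x ^ k * divide_power k x a)"
  have nk: "\<not> k \<le> lookup m x"
  proof
    assume "k \<le> lookup m x"
    then have "m = single x k + (m - single x k)"
      by (intro poly_mapping_eqI) (auto simp: lookup_add lookup_minus lookup_single when_def)
    then obtain m' where m': "m = single x k + m'" by (rule that)
    have "lookup (a - var x ^ k * divide_power k x a) m = 0"
      unfolding m' var_power lookup_minus lookup_single_mult lookup_divide_power by simp
    then show False using m by (simp add: in_keys_iff)
  qed
  have "m \<notin> keys (var x ^ k * divide_power k x a)"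
  proof
    assume "m \<in> keys (var x ^ k * divide_power k x a)"
    then obtain n m' where "n \<in> keys (var x ^ k)" "m = n + m'"
      using keys_mult[of "var x ^ k" "divide_power k x a"] by blast
    then have "m = single x k + m'" by (simp add: var_power)
    then have "lookup m x = k + lookup m' x" by (simp add: lookup_add)
    then show False using nk by simp
  qed
  then have "m \<in> keys a" using m keys_diff[of a "var x ^ k * divide_power k x a"] 
    by (auto simp: in_keys_iff lookup_minus)
  then show "\<exists>y\<in>X. k \<le> lookup m y" using assms nk by (auto simp: in_powers_def)
qed

primrec wedges :: "('x \<Rightarrow> 'i \<Rightarrow> 'a::comm_ring_1) \<Rightarrow> 'x list \<Rightarrow> ('i list \<Rightarrow> 'a) \<Rightarrow> 'i list \<Rightarrow> 'a" where
  "wedges c [] z = z"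
| "wedges c (x # xs) z = (\<lambda>l. wedge (c x) l (wedges c xs z))"

lemma koszul_wedges:
  assumes "koszul I p z" "\<And>x i. i \<notin> I \<Longrightarrow> c x i = 0"
  shows "koszul I (length xs + p) (wedges c xs z)"
proof (induction xs)
  case (Cons x xs)
  then show ?case using koszul_wedge[OF _ assms(2)] by simp
qed (simp add: assms)

lemma in_powers_wedge: "(\<And>l. in_powers k X (z l)) \<Longrightarrow> in_powers k X (wedge c l z)"
proof (induction l arbitrary: z)
  case (Cons i l)
  then show ?case
    using in_powers_diff[OF in_powers_mult[OF Cons.prems] Cons.IH[of "\<lambda>l. z (i # l)"]] by simp
qed simp

text \<open>Each application of the Leibniz rule contributes a multiple of some x^k, and
  \<open>z\<close> itself is a cycle; so the product is a cycle modulo the powers.\<close>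

lemma koszul_d_wedges:
  assumes "\<And>x. x \<in> set xs \<Longrightarrow> (\<Sum>i\<in>I. f i * c x i) = var x ^ k" "\<And>l. koszul_d I f z l = 0"
  shows "in_powers k (set xs) (koszul_d I f (wedges c xs z) l)"
  using assms(1)
proof (induction xs arbitrary: l)
  case Nil
  then show ?case by (simp add: assms(2))
next
  case (Cons x xs)
  have "in_powers k (set (x # xs)) (koszul_d I f (wedges c xs z) l)" for l
    by (rule in_powers_mono[OF Cons.IH]) (simp_all add: Cons.prems subset_insertI)
  then have "in_powers k (set (x # xs)) (wedge (c x) l (koszul_d I f (wedges c xs z)))"
    by (rule in_powers_wedge)
  moreover have "in_powers k (set (x # xs)) (wedges c xs z l * var x ^ k)"
    by (intro in_powers_mult in_powers_var) simp
  moreover have "koszul_d I f (wedges c (x # xs) z) l =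
      wedges c xs z l * var x ^ k - wedge (c x) l (koszul_d I f (wedges c xs z))"
    unfolding wedges.simps koszul_d_wedge using Cons.prems[of x] by (simp only: list.set_intros mult.commute)
  ultimately show ?case by (metis in_powers_diff)
qed

text \<open>Cancelling one \<open>x\<^sup>k\<close> after the other: if \<open>c\<^sub>x \<and> w\<close> is a boundary modulo the first \<open>j\<close> powers,
  then applying the differential shows that \<open>x\<^sup>k w\<close>, hence \<open>w\<close>, is a boundary modulo the first
  \<open>j - 1\<close> powers, because the powers form a regular sequence.\<close>

lemma koszul_descent:
  assumes z: "koszul I p z" "\<And>l. koszul_d I f z l = 0"
    and c: "\<And>x i. i \<notin> I \<Longrightarrow> c x i = 0"
      "\<And>x. x \<in> set xs \<Longrightarrow> (\<Sum>i\<in>I. f i * c x i) = var x ^ k"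
    and xs: "distinct xs"
    and u: "koszul I (Suc (length xs + p)) u" "\<And>l. in_powers k (set xs) (wedges c xs z l - koszul_d I f u l)"
  shows "\<exists>y. koszul I (Suc p) y \<and> z = koszul_d I f y"
  using c(2) xs u
proof (induction xs arbitrary: u)
  case Nil
  have "z l = koszul_d I f u l" for l using Nil(4)[of l] by (simp add: in_powers_empty)
  then have "z = koszul_d I f u" by (rule ext)
  then show ?case using Nil(3) by (intro exI[of _ u] conjI) simp_all
next
  case (Cons x xs)
  define r where "r l = wedges c (x # xs) z l - koszul_d I f u l" for l
  \<comment> \<open>The part of the error divisible by x^k, divided by it, is the next correcting
    chain. What remains of the error lies in the ideal of the remaining powers.\<close>
  define v where "v l = divide_power k x (r l)" for l
  have W: "koszul I (length xs + p) (wedges c xs z)" using koszul_wedges[OF z(1) c(1)] .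
  have r: "koszul I (Suc (length xs + p)) r"
    unfolding r_def using koszul_wedges[OF z(1) c(1), where xs = "x # xs"] koszul_koszul_d Cons.prems(3)
    by (intro koszul_diff) simp_all
  have v: "koszul I (Suc (length xs + p)) v"
    unfolding v_def by (rule koszul_compose[OF r]) (simp_all add: divide_power_uminus)
  have inp: "in_powers k (set xs) (r l - var x ^ k * v l)" for l
    unfolding v_def by (rule in_powers_divide_power) (use Cons.prems(4)[of l] in \<open>simp add: r_def\<close>)
  have kdin: "in_powers k (set xs) (koszul_d I f (wedges c xs z) l)" for l
    by (rule koszul_d_wedges) (use Cons.prems z in auto)
  have "in_powers k (set xs) (wedges c xs z l - koszul_d I f v l)" for l
  proof (rule in_powers_cancel)
    \<comment> \<open>The differential removes \<open>u\<close> and, modulo the remaining powers,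
      leaves x^k times the shorter product on one side and x^k times \<open>koszul_d I f v\<close>
      on the other.\<close>
    have "koszul_d I f r l = koszul_d I f (wedges c (x # xs) z) l - koszul_d I f (koszul_d I f u) l"
      unfolding r_def by (rule koszul_d_diff)
    also have "\<dots> = var x ^ k * wedges c xs z l - wedge (c x) l (koszul_d I f (wedges c xs z))"
      using Cons.prems(1) by (simp add: koszul_d_wedge koszul_d_koszul_d[OF koszul_alternating[OF Cons.prems(3)]])
    finally have "var x ^ k * (wedges c xs z l - koszul_d I f v l)
        = koszul_d I f (\<lambda>l. r l - var x ^ k * v l) l + wedge (c x) l (koszul_d I f (wedges c xs z))"
      by (simp only: koszul_d_diff koszul_d_mult) (simp add: algebra_simps)
    moreover have "in_powers k (set xs) (koszul_d I f (\<lambda>l. r l - var x ^ k * v l) l)"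
      unfolding koszul_d_def by (intro in_powers_sum in_powers_mult inp)
    ultimately show "in_powers k (set xs) (var x ^ k * (wedges c xs z l - koszul_d I f v l))"
      using in_powers_add[OF _ in_powers_wedge[OF kdin]] by simp
  qed (use Cons.prems(2) in simp)
  then show ?case using Cons.prems v by (intro Cons.IH[of v]) simp_all
qed

text \<open>The descent with exponent 1 and with unit vectors for \<open>c\<close>. Their product
  with a chain of positive degree vanishes, since it would need more than \<open>card B\<close>
  distinct indices.\<close>

lemma koszul_exact:
  fixes z :: "'x list \<Rightarrow> 'x cpoly"
  assumes B: "finite B" and z: "koszul B p z" "p > 0" "\<And>l. koszul_d B var z l = 0"
  shows "\<exists>y. koszul B (Suc p) y \<and> z = koszul_d B var y"
proof -
  obtain xs where xs: "set xs = B" "distinct xs" using finite_distinct_list[OF B] by blast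
  define c :: "'x \<Rightarrow> 'x \<Rightarrow> 'x cpoly" where "c x i = (if x = i \<and> i \<in> B then 1 else 0)" for x i
  have W: "koszul B (length xs + p) (wedges c xs z)"
    by (rule koszul_wedges[OF z(1)]) (simp add: c_def)
  have "wedges c xs z l = 0" for l
  proof (cases "l \<in> words B (length xs + p) \<and> distinct l")
    case True
    then have "card (set l) = card B + p"
      using distinct_card[of l] distinct_card[of xs] xs by (auto simp: words_def)
    moreover have "card (set l) \<le> card B" using True B by (intro card_mono) (auto simp: words_def)
    ultimately show ?thesis using z(2) by simp
  next
    case False
    then consider "l \<notin> words B (length xs + p)" | "\<not> distinct l" by blast
    then show ?thesis
      by cases (use koszul_outside[OF W] alternating_not_distinct[OF koszul_alternating[OF W]] in auto)
  qed
  then show ?thesis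
  proof (intro koszul_descent[where c = c and xs = xs and k = 1 and u = "\<lambda>l. 0"])
    show "(\<Sum>i\<in>B. var i * c x i) = var x ^ 1" if "x \<in> set xs" for x
      using that B xs(1) by (simp add: c_def if_distrib cong: if_cong)
  qed (use xs z in \<open>auto simp: koszul_def c_def koszul_d_def\<close>)
qed

section \<open>Comparing Tor with Koszul homology\<close>

definition koszul_d_mod :: "('x, 'm::ab_group_add) gmod \<Rightarrow> 'x set \<Rightarrow> ('x list \<Rightarrow> 'm) \<Rightarrow> 'x list \<Rightarrow> 'm" where
  "koszul_d_mod M B z l = (\<Sum>b\<in>B. gact M (var b) (z (b # l)))"

definition koszul_mod :: "('x, 'm::ab_group_add) gmod \<Rightarrow> 'x set \<Rightarrow> nat \<Rightarrow> ('x list \<Rightarrow> 'm) \<Rightarrow> bool" where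
  "koszul_mod M B j z \<longleftrightarrow> koszul B j z \<and> (\<forall>l. z l \<in> gcarrier M)"

definition graded_fun :: "('x, 'm::ab_group_add) gmod \<Rightarrow> ('x \<Rightarrow> nat) \<Rightarrow> nat \<Rightarrow> ('x list \<Rightarrow> 'm) \<Rightarrow> bool" where
  "graded_fun M w d z \<longleftrightarrow> (\<forall>l. z l = 0 \<or> (\<exists>e. e + sum_list (map w l) = d \<and> z l \<in> gpart M e))"

text \<open>The record \<open>gmod\<close> carries no axioms; these are the ones on which the zigzag
  rests. Division by 2 in the last clause serves to make sections odd in
  \<open>lift_koszul_mod\<close>.\<close>

definition abelian_gmod :: "'x set \<Rightarrow> ('x, 'm::ab_group_add) gmod \<Rightarrow> bool" where
  "abelian_gmod B M \<longleftrightarrow> 0 \<in> gcarrier M \<and>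
     (\<forall>x\<in>gcarrier M. \<forall>y\<in>gcarrier M. x - y \<in> gcarrier M) \<and>
     (\<forall>s\<in>polys B. \<forall>x\<in>gcarrier M. gact M s x \<in> gcarrier M) \<and>
     (\<forall>s x y. gact M s (x - y) = gact M s x - gact M s y) \<and>
     (\<forall>x. gact M (single 0 (1 / 2)) (x + x) = x)"

lemma abelian_gmodD:
  assumes "abelian_gmod B M"
  shows "0 \<in> gcarrier M" "x \<in> gcarrier M \<Longrightarrow> y \<in> gcarrier M \<Longrightarrow> x - y \<in> gcarrier M"
    "s \<in> polys B \<Longrightarrow> x \<in> gcarrier M \<Longrightarrow> gact M s x \<in> gcarrier M"
    "gact M s (x - y) = gact M s x - gact M s y" "gact M (single 0 (1 / 2)) (x + x) = x"
    "x \<in> gcarrier M \<Longrightarrow> - x \<in> gcarrier M"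
    "x \<in> gcarrier M \<Longrightarrow> y \<in> gcarrier M \<Longrightarrow> x + y \<in> gcarrier M"
    "gact M s 0 = 0" "gact M s (- x) = - gact M s x" "gact M s (x + y) = gact M s x + gact M s y"
proof -
  note a = assms[unfolded abelian_gmod_def]
  show c0: "0 \<in> gcarrier M" and cd: "x \<in> gcarrier M \<Longrightarrow> y \<in> gcarrier M \<Longrightarrow> x - y \<in> gcarrier M"
    and "s \<in> polys B \<Longrightarrow> x \<in> gcarrier M \<Longrightarrow> gact M s x \<in> gcarrier M" 
    and d: "gact M s (x - y) = gact M s x - gact M s y"
    and "gact M (single 0 (1 / 2)) (x + x) = x" for x y s
    using a by auto
  show u: "x \<in> gcarrier M \<Longrightarrow> - x \<in> gcarrier M" for x using cd[OF c0, of x] by simp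
  show "x \<in> gcarrier M \<Longrightarrow> y \<in> gcarrier M \<Longrightarrow> x + y \<in> gcarrier M" using cd[OF _ u, of x y] by simp
  show g0: "gact M s 0 = 0" for s using d[of s 0 0] by simp
  show gu: "gact M s (- x) = - gact M s x" for s x using d[of s 0 x] g0 by simp
  show "gact M s (x + y) = gact M s x + gact M s y" using d[of s x "- y"] gu by simp
qed

lemma gcarrier_sum:
  "abelian_gmod B M \<Longrightarrow> (\<And>a. a \<in> A \<Longrightarrow> f a \<in> gcarrier M) \<Longrightarrow> sum f A \<in> gcarrier M"
  by (induction A rule: infinite_finite_induct) (auto simp: abelian_gmodD)

lemma graded_homD:
  assumes "graded_hom B M N f" "abelian_gmod B M"
  shows "x \<in> gcarrier M \<Longrightarrow> f x \<in> gcarrier N"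
    "x \<in> gcarrier M \<Longrightarrow> y \<in> gcarrier M \<Longrightarrow> f (x + y) = f x + f y"
    "s \<in> polys B \<Longrightarrow> x \<in> gcarrier M \<Longrightarrow> f (gact M s x) = gact N s (f x)"
    "x \<in> gpart M d \<Longrightarrow> f x \<in> gpart N d"
    "f 0 = 0" "x \<in> gcarrier M \<Longrightarrow> f (- x) = - f x"
    "x \<in> gcarrier M \<Longrightarrow> y \<in> gcarrier M \<Longrightarrow> f (x - y) = f x - f y"
proof -
  note a = assms(1)[unfolded graded_hom_def]
  show add: "x \<in> gcarrier M \<Longrightarrow> y \<in> gcarrier M \<Longrightarrow> f (x + y) = f x + f y" 
    and "x \<in> gcarrier M \<Longrightarrow> f x \<in> gcarrier N"
    and "s \<in> polys B \<Longrightarrow> x \<in> gcarrier M \<Longrightarrow> f (gact M s x) = gact N s (f x)"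
    and "x \<in> gpart M d \<Longrightarrow> f x \<in> gpart N d" for x y s d
    using a by auto
  show f0: "f 0 = 0" using add[of 0 0] abelian_gmodD(1)[OF assms(2)] by simp
  show u: "x \<in> gcarrier M \<Longrightarrow> f (- x) = - f x" for x
    using add[of x "- x"] abelian_gmodD(6)[OF assms(2), of x] f0 by (simp add: add_eq_0_iff)
  show "x \<in> gcarrier M \<Longrightarrow> y \<in> gcarrier M \<Longrightarrow> f (x - y) = f x - f y"
    using add[of x "- y"] u[of y] abelian_gmodD(6)[OF assms(2), of y] by simp
qed

lemma graded_hom_sum:
  assumes "graded_hom B M N f" "abelian_gmod B M" "\<And>a. a \<in> A \<Longrightarrow> h a \<in> gcarrier M"
  shows "f (sum h A) = (\<Sum>a\<in>A. f (h a))"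
  using assms(3)
proof (induction A rule: infinite_finite_induct)
  case (insert a A)
  then have "f (sum h (insert a A)) = f (h a) + f (sum h A)"
    by (simp add: graded_homD(2)[OF assms(1,2)] gcarrier_sum[OF assms(2)])
  then show ?case using insert by simp
qed (simp_all add: graded_homD(5)[OF assms(1,2)])

lemma koszul_d_mod_hom:
  assumes "graded_hom B M N f" "abelian_gmod B M" "\<And>l. z l \<in> gcarrier M"
  shows "f (koszul_d_mod M B z l) = koszul_d_mod N B (\<lambda>l. f (z l)) l"
  unfolding koszul_d_mod_def
  by (subst graded_hom_sum[OF assms(1,2)])
    (auto simp: assms(3) polys_var abelian_gmodD(3)[OF assms(2)] graded_homD(3)[OF assms(1,2)])

lemma koszul_mod_hom:
  assumes "graded_hom B M N f" "abelian_gmod B M" "koszul_mod M B j z"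
  shows "koszul_mod N B j (\<lambda>l. f (z l))"
proof -
  have "z (u @ i # j # v) = - z (u @ j # i # v)" for u i j v
    using assms(3) unfolding koszul_mod_def koszul_def by (blast intro: altD)
  then have "f (z (u @ i # j # v)) = - f (z (u @ j # i # v))" for u i j v
    using graded_homD(6)[OF assms(1,2)] assms(3) unfolding koszul_mod_def by metis
  then have "alternating (\<lambda>l. f (z l))" unfolding alternating_def by blast
  then show ?thesis
    using assms(3) graded_homD(1,5)[OF assms(1,2)] by (simp add: koszul_mod_def koszul_def)
qed

lemma graded_fun_hom:
  assumes "graded_hom B M N f" "abelian_gmod B M" "graded_fun M w d z"
  shows "graded_fun N w d (\<lambda>l. f (z l))"
  using assms(3) graded_homD(4,5)[OF assms(1,2)] unfolding graded_fun_def by metis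

lemma koszul_mod_koszul_d_mod:
  assumes "abelian_gmod B M" "koszul_mod M B (Suc j) z"
  shows "koszul_mod M B j (koszul_d_mod M B z)"
  using assms unfolding koszul_mod_def koszul_def koszul_d_mod_def[abs_def]
  by (auto intro!: alternating_sum alternating_map[where h = "gact M s" for s] alternating_Cons sum.neutral gcarrier_sum
      simp: abelian_gmodD polys_var)

lemma koszul_mod_diff:
  assumes "abelian_gmod B M" "koszul_mod M B j z" "koszul_mod M B j y"
  shows "koszul_mod M B j (\<lambda>l. z l - y l)"
  using assms by (simp add: koszul_mod_def koszul_diff abelian_gmodD)

text \<open>A section of a surjective homomorphism that commutes with \<open>-\<close> lifts alternating functions to
  alternating functions.\<close>

lemma lift_koszul_mod:
  assumes f: "graded_hom B M N f" and M: "abelian_gmod B M" and N: "abelian_gmod B N"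
    and z: "koszul B j z" "\<And>l. z l \<in> f ` gcarrier M"
  shows "\<exists>y. koszul_mod M B j y \<and> (\<forall>l. f (y l) = z l)"
proof -
  define s where "s r = (SOME x. x \<in> gcarrier M \<and> f x = r)" for r
  have s: "s r \<in> gcarrier M" "f (s r) = r" if "r \<in> f ` gcarrier M" for r
    using someI_ex[of "\<lambda>x. x \<in> gcarrier M \<and> f x = r"] that unfolding s_def by auto
  \<comment> \<open>The odd part of an arbitrary section. It is again a section because
    \<open>s (- r)\<close> lifts \<open>- r\<close>.\<close>
  define t where "t r = gact M (single 0 (1 / 2)) (s r - s (- r))" for r
  have half: "single 0 (1 / 2) \<in> polys B" by (simp add: polys_def)
  have todd: "t (- r) = - t r" for r
    unfolding t_def using abelian_gmodD(9)[OF M, of "single 0 (1 / 2)" "s r - s (- r)"] by simp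
  have neg: "- r \<in> f ` gcarrier M" if r: "r \<in> f ` gcarrier M" for r
  proof -
    obtain x where "x \<in> gcarrier M" "r = f x" using r by blast
    then show ?thesis using graded_homD(6)[OF f M, of x] abelian_gmodD(6)[OF M] by (metis image_eqI)
  qed
  have t: "t r \<in> gcarrier M" "f (t r) = r" if r: "r \<in> f ` gcarrier M" for r
  proof -
    have m: "s r - s (- r) \<in> gcarrier M" using s(1) neg r abelian_gmodD(2)[OF M] by blast
    then show "t r \<in> gcarrier M" unfolding t_def by (rule abelian_gmodD(3)[OF M half])
    have "f (t r) = gact N (single 0 (1 / 2)) (f (s r) - f (s (- r)))"
      unfolding t_def using graded_homD(3)[OF f M half m] graded_homD(7)[OF f M] s(1) neg r by simp
    also have "f (s r) - f (s (- r)) = r + r" using s(2)[OF r] s(2)[OF neg[OF r]] by simp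
    finally show "f (t r) = r" using abelian_gmodD(5)[OF N] by simp
  qed
  have "t 0 = 0" using abelian_gmodD(8)[OF M] by (simp add: t_def)
  then have "koszul_mod M B j (\<lambda>l. t (z l))"
    unfolding koszul_mod_def using koszul_compose[OF z(1), of t] todd t(1)[OF z(2)] by simp
  then show ?thesis using t(2)[OF z(2)] by blast
qed

section \<open>Free graded modules\<close>

lemma free_gmod_simps:
  "gcarrier (free_gmod B w J a) = {x. keys x \<subseteq> J \<and> (\<forall>j. lookup x j \<in> polys B)}"
  "gact (free_gmod B w J a) s = Poly_Mapping.map ((*) s)"
  "gpart (free_gmod B w J a) d = {x \<in> gcarrier (free_gmod B w J a). \<forall>j\<in>keys x.
     \<forall>m\<in>keys (lookup x j). monom_deg w m + a j = d}"
  by (simp_all add: free_gmod_def Let_def)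

lemma lookup_map_times: "lookup (Poly_Mapping.map ((*) s) x) j = s * lookup (x :: 'a \<Rightarrow>\<^sub>0 'x cpoly) j"
  by (simp add: Poly_Mapping.map.rep_eq when_def)

lemma polys_uminus: "f \<in> polys B \<Longrightarrow> - f \<in> polys B"
  by (simp add: polys_def)

lemma polys_diff: "f \<in> polys B \<Longrightarrow> g \<in> polys B \<Longrightarrow> f - g \<in> polys B"
  using polys_add[OF _ polys_uminus, of f B g] by simp

lemma abelian_free_gmod: "abelian_gmod (B :: 'x set) (free_gmod B w J a)"
proof -
  have "keys (x - y) \<subseteq> J" if "keys x \<subseteq> J" "keys y \<subseteq> J" for x y :: "nat \<Rightarrow>\<^sub>0 'x cpoly"
    using that unfolding subset_iff in_keys_iff lookup_minus by (metis diff_self)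
  moreover have "keys (Poly_Mapping.map ((*) s) x) \<subseteq> J" if "keys x \<subseteq> J" for s and x :: "nat \<Rightarrow>\<^sub>0 'x cpoly"
    using that unfolding subset_iff in_keys_iff lookup_map_times by (metis mult_zero_right)
  moreover have "Poly_Mapping.map ((*) (single 0 (1 / 2))) (x + x) = x" for x :: "nat \<Rightarrow>\<^sub>0 'x cpoly"
  proof (rule poly_mapping_eqI)
    fix k
    have "single 0 (1 / 2) * (f + f) = f" for f :: "'x cpoly"
      unfolding cscale_conv_mult[symmetric] cpoly.scale_right_distrib
        cpoly.scale_left_distrib[symmetric] by simp
    then show "lookup (Poly_Mapping.map ((*) (single 0 (1 / 2))) (x + x)) k = lookup x k"
      unfolding lookup_map_times lookup_add .
  qed
  moreover have "Poly_Mapping.map ((*) s) (x - y) = Poly_Mapping.map ((*) s) x - Poly_Mapping.map ((*) s) y"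
    for s and x y :: "nat \<Rightarrow>\<^sub>0 'x cpoly"
    by (rule poly_mapping_eqI) (simp add: lookup_map_times lookup_minus algebra_simps)
  ultimately show ?thesis
    unfolding abelian_gmod_def free_gmod_simps
    by (simp add: lookup_minus lookup_map_times polys_diff polys_mult del: mult_2)
qed

lemma lookup_koszul_d_mod_free:
  "lookup (koszul_d_mod (free_gmod B w J a) B z l) i = koszul_d B var (\<lambda>l. lookup (z l) i) l"
  by (simp add: koszul_d_mod_def koszul_d_def free_gmod_simps lookup_sum lookup_map_times)

lemma koszul_d_mod_koszul_d_mod_free: "alternating z \<Longrightarrow> koszul_d_mod (free_gmod B w J a) B (koszul_d_mod (free_gmod B w J a) B z) l = 0"
proof (rule poly_mapping_eqI)
  fix i assume "alternating z"
  then have a: "alternating (\<lambda>l. lookup (z l) i)" by (rule alternating_map) simp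
  show "lookup (koszul_d_mod (free_gmod B w J a) B (koszul_d_mod (free_gmod B w J a) B z) l) i = lookup 0 i"
    using koszul_d_koszul_d[OF a] by (simp add: lookup_koszul_d_mod_free[abs_def])
qed

text \<open>Preimages found for each coordinate separately are cut down to the right variables and
  degree. This commutes with the differential: multiplying by the variable b raises the degree by
  \<open>w b\<close>, just as prefixing b to the list does.\<close>

lemma graded_lift_free:
  assumes B: "finite B" and z: "koszul_mod (free_gmod B w J a) B j z" "graded_fun (free_gmod B w J a) w d z"
    and ex: "\<And>i. \<exists>y. koszul B (Suc j) y \<and> koszul_d B var y = (\<lambda>l. lookup (z l) i)"
  shows "\<exists>y. koszul_mod (free_gmod B w J a) B (Suc j) y \<and> graded_fun (free_gmod B w J a) w d y
     \<and> koszul_d_mod (free_gmod B w J a) B y = z"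
proof -
  let ?N = "free_gmod B w J a"
  obtain y where y: "\<And>i. koszul B (Suc j) (y i)" "\<And>i. koszul_d B var (y i) = (\<lambda>l. lookup (z l) i)"
    using ex by metis
  define Q where "Q i l m \<longleftrightarrow> keys m \<subseteq> B \<and> monom_deg w m + a i + sum_list (map w l) = d" for i l m
  define y' where "y' i l = restrict_monoms (Q i l) (y i l)" for i l
  \<comment> \<open>A finite set of coordinates outside of which \<open>z\<close> vanishes. It is
    needed because \<open>y\<close> provides a chain for every coordinate, while \<open>Y\<close>
    must have finite support.\<close>
  define I0 where "I0 = (\<Union>l\<in>words B j. keys (z l))"
  define Y where "Y l = (\<Sum>i\<in>I0. single i (y' i l))" for l
  have I0: "finite I0" by (simp add: I0_def finite_words B)
  have I0J: "I0 \<subseteq> J" using z(1) by (auto simp: I0_def koszul_mod_def free_gmod_simps)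
  have lY: "lookup (Y l) i = (if i \<in> I0 then y' i l else 0)" for i l
    using I0 by (simp add: Y_def lookup_sum lookup_single when_def)
  have kd': "koszul_d B var (y' i) l = lookup (z l) i" for i l
  proof -
    have "var b * y' i (b # l) = restrict_monoms (Q i l) (var b * y i (b # l))" if "b \<in> B" for b
    proof -
      have "Q i l (single b 1 + m) \<longleftrightarrow> Q i (b # l) m" for m
      proof -
        have "keys (single b 1 + m) = insert b (keys m)"
          by (auto simp: in_keys_iff lookup_add lookup_single when_def split: if_splits)
        then show ?thesis using \<open>b \<in> B\<close> by (simp add: Q_def monom_deg_add add_ac)
      qed
      then show ?thesis by (simp add: y'_def var_def restrict_monoms_single_mult)
    qed
    then have "koszul_d B var (y' i) l = restrict_monoms (Q i l) (koszul_d B var (y i) l)"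
      by (simp add: koszul_d_def restrict_monoms_sum)
    also have "\<dots> = restrict_monoms (Q i l) (lookup (z l) i)" by (simp add: y(2))
    also have "\<dots> = lookup (z l) i"
    proof (rule restrict_monoms_id)
      fix m assume m: "m \<in> keys (lookup (z l) i)"
      then have "z l \<noteq> 0" "i \<in> keys (z l)" by (auto simp: in_keys_iff)
      then obtain e where "e + sum_list (map w l) = d" "z l \<in> gpart ?N e"
        using z(2) by (auto simp: graded_fun_def)
      then show "Q i l m" using m \<open>i \<in> keys (z l)\<close> by (auto simp: Q_def free_gmod_simps polys_def)
    qed
    finally show ?thesis .
  qed
  have car: "Y l \<in> gcarrier ?N" for l
    using I0J by (auto simp: free_gmod_simps lY in_keys_iff polys_def y'_def keys_restrict_monoms Q_def split: if_splits)
  have "alternating Y"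
    unfolding alternating_def
  proof (intro allI, rule poly_mapping_eqI)
    fix u i j v k
    have "Q k (u @ i # j # v) = Q k (u @ j # i # v)" by (simp add: Q_def fun_eq_iff add_ac)
    moreover have "y k (u @ i # j # v) = - y k (u @ j # i # v)" using altD[OF koszul_alternating[OF y(1)]] .
    ultimately show "lookup (Y (u @ i # j # v)) k = lookup (- Y (u @ j # i # v)) k"
      by (simp add: lY y'_def restrict_monoms_uminus)
  qed
  moreover have "Y l = 0" if "l \<notin> words B (Suc j)" for l
    using koszul_outside[OF y(1) that] by (simp add: Y_def y'_def)
  ultimately have "koszul_mod ?N B (Suc j) Y" using car by (simp add: koszul_mod_def koszul_def)
  moreover have "graded_fun ?N w d Y"
    unfolding graded_fun_def
  proof
    fix l
    show "Y l = 0 \<or> (\<exists>e. e + sum_list (map w l) = d \<and> Y l \<in> gpart ?N e)"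
    proof (cases "Y l = 0")
      case False
      then obtain i where "lookup (Y l) i \<noteq> 0" by (metis lookup_zero poly_mapping_eqI)
      then obtain m where "m \<in> keys (y' i l)" by (auto simp: lY split: if_splits simp flip: keys_eq_empty)
      then have "sum_list (map w l) \<le> d" by (auto simp: y'_def keys_restrict_monoms Q_def)
      then have "(d - sum_list (map w l)) + sum_list (map w l) = d" by simp
      moreover have "Y l \<in> gpart ?N (d - sum_list (map w l))"
        unfolding free_gmod_simps(3) using car[of l]
        by (auto simp: lY y'_def keys_restrict_monoms Q_def split: if_splits)
      ultimately show ?thesis by blast
    qed simp
  qed
  moreover have "koszul_d_mod ?N B Y l = z l" for l
  proof (rule poly_mapping_eqI)
    fix i
    have "lookup (z l) i = 0" if "i \<notin> I0"
      using that koszul_outside[of B j z l] z(1) by (cases "l \<in> words B j") (auto simp: I0_def koszul_mod_def in_keys_iff)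
    then show "lookup (koszul_d_mod ?N B Y l) i = lookup (z l) i"
      using kd'[of i l] by (cases "i \<in> I0") (simp_all add: lookup_koszul_d_mod_free lY koszul_d_def)
  qed
  ultimately show ?thesis by blast
qed

text \<open>One variable after the other is divided off; for elements of the irrelevant ideal this
  produces the form of a Koszul boundary.\<close>

lemma in_powers_1_sum:
  assumes "finite X" "in_powers 1 X f"
  shows "\<exists>c. f = (\<Sum>x\<in>X. var x * c x)"
  using assms
proof (induction X arbitrary: f)
  case empty
  then show ?case by (simp add: in_powers_empty)
next
  case (insert x X)
  obtain c where c: "f - var x ^ 1 * divide_power 1 x f = (\<Sum>x\<in>X. var x * c x)"
    using insert.IH[OF in_powers_divide_power[OF insert.prems]] by blast
  define c' where "c' y = (if y = x then divide_power 1 x f else c y)" for y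
  have "(\<Sum>y\<in>X. var y * c' y) = (\<Sum>y\<in>X. var y * c y)"
    using insert.hyps by (intro sum.cong) (auto simp: c'_def)
  then have "f = (\<Sum>y\<in>insert x X. var y * c' y)"
    using c insert.hyps by (simp add: c'_def algebra_simps)
  then show ?case by blast
qed

lemma irrelevant_ideal_in_powers: "s \<in> irrelevant_ideal B \<Longrightarrow> in_powers 1 B s"
proof -
  assume s: "s \<in> irrelevant_ideal B"
  have "\<exists>x\<in>B. 1 \<le> lookup m x" if "m \<in> keys s" for m
  proof -
    have "m \<noteq> 0" using s that by (auto simp: irrelevant_ideal_def in_keys_iff)
    then obtain x where x: "x \<in> keys m" using poly_mapping_eqI[of m 0] by (auto simp: in_keys_iff)
    then have "x \<in> B" using s that by (auto simp: irrelevant_ideal_def polys_def)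
    then show ?thesis using x by (intro bexI[of _ x]) (simp_all add: in_keys_iff)
  qed
  then show ?thesis by (simp add: in_powers_def)
qed

text \<open>The zigzag through the double complex formed by the resolution and the Koszul complex.\<close>

lemma tor_vanishes_if_koszul:
  assumes B: "finite B" and res: "graded_free_resolution B w M F" and M: "abelian_gmod B M"
    and p: "p > 0"
    and van: "\<And>z. koszul_mod M B p z \<Longrightarrow> graded_fun M w d z \<Longrightarrow> (\<And>l. koszul_d_mod M B z l = 0) \<Longrightarrow>
      \<exists>u. koszul_mod M B (Suc p) u \<and> z = koszul_d_mod M B u"
  shows "tor_cycles B w F p d \<subseteq> tor_boundaries B w F p d"
proof
  let ?T = "term_mod B w F"
  have T: "abelian_gmod B (?T i)" for i by (simp add: term_mod_def abelian_free_gmod)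
  have hom: "graded_hom B (?T (Suc i)) (?T i) (bdry F i)"
    and hom0: "graded_hom B (?T 0) M (augm F)"
    and surj: "augm F ` gcarrier (?T 0) = gcarrier M"
    and ker0: "{x \<in> gcarrier (?T 0). augm F x = 0} = bdry F 0 ` gcarrier (?T 1)"
    and ker: "{x \<in> gcarrier (?T (Suc i)). bdry F i x = 0} = bdry F (Suc i) ` gcarrier (?T (Suc (Suc i)))" for i
    using res by (auto simp: graded_free_resolution_def)
  \<comment> \<open>The Koszul complex of a free module is exact in positive degrees, coordinate by
    coordinate, and preimages can be kept homogeneous of degree \<open>d\<close>.\<close>
  have exact: "\<exists>y'. koszul_mod (?T i) B (Suc j) y' \<and> graded_fun (?T i) w d y' \<and> koszul_d_mod (?T i) B y' = z"
    if "koszul_mod (?T i) B j z" "graded_fun (?T i) w d z" "j > 0" "\<And>l. koszul_d_mod (?T i) B z l = 0" for i j z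
    unfolding term_mod_def
  proof (rule graded_lift_free[OF B that(1,2)[unfolded term_mod_def]])
    fix k
    have "koszul B j (\<lambda>l. lookup (z l) k)" using that(1) unfolding koszul_mod_def by (auto intro: koszul_compose)
    moreover have "koszul_d B var (\<lambda>l. lookup (z l) k) l = 0" for l
      using that(4)[of l] lookup_koszul_d_mod_free[of B w "gens F i" "gen_deg F i" z l k] by (simp add: term_mod_def)
    ultimately show "\<exists>y. koszul B (Suc j) y \<and> koszul_d B var y = (\<lambda>l. lookup (z l) k)"
      using koszul_exact[OF B _ that(3)] by metis
  qed
  \<comment> \<open>The invariant of the zigzag at position (i, j) with i + j = p: the boundary of
    \<open>y\<close> is a Koszul boundary coming from position (i - 1, j + 1) or, for i = 0, the
    image of \<open>y\<close> in \<open>M\<close> is a Koszul cycle.\<close>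
  define H where "H i j y = (case i of 0 \<Rightarrow> (\<forall>l. koszul_d_mod M B (\<lambda>l. augm F (y l)) l = 0)
      | Suc i \<Rightarrow> (\<exists>y'. koszul_mod (?T i) B (Suc j) y' \<and> graded_fun (?T i) w d y' \<and>
          (\<forall>l. bdry F i (y l) = koszul_d_mod (?T i) B y' l)))" for i j y
  \<comment> \<open>The staircase descends to \<open>M\<close>, where the assumption
    \<open>van\<close> applies, and climbs back: at each level \<open>y\<close> is corrected by a
    Koszul boundary until it is a cycle for \<open>bdry\<close>, hence a boundary of the
    resolution.\<close>
  have zigzag: "\<exists>v v'. koszul_mod (?T (Suc i)) B j v \<and> koszul_mod (?T i) B (Suc j) v' \<and>
      (\<forall>l. y l = bdry F i (v l) + koszul_d_mod (?T i) B v' l)"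
    if "i + j = p" "koszul_mod (?T i) B j y" "graded_fun (?T i) w d y" "H i j y" for i j y
    using that
  proof (induction i arbitrary: j y)
    case 0
    define z where "z l = augm F (y l)" for l
    have "koszul_mod M B p z" unfolding z_def using koszul_mod_hom[OF hom0 T 0(2)] 0(1) by simp
    moreover have "graded_fun M w d z" unfolding z_def by (rule graded_fun_hom[OF hom0 T 0(3)])
    moreover have "koszul_d_mod M B z l = 0" for l using 0(4) by (simp add: H_def z_def[abs_def])
    ultimately obtain u where u: "koszul_mod M B (Suc p) u" "z = koszul_d_mod M B u" using van by blast
    have "\<exists>y. koszul_mod (?T 0) B (Suc p) y \<and> (\<forall>l. augm F (y l) = u l)"
      by (rule lift_koszul_mod[OF hom0 T M]) (use u surj in \<open>auto simp: koszul_mod_def\<close>)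
    then obtain v' where v': "koszul_mod (?T 0) B (Suc p) v'" "\<And>l. augm F (v' l) = u l" by blast
    have dv': "koszul_mod (?T 0) B p (koszul_d_mod (?T 0) B v')" by (rule koszul_mod_koszul_d_mod[OF T v'(1)])
    have k: "koszul_mod (?T 0) B p (\<lambda>l. y l - koszul_d_mod (?T 0) B v' l)"
      using 0 dv' by (intro koszul_mod_diff[OF T]) auto
    have "augm F (y l - koszul_d_mod (?T 0) B v' l) = 0" for l
    proof -
      have "augm F (koszul_d_mod (?T 0) B v' l) = koszul_d_mod M B (\<lambda>l. augm F (v' l)) l"
        by (rule koszul_d_mod_hom[OF hom0 T]) (use v' in \<open>simp add: koszul_mod_def\<close>)
      also have "\<dots> = augm F (y l)" using u(2) v'(2) by (simp add: z_def[abs_def] fun_eq_iff)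
      finally show ?thesis
        using graded_homD(7)[OF hom0 T, of "y l" "koszul_d_mod (?T 0) B v' l"] 0(2) dv' by (simp add: koszul_mod_def)
    qed
    then have "y l - koszul_d_mod (?T 0) B v' l \<in> bdry F 0 ` gcarrier (?T (Suc 0))" for l
      using ker0 k by (auto simp: koszul_mod_def)
    then obtain v where "koszul_mod (?T (Suc 0)) B p v" "\<And>l. bdry F 0 (v l) = y l - koszul_d_mod (?T 0) B v' l"
      using lift_koszul_mod[OF hom[of 0] T T, of p "\<lambda>l. y l - koszul_d_mod (?T 0) B v' l"] k by (auto simp: koszul_mod_def)
    then show ?case using v' 0(1) by (intro exI[of _ v] exI[of _ v']) simp
  next
    case (Suc i)
    obtain y' where y': "koszul_mod (?T i) B (Suc j) y'" "graded_fun (?T i) w d y'"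
      "\<And>l. bdry F i (y l) = koszul_d_mod (?T i) B y' l"
      using Suc.prems(4) by (auto simp: H_def)
    have bb: "bdry F i (bdry F (Suc i) x) = 0" if "x \<in> gcarrier (?T (Suc (Suc i)))" for x i
      using ker[of i] that by blast
    have yc: "y l \<in> gcarrier (?T (Suc i))" for l using Suc.prems(2) by (simp add: koszul_mod_def)
    \<comment> \<open>Consecutive maps of the resolution compose to 0, so the image of
      \<open>y'\<close> under the next one is a Koszul cycle; unless that map ends in
      \<open>M\<close>, exactness makes it a Koszul boundary.\<close>
    have "H i (Suc j) y'"
    proof (cases i)
      case 0
      have "koszul_d_mod M B (\<lambda>l. augm F (y' l)) l = augm F (koszul_d_mod (?T 0) B y' l)" for l
        by (rule koszul_d_mod_hom[OF hom0 T, symmetric]) (use y'(1) 0 in \<open>simp add: koszul_mod_def\<close>)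
      moreover have "augm F (bdry F 0 (y l)) = 0" for l using ker0 yc[of l] 0 by auto
      ultimately show ?thesis using y'(3) 0 by (simp add: H_def)
    next
      case (Suc i')
      have "koszul_d_mod (?T i') B (\<lambda>l. bdry F i' (y' l)) l = bdry F i' (koszul_d_mod (?T i) B y' l)" for l
        unfolding Suc by (rule koszul_d_mod_hom[OF hom T, symmetric]) (use y'(1) Suc in \<open>simp add: koszul_mod_def\<close>)
      also have "bdry F i' (koszul_d_mod (?T i) B y' l) = 0" for l
        using bb[of "y l" i'] yc[of l] y'(3)[of l] Suc by simp
      finally have "\<exists>y''. koszul_mod (?T i') B (Suc (Suc j)) y'' \<and> graded_fun (?T i') w d y'' \<and>
          koszul_d_mod (?T i') B y'' = (\<lambda>l. bdry F i' (y' l))"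
        using koszul_mod_hom[OF hom T y'(1)[unfolded Suc]] graded_fun_hom[OF hom T y'(2)[unfolded Suc]]
        by (intro exact) simp_all
      then show ?thesis unfolding H_def Suc by (auto simp: fun_eq_iff)
    qed
    then obtain v v' where v: "koszul_mod (?T (Suc i)) B (Suc j) v" "koszul_mod (?T i) B (Suc (Suc j)) v'"
      "\<And>l. y' l = bdry F i (v l) + koszul_d_mod (?T i) B v' l"
      using Suc.IH[of "Suc j" y'] Suc.prems(1) y' by auto
    have dv: "koszul_mod (?T (Suc i)) B j (koszul_d_mod (?T (Suc i)) B v)" by (rule koszul_mod_koszul_d_mod[OF T v(1)])
    have k: "koszul_mod (?T (Suc i)) B j (\<lambda>l. y l - koszul_d_mod (?T (Suc i)) B v l)"
      by (rule koszul_mod_diff[OF T Suc.prems(2) dv])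
    \<comment> \<open>The contribution of \<open>v'\<close> to
      \<open>koszul_d_mod (?T i) B y'\<close> drops out, because the Koszul differential squares to
      zero.\<close>
    have "bdry F i (y l - koszul_d_mod (?T (Suc i)) B v l) = 0" for l
    proof -
      have "bdry F i (koszul_d_mod (?T (Suc i)) B v l) = koszul_d_mod (?T i) B (\<lambda>l. bdry F i (v l)) l"
        by (rule koszul_d_mod_hom[OF hom T]) (use v in \<open>simp add: koszul_mod_def\<close>)
      also have "\<dots> = koszul_d_mod (?T i) B y' l"
      proof -
        have "koszul_d_mod (?T i) B y' l = koszul_d_mod (?T i) B (\<lambda>l. bdry F i (v l)) l + koszul_d_mod (?T i) B (koszul_d_mod (?T i) B v') l"
          unfolding koszul_d_mod_def[of _ _ y'] koszul_d_mod_def[of _ _ "\<lambda>l. bdry F i (v l)"]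
            koszul_d_mod_def[of _ _ "koszul_d_mod (?T i) B v'"] v(3)
          by (simp add: abelian_gmodD(10)[OF T] sum.distrib)
        also have "koszul_d_mod (?T i) B (koszul_d_mod (?T i) B v') l = 0"
          unfolding term_mod_def by (rule koszul_d_mod_koszul_d_mod_free) (use v(2) in \<open>simp add: koszul_mod_def koszul_def\<close>)
        finally show ?thesis by simp
      qed
      finally show ?thesis
        using graded_homD(7)[OF hom T, of "y l" i "koszul_d_mod (?T (Suc i)) B v l"] yc y'(3) dv
        by (simp add: koszul_mod_def)
    qed
    then have "y l - koszul_d_mod (?T (Suc i)) B v l \<in> bdry F (Suc i) ` gcarrier (?T (Suc (Suc i)))" for l
      using ker[of i] k by (auto simp: koszul_mod_def)
    then obtain v'' where "koszul_mod (?T (Suc (Suc i))) B j v''"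
      "\<And>l. bdry F (Suc i) (v'' l) = y l - koszul_d_mod (?T (Suc i)) B v l"
      using lift_koszul_mod[OF hom[of "Suc i"] T T, of j "\<lambda>l. y l - koszul_d_mod (?T (Suc i)) B v l"] k
      by (auto simp: koszul_mod_def)
    then show ?case using v by (intro exI[of _ v''] exI[of _ v]) simp
  qed
  fix x assume x: "x \<in> tor_cycles B w F p d"
  obtain q where q: "p = Suc q" using p by (cases p) auto
  \<comment> \<open>An element of the resolution regarded as a Koszul chain of degree 0, where the
    zigzag starts and ends.\<close>
  define y where "y l = (if l = [] then x else 0)" for l :: "'a list"
  have xp: "x \<in> gpart (?T p) d" "bdry F q x \<in> irrelevant_part B w F q"
    using x q by (auto simp: tor_cycles_def)
  then have xc: "x \<in> gcarrier (?T p)" by (simp add: term_mod_def free_gmod_simps)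
  have y: "koszul_mod (?T p) B 0 y" "graded_fun (?T p) w d y"
    using xc xp abelian_gmodD(1)[OF T]
    by (auto simp: koszul_mod_def koszul_def y_def alternating_def graded_fun_def)
  \<comment> \<open>A cycle for Tor has its boundary in the irrelevant part, which is the image of
    the Koszul differential from degree 1. This is the invariant \<open>H\<close> at the starting
    point.\<close>
  have "\<exists>y'. koszul_mod (?T q) B (Suc 0) y' \<and> graded_fun (?T q) w d y' \<and> koszul_d_mod (?T q) B y' = (\<lambda>l. bdry F q (y l))"
    unfolding term_mod_def
  proof (rule graded_lift_free[OF B])
    show "koszul_mod (free_gmod B w (gens F q) (gen_deg F q)) B 0 (\<lambda>l. bdry F q (y l))"
      "graded_fun (free_gmod B w (gens F q) (gen_deg F q)) w d (\<lambda>l. bdry F q (y l))"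
      using koszul_mod_hom[OF hom T y(1)[unfolded q]] graded_fun_hom[OF hom T y(2)[unfolded q]]
      by (simp_all add: term_mod_def)
    fix i
    have "in_powers 1 B (lookup (bdry F q x) i)"
      using xp(2) by (intro irrelevant_ideal_in_powers) (simp add: irrelevant_part_def)
    then obtain c where c: "lookup (bdry F q x) i = (\<Sum>b\<in>B. var b * c b)"
      using in_powers_1_sum[OF B] by blast
    define e where "e l = (case l of [b] \<Rightarrow> if b \<in> B then c b else 0 | _ \<Rightarrow> 0)" for l
    have "koszul B (Suc 0) e"
      by (auto simp: koszul_def alternating_def e_def words_def split: list.splits)
    moreover have "koszul_d B var e l = lookup (bdry F q (y l)) i" for l
      using c graded_homD(5)[OF hom T] by (cases l) (auto simp: koszul_d_def e_def y_def)
    ultimately show "\<exists>y'. koszul B (Suc 0) y' \<and> koszul_d B var y' = (\<lambda>l. lookup (bdry F q (y l)) i)"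
      by blast
  qed
  then have "H p 0 y" unfolding q H_def by auto
  then obtain v v' where v: "koszul_mod (?T (Suc p)) B 0 v" "koszul_mod (?T p) B (Suc 0) v'"
    "\<And>l. y l = bdry F p (v l) + koszul_d_mod (?T p) B v' l"
    using zigzag[of p 0 y] y by auto
  have "x - bdry F p (v []) = koszul_d_mod (?T p) B v' []" using v(3)[of "[]"] by (simp add: y_def)
  \<comment> \<open>Conversely, a Koszul boundary in degree 0 has no constant terms; so
    \<open>x\<close> is congruent to a boundary of the resolution modulo the irrelevant
    part.\<close>
  moreover have "koszul_d_mod (?T p) B v' [] \<in> irrelevant_part B w F p"
  proof -
    have "koszul_d_mod (?T p) B v' [] \<in> gcarrier (?T p)"
      using koszul_mod_koszul_d_mod[OF T v(2)] by (simp add: koszul_mod_def)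
    moreover have "lookup (koszul_d_mod (?T p) B v' []) j \<in> irrelevant_ideal B" for j
    proof -
      have "lookup (lookup (koszul_d_mod (?T p) B v' []) j) 0 = 0"
      proof -
        have "lookup (var b * f) 0 = 0" for b :: 'a and f
        proof -
          have "0 \<notin> keys (var b * f)"
          proof
            assume "0 \<in> keys (var b * f)"
            then obtain n m where nm: "n \<in> keys (var b)" "0 = n + m"
              using keys_mult[of "var b" f] by blast
            then have "lookup n b + lookup m b = 0" by (metis lookup_add lookup_zero)
            then show False using nm(1) by (simp add: var_def)
          qed
          then show ?thesis by (simp add: in_keys_iff)
        qed
        then show ?thesis by (simp add: term_mod_def lookup_koszul_d_mod_free koszul_d_def lookup_sum)
      qed
      then show ?thesis
        using \<open>koszul_d_mod (?T p) B v' [] \<in> gcarrier (?T p)\<close>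
        by (simp add: irrelevant_ideal_def term_mod_def free_gmod_simps)
    qed
    ultimately show ?thesis by (simp add: irrelevant_part_def)
  qed
  ultimately show "x \<in> tor_boundaries B w F p d"
    using xp(1) v(1) by (auto simp: tor_boundaries_def koszul_mod_def intro!: bexI[of _ "v []"])
qed

section \<open>Invariants\<close>

definition in_ideal :: "'x set \<Rightarrow> 'i set \<Rightarrow> ('i \<Rightarrow> 'x cpoly) \<Rightarrow> 'x cpoly \<Rightarrow> bool" where
  "in_ideal X I f a \<longleftrightarrow> (\<exists>c. (\<forall>i. c i \<in> polys X) \<and> a = (\<Sum>i\<in>I. f i * c i))"

lemma in_ideal_0 [simp]: "in_ideal X I f 0"
  unfolding in_ideal_def by (rule exI[of _ "\<lambda>_. 0"]) simp

lemma in_ideal_add: "in_ideal X I f a \<Longrightarrow> in_ideal X I f b \<Longrightarrow> in_ideal X I f (a + b)"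
  unfolding in_ideal_def
proof (elim exE conjE)
  fix c c' assume "\<forall>i. c i \<in> polys X" "\<forall>i. c' i \<in> polys X" "a = (\<Sum>i\<in>I. f i * c i)" "b = (\<Sum>i\<in>I. f i * c' i)"
  then show "\<exists>c. (\<forall>i. c i \<in> polys X) \<and> a + b = (\<Sum>i\<in>I. f i * c i)"
    by (intro exI[of _ "\<lambda>i. c i + c' i"]) (simp add: polys_add algebra_simps sum.distrib)
qed

lemma in_ideal_mult: "in_ideal X I f a \<Longrightarrow> b \<in> polys X \<Longrightarrow> in_ideal X I f (a * b)"
  unfolding in_ideal_def
proof (elim exE conjE)
  fix c assume "b \<in> polys X" "\<forall>i. c i \<in> polys X" "a = (\<Sum>i\<in>I. f i * c i)"
  then show "\<exists>c. (\<forall>i. c i \<in> polys X) \<and> a * b = (\<Sum>i\<in>I. f i * c i)"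
    by (intro exI[of _ "\<lambda>i. c i * b"]) (simp add: polys_mult sum_distrib_right mult.assoc)
qed

lemma polys_single_0 [simp]: "single 0 c \<in> polys X"
  by (simp add: polys_def)

lemma in_ideal_cscale: "in_ideal X I f a \<Longrightarrow> in_ideal X I f (cscale c a)"
  using in_ideal_mult[of X I f a "single 0 c"] by (simp add: cscale_conv_mult mult.commute)

lemma in_ideal_uminus: "in_ideal X I f a \<Longrightarrow> in_ideal X I f (- a)"
  using in_ideal_cscale[of X I f a "-1"] by (simp add: cscale_uminus)

lemma in_ideal_sum: "(\<And>a. a \<in> A \<Longrightarrow> in_ideal X I f (h a)) \<Longrightarrow> in_ideal X I f (sum h A)"
  by (induction A rule: infinite_finite_induct) (simp_all add: in_ideal_add)

lemma in_ideal_gen: "finite I \<Longrightarrow> i \<in> I \<Longrightarrow> in_ideal X I f (f i)"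
  unfolding in_ideal_def by (rule exI[of _ "\<lambda>j. if j = i then 1 else 0"]) (simp add: if_distrib cong: if_cong)

lemma in_ideal_trans:
  assumes "in_ideal X I f a" "\<And>i. i \<in> I \<Longrightarrow> in_ideal X J h (f i)"
  shows "in_ideal X J h a"
proof -
  obtain c where c: "\<forall>i. c i \<in> polys X" "a = (\<Sum>i\<in>I. f i * c i)" using assms(1) by (auto simp: in_ideal_def)
  show ?thesis unfolding c(2) by (intro in_ideal_sum in_ideal_mult assms(2)) (simp_all add: c)
qed

lemma lookup_mult_0: "lookup (f * g :: 'x cpoly) 0 = lookup f 0 * lookup g 0"
proof (induction f rule: cpoly_induct)
  case (single m c)
  show ?case
  proof (induction g rule: cpoly_induct)
    case (single n d)
    have "m + n = 0 \<longleftrightarrow> m = 0 \<and> n = 0"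
      by (metis add_is_0 monom_deg_0 monom_deg_add monom_deg_std_0_iff add_0)
    then show ?case by (simp add: mult_single lookup_single when_def)
  qed (simp add: algebra_simps lookup_add)
qed (simp add: algebra_simps lookup_add)

lemma subalgebra_hull: "subalgebra (subalgebra hull S)"
proof (rule hull_in)
  fix T :: "'a cpoly set set" assume "\<forall>x\<in>T. subalgebra x"
  then show "subalgebra (\<Inter> T)" by (auto simp: subalgebra_def intro: cpoly.subspace_Inter)
qed

lemma subalgebraD:
  assumes "subalgebra A"
  shows "f \<in> A \<Longrightarrow> h \<in> A \<Longrightarrow> f + h \<in> A" "f \<in> A \<Longrightarrow> h \<in> A \<Longrightarrow> f * h \<in> A"
    "f \<in> A \<Longrightarrow> cscale c f \<in> A" "1 \<in> A" "(\<And>i. i \<in> I \<Longrightarrow> k i \<in> A) \<Longrightarrow> sum k I \<in> A"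
  using assms unfolding subalgebra_def
  by (auto intro: cpoly.subspace_add cpoly.subspace_scale cpoly.subspace_sum)

text \<open>The polynomials that lie in the ideal up to their constant term form a subalgebra,
  because hk - h(0)k(0) = (h - h(0))k + (k - k(0))h(0).\<close>

lemma in_ideal_subalgebra_hull:
  assumes "\<And>h. h \<in> S \<Longrightarrow> h \<in> polys X \<and> in_ideal X I f (h - single 0 (lookup h 0))"
    and "a \<in> subalgebra hull S" "lookup a 0 = 0"
  shows "in_ideal X I f a"
proof -
  let ?T = "{h \<in> polys X. in_ideal X I f (h - single 0 (lookup h 0))}"
  have "subalgebra ?T"
    unfolding subalgebra_def
  proof (intro conjI cpoly.subspaceI ballI)
    fix h k assume h: "h \<in> ?T" and k: "k \<in> ?T"
    have "h + k - single 0 (lookup (h + k) 0) = (h - single 0 (lookup h 0)) + (k - single 0 (lookup k 0))"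
      by (simp add: lookup_add single_add)
    then show "h + k \<in> ?T" using h k in_ideal_add[of X I f] polys_add by (metis (mono_tags, lifting) mem_Collect_eq)
    have "h * k - single 0 (lookup (h * k) 0) =
        (h - single 0 (lookup h 0)) * k + (k - single 0 (lookup k 0)) * single 0 (lookup h 0)"
      by (simp add: lookup_mult_0 algebra_simps mult_single)
    moreover have "in_ideal X I f \<dots>"
      using h k by (intro in_ideal_add in_ideal_mult) auto
    ultimately show "h * k \<in> ?T" using h k polys_mult by auto
  next
    fix c h assume h: "h \<in> ?T"
    have "cscale c h - single 0 (lookup (cscale c h) 0) = cscale c (h - single 0 (lookup h 0))"
      by (simp add: lookup_cscale cpoly.scale_right_diff_distrib cscale_single)
    then show "cscale c h \<in> ?T" using h in_ideal_cscale[of X I f] polys_cscale by auto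
  qed (simp_all add: single_one)
  then have "subalgebra hull S \<subseteq> ?T" using assms(1) by (intro hull_minimal) auto
  then show ?thesis using assms(2,3) by auto
qed

section \<open>Total degree and homogeneous parts of products\<close>

lemma total_deg_le_iff: "total_deg f \<le> k \<longleftrightarrow> (\<forall>m\<in>keys f. monom_deg std m \<le> k)"
  by (cases "f = 0") (auto simp: total_deg_def)

lemma homogeneous_total_deg_le: "homogeneous std d f \<Longrightarrow> total_deg f \<le> d"
  unfolding total_deg_le_iff homogeneous_def by simp

lemma homogeneous_total_deg: "homogeneous std d f \<Longrightarrow> f \<noteq> 0 \<Longrightarrow> total_deg f = d"
proof -
  assume "homogeneous std d f" "f \<noteq> 0"
  then have "monom_deg std ` keys f = {d}" using keys_eq_empty by (fastforce simp: homogeneous_def)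
  then show "total_deg f = d" using \<open>f \<noteq> 0\<close> by (simp only: total_deg_def if_False Max_singleton)
qed

lemma homog_part_homogeneous: "homogeneous w e f \<Longrightarrow> homog_part w d f = (if d = e then f else 0)"
proof (cases "d = e")
  case True
  assume "homogeneous w e f"
  then show ?thesis using True unfolding homog_part_conv_restrict_monoms by (simp add: restrict_monoms_id homogeneous_def)
next
  case False
  assume "homogeneous w e f"
  then show ?thesis using False unfolding homog_part_conv_restrict_monoms
    by (intro poly_mapping_eqI) (auto simp: lookup_restrict_monoms homogeneous_def in_keys_iff)
qed

lemma homog_part_add: "homog_part w d (f + g) = homog_part w d f + homog_part w d g"
  and homog_part_0 [simp]: "homog_part w d 0 = 0"
  and homog_part_sum: "homog_part w d (sum h A) = (\<Sum>a\<in>A. homog_part w d (h a))"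
  and homog_part_cscale: "homog_part w d (cscale c f) = cscale c (homog_part w d f)"
  by (simp_all add: homog_part_conv_restrict_monoms restrict_monoms_add restrict_monoms_sum restrict_monoms_cscale)

lemma homog_part_mult:
  assumes "homogeneous w e a"
  shows "homog_part w d (a * b) = (if e \<le> d then a * homog_part w (d - e) b else 0)"
proof -
  have 1: "homog_part w d (single m c * b) = (if e \<le> d then single m c * homog_part w (d - e) b else 0)"
    if "m \<in> keys a" for m c
  proof -
    have "monom_deg w m = e" using that assms by (simp add: homogeneous_def)
    then have "(\<lambda>n. monom_deg w (m + n) = d) = (if e \<le> d then (\<lambda>n. monom_deg w n = d - e) else (\<lambda>n. False))"
      by (auto simp: monom_deg_add)
    moreover have "restrict_monoms (\<lambda>n. False) b = 0" by (rule poly_mapping_eqI) (simp add: lookup_restrict_monoms)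
    ultimately show ?thesis
      unfolding homog_part_conv_restrict_monoms restrict_monoms_single_mult by auto
  qed
  have "homog_part w d (\<Sum>m\<in>keys a. single m (lookup a m) * b) =
      (if e \<le> d then (\<Sum>m\<in>keys a. single m (lookup a m)) * homog_part w (d - e) b else 0)"
    by (simp add: homog_part_sum 1 sum_distrib_right)
  then show ?thesis unfolding sum_distrib_right[symmetric] poly_as_sum[symmetric] .
qed

lemma homog_part_lin_subst: "homog_part std d (lin_subst a Y f) = lin_subst a Y (homog_part std d f)"
proof -
  let ?D = "insert d (monom_deg std ` keys f)"
  have f: "f = (\<Sum>e\<in>?D. homog_part std e f)" by (rule sum_homog_parts) auto
  have "homog_part std d (lin_subst a Y f) = homog_part std d (lin_subst a Y (\<Sum>e\<in>?D. homog_part std e f))"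
    using f by simp
  also have "\<dots> = (\<Sum>e\<in>?D. homog_part std d (lin_subst a Y (homog_part std e f)))"
    by (simp only: lin_subst_simps homog_part_sum)
  also have "\<dots> = (\<Sum>e\<in>?D. if d = e then lin_subst a Y (homog_part std e f) else 0)"
    by (intro sum.cong refl homog_part_homogeneous homogeneous_lin_subst homogeneous_homog_part)
  also have "\<dots> = lin_subst a Y (homog_part std d f)" by (simp add: sum.delta')
  finally show ?thesis .
qed

text \<open>The index set of the large Koszul complex. The empty word is left out because its
  invariant is the unit 1.\<close>

definition low_words :: "'x set \<Rightarrow> nat \<Rightarrow> 'x list set" where
  "low_words X b = {w. set w \<subseteq> X \<and> 1 \<le> length w \<and> length w \<le> b}"

lemma finite_low_words: "finite X \<Longrightarrow> finite (low_words X b)"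
  by (rule finite_subset[OF _ finite_lists_length_le[of X b]]) (auto simp: low_words_def)

text \<open>The index set of the basis is arbitrary, since both standard bases and the basis
  \<open>perm_space G n\<close> of a permutation representation occur.\<close>

locale mrep = group G for G :: "('g, 'b) monoid_scheme" (structure) +
  fixes X :: "'x set" and r :: "'g \<Rightarrow> 'x \<Rightarrow> 'x \<Rightarrow> complex"
  assumes fin_G: "finite (carrier G)" and fin_X: "finite X"
    and r_one: "i \<in> X \<Longrightarrow> j \<in> X \<Longrightarrow> r \<one> i j = (if i = j then 1 else 0)"
    and r_mult: "g \<in> carrier G \<Longrightarrow> h \<in> carrier G \<Longrightarrow> i \<in> X \<Longrightarrow> j \<in> X \<Longrightarrow>
      r (g \<otimes> h) i j = (\<Sum>k\<in>X. r g i k * r h k j)"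
begin

section \<open>Invariants and the Reynolds operator\<close>

definition invs :: "'x cpoly set" where
  "invs = {f \<in> polys X. \<forall>g\<in>carrier G. lin_subst (r g) X f = f}"

definition reynolds :: "'x cpoly \<Rightarrow> 'x cpoly" where
  "reynolds f = cscale (1 / of_nat (card (carrier G))) (\<Sum>g\<in>carrier G. lin_subst (r g) X f)"

definition word_invariant :: "'x list \<Rightarrow> 'x cpoly" where
  "word_invariant w = reynolds (word_poly w)"

lemma card_G: "card (carrier G) > 0"
  using fin_G one_closed card_gt_0_iff by blast

lemma lin_subst_one: "f \<in> polys X \<Longrightarrow> lin_subst (r \<one>) X f = f"
  by (rule lin_subst_id) (simp_all add: fin_X r_one)

lemma lin_subst_mult:
  assumes "f \<in> polys X" "g \<in> carrier G" "h \<in> carrier G"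
  shows "lin_subst (r g) X (lin_subst (r h) X f) = lin_subst (r (g \<otimes> h)) X f"
  unfolding lin_subst_lin_subst[OF fin_X] by (rule lin_subst_cong[OF assms(1)]) (simp add: r_mult assms)

lemma reynolds_add: "reynolds (f + h) = reynolds f + reynolds h"
  and reynolds_cscale: "reynolds (cscale c f) = cscale c (reynolds f)"
  and reynolds_0 [simp]: "reynolds 0 = 0"
  by (simp_all add: reynolds_def lin_subst_simps sum.distrib cpoly.scale_right_distrib mult.commute
      flip: cscale_sum_right)

lemma reynolds_sum: "reynolds (sum f A) = (\<Sum>a\<in>A. reynolds (f a))"
  by (induction A rule: infinite_finite_induct) (simp_all add: reynolds_add)

lemma reynolds_polys: "reynolds f \<in> polys X"
  unfolding reynolds_def by (intro polys_cscale polys_sum polys_lin_subst)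

lemma reynolds_inv:
  assumes "f \<in> polys X"
  shows "reynolds f \<in> invs"
proof -
  have "lin_subst (r g) X (reynolds f) = reynolds f" if g: "g \<in> carrier G" for g
  proof -
    have "(\<Sum>h\<in>carrier G. lin_subst (r (g \<otimes> h)) X f) = (\<Sum>h\<in>carrier G. lin_subst (r h) X f)"
      by (rule sum.reindex_bij_witness[of _ "\<lambda>h. inv g \<otimes> h" "\<lambda>h. g \<otimes> h"])
        (use g in \<open>simp_all add: m_assoc[symmetric]\<close>)
    then show ?thesis
      unfolding reynolds_def using assms g by (simp add: lin_subst_simps lin_subst_mult)
  qed
  then show ?thesis by (simp add: invs_def reynolds_polys)
qed

lemma reynolds_id:
  assumes "f \<in> invs"
  shows "reynolds f = f"
proof -
  have "(\<Sum>g\<in>carrier G. lin_subst (r g) X f) = (\<Sum>g\<in>carrier G. f)"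
    using assms by (intro sum.cong) (simp_all add: invs_def)
  also have "\<dots> = cscale (of_nat (card (carrier G))) f"
    by (simp add: cscale_conv_mult single_of_nat)
  finally show ?thesis using card_G by (simp add: reynolds_def)
qed

lemma reynolds_mult: "f \<in> invs \<Longrightarrow> reynolds (f * h) = f * reynolds h"
  by (simp add: reynolds_def lin_subst_simps invs_def cscale_mult_right sum_distrib_left)

lemma homogeneous_reynolds: "homogeneous std d f \<Longrightarrow> homogeneous std d (reynolds f)"
  unfolding reynolds_def by (intro homogeneous_cscale homogeneous_sum homogeneous_lin_subst)

lemma word_invariant_inv: "set w \<subseteq> X \<Longrightarrow> word_invariant w \<in> invs"
  unfolding word_invariant_def by (intro reynolds_inv polys_word_poly)

lemma homogeneous_word_invariant: "homogeneous std (length w) (word_invariant w)"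
  unfolding word_invariant_def by (rule homogeneous_reynolds[OF homogeneous_word_poly])

lemma reynolds_words:
  assumes "finite W" "\<And>m. m \<in> keys f \<Longrightarrow> monom_word m \<in> W"
  shows "reynolds f = (\<Sum>w\<in>W. cscale (word_coeff f w) (word_invariant w))"
proof -
  have "reynolds f = reynolds (\<Sum>w\<in>W. cscale (word_coeff f w) (word_poly w))" using poly_words[OF assms] by simp
  then show ?thesis by (simp add: reynolds_sum reynolds_cscale word_invariant_def)
qed

lemma subalgebra_inv: "subalgebra invs"
  unfolding subalgebra_def
proof (intro conjI cpoly.subspaceI ballI)
qed (auto simp: invs_def lin_subst_simps polys_add polys_cscale polys_mult)

lemma homog_part_inv:
  assumes "f \<in> invs"
  shows "homog_part std d f \<in> invs"
proof -
  have "lin_subst (r g) X (homog_part std d f) = homog_part std d f" if "g \<in> carrier G" for g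
    unfolding homog_part_lin_subst[symmetric] using assms that by (simp add: invs_def)
  moreover have "homog_part std d f \<in> polys X"
    unfolding homog_part_conv_restrict_monoms using assms by (intro polys_restrict_monoms) (simp add: invs_def)
  ultimately show ?thesis by (simp add: invs_def)
qed

lemma inv_polys: "f \<in> invs \<Longrightarrow> f \<in> polys X"
  by (simp add: invs_def)

text \<open>For every \<open>s \<in> G\<close> the product of all \<open>s h f\<^sub>h - f\<^sub>h\<close> vanishes, because of the factor with
  \<open>s h = 1\<close>. Expanding and summing over \<open>s\<close> exhibits the product of all \<open>f\<^sub>h\<close> as an element of the
  ideal generated by invariants of degree at most the order of \<open>G\<close>.\<close>

lemma word_in_ideal:
  assumes w: "w \<in> words X (card (carrier G))"
  shows "in_ideal X (low_words X (card (carrier G))) word_invariant (word_poly w)"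
proof -
  let ?n = "card (carrier G)" and ?C = "carrier G"
  let ?I = "in_ideal X (low_words X ?n) word_invariant"
  \<comment> \<open>The letters of \<open>w\<close> are indexed by the group elements, which is
    possible as the length of \<open>w\<close> is the group order.\<close>
  obtain e where e: "bij_betw e ?C {0..<?n}" using ex_bij_betw_finite_nat[OF fin_G] by blast
  define f where "f h = var (w ! e h)" for h
  have lw: "length w = ?n" "set w \<subseteq> X" using w by (auto simp: words_def)
  have fX: "f h \<in> polys X" if "h \<in> ?C" for h
  proof -
    have "e h \<in> {0..<?n}" using bij_betw_apply[OF e that] .
    then show ?thesis unfolding f_def using lw nth_mem[of "e h" w] by (intro polys_var) auto
  qed
  have fhom: "homogeneous std 1 (f h)" for h by (simp add: f_def homogeneous_def var_def)
  have prodf: "(\<Prod>h\<in>?C. f h) = word_poly w"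
  proof -
    have "(\<Prod>h\<in>?C. f h) = (\<Prod>k\<in>{0..<?n}. var (w ! k))"
      unfolding f_def by (rule prod.reindex_bij_betw[OF e])
    also have "\<dots> = word_poly w" by (simp add: word_poly_def prod.list_conv_set_nth lw)
    finally show ?thesis .
  qed
  define P where "P S = (\<Prod>h\<in>S. lin_subst (r h) X (f h))" for S
  define B where "B S = (\<Prod>h\<in>?C - S. - f h)" for S
  have "(\<Prod>h\<in>?C. lin_subst (r (s \<otimes> h)) X (f h) + - f h) = 0" if s: "s \<in> ?C" for s
    using fin_G s by (intro prod_zero bexI[of _ "inv s"]) (simp_all add: lin_subst_one fX)
  then have "(\<Sum>S\<in>Pow ?C. (\<Prod>h\<in>S. lin_subst (r (s \<otimes> h)) X (f h)) * B S) = 0" if s: "s \<in> ?C" for s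
    using s unfolding prod_add[OF fin_G] B_def by simp
  moreover have "(\<Prod>h\<in>S. lin_subst (r (s \<otimes> h)) X (f h)) = lin_subst (r s) X (P S)" if "s \<in> ?C" "S \<in> Pow ?C" for s S
  proof -
    have "lin_subst (r s) X (P S) = (\<Prod>h\<in>S. lin_subst (r s) X (lin_subst (r h) X (f h)))"
      unfolding P_def lin_subst_def by (rule subst_poly_prod)
    also have "\<dots> = (\<Prod>h\<in>S. lin_subst (r (s \<otimes> h)) X (f h))"
      using that by (intro prod.cong refl lin_subst_mult fX) auto
    finally show ?thesis by simp
  qed
  ultimately have "(\<Sum>S\<in>Pow ?C. lin_subst (r s) X (P S) * B S) = 0" if "s \<in> ?C" for s
    using that by simp
  then have "0 = (\<Sum>s\<in>?C. \<Sum>S\<in>Pow ?C. lin_subst (r s) X (P S) * B S)" by simp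
  also have "\<dots> = (\<Sum>S\<in>Pow ?C. (\<Sum>s\<in>?C. lin_subst (r s) X (P S)) * B S)"
    by (subst sum.swap) (simp add: sum_distrib_right)
  also have "\<dots> = (\<Sum>S\<in>Pow ?C. cscale (of_nat ?n) (reynolds (P S)) * B S)"
    using card_G by (simp add: reynolds_def)
  also have "\<dots> = cscale (of_nat ?n) (\<Sum>S\<in>Pow ?C. reynolds (P S) * B S)"
    by (simp add: cscale_mult_left cscale_sum_right)
  finally have "of_nat ?n = (0 :: complex) \<or> (\<Sum>S\<in>Pow ?C. reynolds (P S) * B S) = 0"
    unfolding cpoly.scale_eq_0_iff[symmetric] by (rule sym)
  then have "(\<Sum>S\<in>Pow ?C. reynolds (P S) * B S) = 0" using card_G by simp
  \<comment> \<open>The term of the empty set is, up to sign, the given word, whereas every other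
    term contains an invariant of positive degree.\<close>
  then have "reynolds (P {}) * B {} = - (\<Sum>S\<in>Pow ?C - {{}}. reynolds (P S) * B S)"
    using fin_G by (simp add: sum.remove[of "Pow ?C" "{}"] add_eq_0_iff)
  moreover have "?I (\<Sum>S\<in>Pow ?C - {{}}. reynolds (P S) * B S)"
  proof (intro in_ideal_sum in_ideal_mult)
    fix S assume S: "S \<in> Pow ?C - {{}}"
    show "B S \<in> polys X" unfolding B_def by (intro polys_prod polys_uminus fX) auto
    have "finite S" using S fin_G finite_subset by blast
    have PX: "P S \<in> polys X" unfolding P_def by (intro polys_prod polys_lin_subst)
    have "homogeneous std (card T) (P T)" if "finite T" for T
      using that
    proof induction
      case (insert h T)
      then show ?case
        using homogeneous_mult[OF homogeneous_lin_subst[OF fhom] insert.IH] by (simp add: P_def)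
    qed (simp add: P_def homogeneous_def)
    then have "homogeneous std (card S) (P S)" using \<open>finite S\<close> by blast
    moreover have "1 \<le> card S" "card S \<le> ?n"
      using S \<open>finite S\<close> fin_G by (auto simp: Suc_le_eq card_gt_0_iff intro: card_mono)
    ultimately have "reynolds (P S) = (\<Sum>w\<in>low_words X ?n. cscale (word_coeff (P S) w) (word_invariant w))"
      using PX by (intro reynolds_words[OF finite_low_words[OF fin_X]])
        (auto simp: low_words_def length_monom_word polys_def homogeneous_def)
    then show "?I (reynolds (P S))"
      by (simp add: in_ideal_sum in_ideal_cscale in_ideal_gen finite_low_words fin_X)
  qed
  ultimately have "?I (reynolds (P {}) * B {})" by (simp add: in_ideal_uminus)
  moreover have "reynolds (P {}) = 1"
    using reynolds_id[of 1] subalgebraD(4)[OF subalgebra_inv] by (simp add: P_def)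
  moreover have "B {} = (- 1) ^ ?n * word_poly w"
    unfolding B_def prodf[symmetric] by (simp add: prod_uminus)
  ultimately have "?I ((- 1) ^ ?n * word_poly w)" by simp
  then have "?I (((- 1) ^ ?n * word_poly w) * single 0 ((- 1) ^ ?n))"
    by (rule in_ideal_mult) simp
  moreover have "((- 1) ^ ?n * word_poly w) * single 0 ((- 1) ^ ?n) = word_poly w"
    by (cases "even ?n") (simp_all add: single_one single_uminus)
  ultimately show ?thesis by simp
qed

text \<open>Induction on the degree. Beyond the group order each word has a prefix in the ideal of
  the low invariants, and the Reynolds operator turns the coefficients into invariants of smaller
  degree.\<close>

theorem noether_bound: "subalgebra hull {f \<in> invs. total_deg f \<le> card (carrier G)} = invs"
proof
  let ?n = "card (carrier G)"
  let ?H = "subalgebra hull {f \<in> invs. total_deg f \<le> ?n}"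
  show "?H \<subseteq> invs" by (rule hull_minimal) (auto simp: subalgebra_inv)
  note H = subalgebraD[OF subalgebra_hull[of "{f \<in> invs. total_deg f \<le> ?n}"]]
  have hom: "f \<in> ?H" if "f \<in> invs" "homogeneous std d f" for f d
    using that
  proof (induction d arbitrary: f rule: less_induct)
    case (less d)
    show ?case
    proof (cases "d \<le> ?n")
      case True
      then show ?thesis using less.prems homogeneous_total_deg_le by (intro hull_inc) fastforce
    next
      case False
      have "f = (\<Sum>w\<in>words X d. cscale (word_coeff f w) (word_poly w))"
        using less.prems fin_X by (intro polyI_words) (simp_all add: invs_def)
      moreover have "in_ideal X (low_words X ?n) word_invariant (word_poly w)" if w: "w \<in> words X d" for w
      proof -
        have "word_poly w = word_poly (take ?n w) * word_poly (drop ?n w)" by (metis append_take_drop_id word_poly_append)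
        moreover have "take ?n w \<in> words X ?n" "set (drop ?n w) \<subseteq> X"
          using w False by (auto simp: words_def dest: in_set_takeD in_set_dropD)
        ultimately show ?thesis using in_ideal_mult[OF word_in_ideal polys_word_poly] by simp
      qed
      ultimately have "in_ideal X (low_words X ?n) word_invariant f" by (metis (no_types, lifting) in_ideal_sum in_ideal_cscale)
      then obtain c where c: "\<And>u. c u \<in> polys X" "f = (\<Sum>u\<in>low_words X ?n. word_invariant u * c u)"
        by (auto simp: in_ideal_def)
      \<comment> \<open>Only the part of the coefficient of complementary degree contributes to
        \<open>f\<close>; passing to it makes the induction hypothesis applicable.\<close>
      define c' where "c' u = homog_part std (d - length u) (c u)" for u
      have c'X: "c' u \<in> polys X" for u using c(1) by (simp add: c'_def homog_part_conv_restrict_monoms polys_restrict_monoms)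
      have len: "length u \<le> d" "length u > 0" "set u \<subseteq> X" if "u \<in> low_words X ?n" for u
        using that False by (auto simp: low_words_def)
      have "f = homog_part std d f" using less.prems(2) homog_part_homogeneous by metis
      also have "\<dots> = (\<Sum>u\<in>low_words X ?n. homog_part std d (word_invariant u * c u))"
        by (subst c(2)) (rule homog_part_sum)
      also have "\<dots> = (\<Sum>u\<in>low_words X ?n. word_invariant u * c' u)"
        unfolding c'_def homog_part_mult[OF homogeneous_word_invariant]
        by (intro sum.cong refl) (simp only: len if_True)
      finally have "f = reynolds (\<Sum>u\<in>low_words X ?n. word_invariant u * c' u)" using reynolds_id[OF less.prems(1)] by simp
      also have "\<dots> = (\<Sum>u\<in>low_words X ?n. word_invariant u * reynolds (c' u))"
        by (simp add: reynolds_sum reynolds_mult word_invariant_inv len)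
      also have "\<dots> \<in> ?H"
      proof (intro H(5) H(2))
        fix u assume u: "u \<in> low_words X ?n"
        have "total_deg (word_invariant u) \<le> ?n"
          using homogeneous_total_deg_le[OF homogeneous_word_invariant[of u]] u by (simp add: low_words_def)
        then show "word_invariant u \<in> ?H" using u len by (intro hull_inc) (simp add: word_invariant_inv)
        have "d - length u < d" using len(1,2)[OF u] by (intro diff_less) linarith+
        then show "reynolds (c' u) \<in> ?H"
          by (rule less.IH) (intro reynolds_inv c'X, unfold c'_def, intro homogeneous_reynolds homogeneous_homog_part)
      qed
      finally show ?thesis .
    qed
  qed
  show "invs \<subseteq> ?H"
  proof
    fix f assume f: "f \<in> invs"
    have "f = (\<Sum>d\<in>monom_deg std ` keys f. homog_part std d f)" by (rule sum_homog_parts) auto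
    also have "\<dots> \<in> ?H"
      by (rule H(5), rule hom[OF homog_part_inv[OF f] homogeneous_homog_part])
    finally show "f \<in> ?H" .
  qed
qed

text \<open>A generator of degree at most \<open>b\<close>, freed from its constant term, equals its
  own Reynolds image and so is a combination of invariants of words in
  \<open>low_words X b\<close>.\<close>

lemma inv_in_ideal:
  assumes gen: "subalgebra hull {f \<in> invs. total_deg f \<le> b} = invs"
    and h: "h \<in> invs" "lookup h 0 = 0"
  shows "in_ideal X (low_words X b) word_invariant h"
proof (rule in_ideal_subalgebra_hull[where S = "{f \<in> invs. total_deg f \<le> b}"])
  fix f assume f: "f \<in> {f \<in> invs. total_deg f \<le> b}"
  let ?f = "f - single 0 (lookup f 0)"
  have "single 0 c = cscale c 1" for c :: complex by (simp add: cscale_conv_mult)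
  then have "single 0 c \<in> invs" for c :: complex using subalgebraD[OF subalgebra_inv] by metis
  then have "f + single 0 (- lookup f 0) \<in> invs" using f subalgebraD(1)[OF subalgebra_inv] by blast
  then have "?f = reynolds ?f" by (simp add: reynolds_id single_uminus)
  also have "\<dots> = (\<Sum>w\<in>low_words X b. cscale (word_coeff ?f w) (word_invariant w))"
  proof (rule reynolds_words[OF finite_low_words[OF fin_X]])
    fix m assume m: "m \<in> keys ?f"
    then have "m \<noteq> 0" "m \<in> keys f"
      by (auto simp: in_keys_iff lookup_minus lookup_single when_def split: if_splits)
    moreover have "monom_deg std m \<le> b" using f \<open>m \<in> keys f\<close> by (auto simp: total_deg_le_iff)
    moreover have "monom_deg std m \<noteq> 0" using \<open>m \<noteq> 0\<close> monom_deg_std_0_iff by metis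
    ultimately show "monom_word m \<in> low_words X b"
      using f by (auto simp: low_words_def length_monom_word invs_def polys_def)
  qed
  finally have "?f = (\<Sum>w\<in>low_words X b. cscale (word_coeff ?f w) (word_invariant w))" .
  moreover have "in_ideal X (low_words X b) word_invariant \<dots>"
    by (simp add: in_ideal_sum in_ideal_cscale in_ideal_gen finite_low_words fin_X)
  ultimately show "f \<in> polys X \<and> in_ideal X (low_words X b) word_invariant ?f" using f by (simp add: invs_def)
qed (use assms in auto)

lemma homogeneous_pos_lookup_0: "homogeneous std d f \<Longrightarrow> d > 0 \<Longrightarrow> lookup f 0 = 0"
  by (metis homogeneous_def in_keys_iff less_numeral_extra(3) monom_deg_0)

text \<open>Here the group order and the degree bound \<open>b\<close> meet: the first is the
  exponent, and the invariants of words up to that length are rewritten in terms of words of length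
  at most \<open>b\<close>.\<close>

lemma power_in_ideal:
  assumes gen: "subalgebra hull {f \<in> invs. total_deg f \<le> b} = invs" and x: "x \<in> X"
  shows "in_ideal X (low_words X b) word_invariant (var x ^ card (carrier G))"
proof -
  have "word_poly (replicate k x) = var x ^ k" for k by (induction k) simp_all
  moreover have "replicate (card (carrier G)) x \<in> words X (card (carrier G))"
    using x by (auto simp: words_def)
  ultimately have "in_ideal X (low_words X (card (carrier G))) word_invariant (var x ^ card (carrier G))"
    using word_in_ideal by metis
  then show ?thesis
  proof (rule in_ideal_trans)
    fix u assume "u \<in> low_words X (card (carrier G))"
    then show "in_ideal X (low_words X b) word_invariant (word_invariant u)"
      by (intro inv_in_ideal[OF gen] word_invariant_inv homogeneous_pos_lookup_0[OF homogeneous_word_invariant])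
        (auto simp: low_words_def)
  qed
qed

end

text \<open>The assumption \<open>eq\<close> says that \<open>a\<close> intertwines the two
  representations, so it can be pulled through the average over the group.\<close>

lemma lin_subst_reynolds:
  assumes "mrep G X r" "mrep G Y s"
    and eq: "\<And>g i j. g \<in> carrier G \<Longrightarrow> i \<in> Y \<Longrightarrow> j \<in> X \<Longrightarrow>
      (\<Sum>k\<in>X. a i k * r g k j) = (\<Sum>k\<in>Y. s g i k * a k j)"
    and f: "f \<in> polys X"
  shows "lin_subst a Y (mrep.reynolds G X r f) = mrep.reynolds G Y s (lin_subst a Y f)"
proof -
  interpret A: mrep G X r by fact
  interpret B: mrep G Y s by fact
  have "lin_subst a Y (lin_subst (r g) X f) = lin_subst (s g) Y (lin_subst a Y f)" if g: "g \<in> carrier G" for g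
    unfolding lin_subst_lin_subst[OF A.fin_X] lin_subst_lin_subst[OF B.fin_X] by (rule lin_subst_cong[OF f]) (simp add: eq g)
  then show ?thesis by (simp add: A.reynolds_def B.reynolds_def lin_subst_simps)
qed

section \<open>Functoriality of Koszul complexes\<close>

definition ring_hom_fun :: "('a::comm_ring_1 \<Rightarrow> 'b::comm_ring_1) \<Rightarrow> bool" where
  "ring_hom_fun h \<longleftrightarrow> (\<forall>a b. h (a + b) = h a + h b \<and> h (a * b) = h a * h b)"

lemma rhomD:
  assumes "ring_hom_fun h"
  shows "h (a + b) = h a + h b" "h (a * b) = h a * h b" "h 0 = 0" "h (- a) = - h a"
proof -
  show add: "h (a + b) = h a + h b" and "h (a * b) = h a * h b" for a b
    using assms by (auto simp: ring_hom_fun_def)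
  show 0: "h 0 = 0" using add[of 0 0] by simp
  show "h (- a) = - h a" using add[of a "- a"] 0 by (simp add: add_eq_0_iff)
qed

lemma ring_hom_fun_sum: "ring_hom_fun h \<Longrightarrow> h (sum f A) = (\<Sum>a\<in>A. h (f a))"
  by (induction A rule: infinite_finite_induct) (simp_all add: rhomD)

lemma ring_hom_fun_lin_subst: "ring_hom_fun (lin_subst a Y)"
  by (simp add: ring_hom_fun_def lin_subst_simps)

text \<open>The exterior power of the map taking the generator e_i to the sum of the C i j e_j,
  semilinear over \<open>h\<close>, evaluated at the list of indices.\<close>

primrec koszul_map :: "'i set \<Rightarrow> ('i \<Rightarrow> 'j \<Rightarrow> 'b::comm_ring_1) \<Rightarrow> ('a \<Rightarrow> 'b) \<Rightarrow> 'j list \<Rightarrow> ('i list \<Rightarrow> 'a) \<Rightarrow> 'b" where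
  "koszul_map I C h [] z = h (z [])"
| "koszul_map I C h (j # js) z = (\<Sum>i\<in>I. C i j * koszul_map I C h js (\<lambda>l. z (i # l)))"

lemma koszul_map_sum:
  assumes "ring_hom_fun h"
  shows "koszul_map I C h js (\<lambda>l. \<Sum>a\<in>A. f a * z a l) = (\<Sum>a\<in>A. h (f a) * koszul_map I C h js (z a))"
proof (induction js arbitrary: z)
  case Nil
  then show ?case by (simp add: ring_hom_fun_sum[OF assms] rhomD[OF assms])
next
  case (Cons j js)
  show ?case
    by (simp add: Cons.IH sum_distrib_left mult_ac) (rule sum.swap)
qed

lemma koszul_map_uminus:
  assumes "ring_hom_fun h"
  shows "koszul_map I C h js (\<lambda>l. - z l) = - koszul_map I C h js z"
  by (induction js arbitrary: z) (simp_all add: rhomD[OF assms] sum_negf)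

lemma koszul_map_0: "ring_hom_fun h \<Longrightarrow> koszul_map I C h js (\<lambda>l. 0) = 0"
  by (induction js) (simp_all add: rhomD)

text \<open>Compatibility on generators suffices for a chain map, since contraction only touches the
  first index, to which \<open>koszul_map\<close> applies its first matrix factor.\<close>

lemma koszul_d_koszul_map:
  assumes "ring_hom_fun h" "\<And>i. i \<in> I \<Longrightarrow> (\<Sum>j\<in>J. g j * C i j) = h (f i)"
  shows "koszul_d J g (\<lambda>js. koszul_map I C h js z) js = koszul_map I C h js (koszul_d I f z)"
proof -
  have "koszul_d J g (\<lambda>js. koszul_map I C h js z) js =
      (\<Sum>j\<in>J. \<Sum>i\<in>I. g j * C i j * koszul_map I C h js (\<lambda>l. z (i # l)))"
    by (simp add: koszul_d_def sum_distrib_left mult.assoc)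
  also have "\<dots> = (\<Sum>i\<in>I. (\<Sum>j\<in>J. g j * C i j) * koszul_map I C h js (\<lambda>l. z (i # l)))"
    by (subst sum.swap) (simp add: sum_distrib_right)
  also have "\<dots> = (\<Sum>i\<in>I. h (f i) * koszul_map I C h js (\<lambda>l. z (i # l)))"
    by (simp add: assms(2))
  also have "\<dots> = koszul_map I C h js (koszul_d I f z)"
    unfolding koszul_d_def[abs_def] koszul_map_sum[OF assms(1)] ..
  finally show ?thesis .
qed

lemma alternating_koszul_map:
  assumes h: "ring_hom_fun h" and z: "alternating z"
  shows "alternating (\<lambda>js. koszul_map I C h js z)"
proof -
  have "alternating z \<Longrightarrow> koszul_map I C h (u @ i # j # v) z = - koszul_map I C h (u @ j # i # v) z" for u i j v
  proof (induction u arbitrary: z)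
    case Nil
    have "koszul_map I C h ([] @ i # j # v) z =
        (\<Sum>a\<in>I. \<Sum>b\<in>I. C a i * (C b j * koszul_map I C h v (\<lambda>l. z (a # b # l))))"
      by (simp add: sum_distrib_left)
    also have "\<dots> = (\<Sum>b\<in>I. \<Sum>a\<in>I. C a i * (C b j * koszul_map I C h v (\<lambda>l. z (a # b # l))))"
      by (rule sum.swap)
    also have "\<dots> = (\<Sum>b\<in>I. \<Sum>a\<in>I. - (C b j * (C a i * koszul_map I C h v (\<lambda>l. z (b # a # l)))))"
    proof (intro sum.cong refl)
      fix a b
      have "koszul_map I C h v (\<lambda>l. z (a # b # l)) = - koszul_map I C h v (\<lambda>l. z (b # a # l))"
        unfolding alternating_swap[OF Nil, of a b] by (rule koszul_map_uminus[OF h])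
      then show "C a i * (C b j * koszul_map I C h v (\<lambda>l. z (a # b # l))) =
          - (C b j * (C a i * koszul_map I C h v (\<lambda>l. z (b # a # l))))" by (simp add: mult.left_commute)
    qed
    also have "\<dots> = - koszul_map I C h ([] @ j # i # v) z"
      by (simp add: sum_distrib_left sum_negf)
    finally show ?case .
  next
    case (Cons k u)
    then show ?case by (simp add: Cons.IH[OF alternating_Cons[OF Cons.prems]] sum_negf)
  qed
  then show ?thesis unfolding alternating_def[of "\<lambda>js. koszul_map I C h js z"] using z by blast
qed

lemma koszul_map_nonzeroD:
  assumes h: "ring_hom_fun h"
  shows "koszul_map I C h js z \<noteq> 0 \<Longrightarrow>
    (\<exists>l. length l = length js \<and> set l \<subseteq> I \<and> z l \<noteq> 0) \<and> (\<forall>j\<in>set js. \<exists>i\<in>I. C i j \<noteq> 0)"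
proof (induction js arbitrary: z)
  case Nil
  then show ?case using rhomD(3)[OF h] by auto
next
  case (Cons j js)
  then obtain i where i: "i \<in> I" "C i j * koszul_map I C h js (\<lambda>l. z (i # l)) \<noteq> 0"
    by (auto elim: sum.not_neutral_contains_not_neutral)
  then have "C i j \<noteq> 0" "koszul_map I C h js (\<lambda>l. z (i # l)) \<noteq> 0" by auto
  moreover obtain l where "length l = length js" "set l \<subseteq> I" "z (i # l) \<noteq> 0"
    using Cons.IH[OF calculation(2)] by blast
  ultimately show ?case
    using i(1) Cons.IH[of "\<lambda>l. z (i # l)"] by (intro conjI exI[of _ "i # l"]) auto
qed

lemma koszul_koszul_map:
  assumes h: "ring_hom_fun h" and z: "koszul I p z" and C: "\<And>i j. i \<in> I \<Longrightarrow> j \<notin> J \<Longrightarrow> C i j = 0"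
  shows "koszul J p (\<lambda>js. koszul_map I C h js z)"
proof -
  have "js \<in> words J p" if nz: "koszul_map I C h js z \<noteq> 0" for js
  proof -
    obtain l where "length l = length js" "z l \<noteq> 0" using koszul_map_nonzeroD[OF h nz] by blast
    then have "length js = p" using koszul_outside[OF z, of l] by (auto simp: words_def)
    moreover have "set js \<subseteq> J" using koszul_map_nonzeroD[OF h nz] C by blast
    ultimately show ?thesis by (simp add: words_def)
  qed
  then show ?thesis using alternating_koszul_map[OF h] z by (auto simp: koszul_def)
qed

lemma koszul_map_comp:
  assumes h': "ring_hom_fun h'"
  shows "koszul_map J D h' ls (\<lambda>js. koszul_map I C h js z) =
    koszul_map I (\<lambda>i l. \<Sum>j\<in>J. h' (C i j) * D j l) (\<lambda>a. h' (h a)) ls z"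
proof (induction ls arbitrary: z)
  case (Cons l ls)
  have "koszul_map J D h' (l # ls) (\<lambda>js. koszul_map I C h js z) =
      (\<Sum>j\<in>J. \<Sum>i\<in>I. D j l * (h' (C i j) * koszul_map J D h' ls (\<lambda>js. koszul_map I C h js (\<lambda>l. z (i # l)))))"
    by (simp add: koszul_map_sum[OF h'] sum_distrib_left)
  also have "\<dots> = (\<Sum>i\<in>I. (\<Sum>j\<in>J. h' (C i j) * D j l) *
      koszul_map I (\<lambda>i l. \<Sum>j\<in>J. h' (C i j) * D j l) (\<lambda>a. h' (h a)) ls (\<lambda>l. z (i # l)))"
    by (subst sum.swap) (simp add: Cons.IH sum_distrib_right mult_ac)
  finally show ?case by simp
qed simp

lemma koszul_map_id:
  assumes "finite I" "koszul I p z" "\<And>l. h (z l) = z l" "h 0 = 0"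
    "\<And>i j. i \<in> I \<Longrightarrow> C i j = (if i = j then 1 else 0)"
  shows "koszul_map I C h l z = z l"
proof -
  have "(\<And>l. \<not> set l \<subseteq> I \<Longrightarrow> z l = 0) \<Longrightarrow> (\<And>l. h (z l) = z l) \<Longrightarrow> koszul_map I C h l z = z l" for l
  proof (induction l arbitrary: z)
    case (Cons j l)
    have IH: "koszul_map I C h l (\<lambda>l. z (i # l)) = z (i # l)" if "i \<in> I" for i
      using Cons.prems that by (intro Cons.IH) auto
    have "koszul_map I C h (j # l) z = (\<Sum>i\<in>I. if i = j then z (i # l) else 0)"
      unfolding koszul_map.simps by (intro sum.cong refl) (auto simp: IH assms(5))
    then show ?case using assms(1) Cons.prems(1)[of "j # l"] by auto
  qed simp
  then show ?thesis using assms(2,3) by (auto simp: koszul_def words_def)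
qed

text \<open>The offset \<open>c\<close> collects the degrees of indices that a recursion has already
  split off; for whole chains it is 0.\<close>

definition graded_chain :: "('i \<Rightarrow> nat) \<Rightarrow> nat \<Rightarrow> nat \<Rightarrow> ('i list \<Rightarrow> 'x cpoly) \<Rightarrow> bool" where
  "graded_chain v c d z \<longleftrightarrow> (\<forall>l. \<forall>m\<in>keys (z l). monom_deg std m + sum_list (map v l) + c = d)"

lemma graded_chain_Cons: "graded_chain v c d z \<Longrightarrow> graded_chain v (c + v i) d (\<lambda>l. z (i # l))"
  by (force simp: graded_chain_def)

lemma graded_chain_koszul_map:
  assumes C: "\<And>i j m. i \<in> I \<Longrightarrow> m \<in> keys (C i j) \<Longrightarrow> m = 0 \<and> v i = v' j"
    and h: "\<And>f d. homogeneous std d f \<Longrightarrow> homogeneous std d (h f)" and z: "graded_chain v c d z"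
  shows "graded_chain v' c d (\<lambda>js. koszul_map I C h js z)"
proof -
  have "graded_chain v c d z \<Longrightarrow> m \<in> keys (koszul_map I C h js z) \<Longrightarrow> monom_deg std m + sum_list (map v' js) + c = d"
    for m js
  proof (induction js arbitrary: c z m)
    case Nil
    then have "h (z []) \<noteq> 0" by auto
    have "\<forall>m\<in>keys (z []). monom_deg std m + c = d" using Nil.prems(1) by (force simp: graded_chain_def)
    then have "homogeneous std (d - c) (z [])" by (auto simp: homogeneous_def)
    then have "homogeneous std (d - c) (h (z []))" by (rule h)
    \<comment> \<open>This is needed as \<open>d - c\<close> is truncated. If \<open>z []\<close>
      vanishes, then \<open>h (z [])\<close> is homogeneous of every degree, which the monomial
      \<open>m\<close> contradicts.\<close>
    moreover have "c \<le> d"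
    proof (cases "z [] = 0")
      case True
      then have "homogeneous std k (h (z []))" for k by (intro h) simp
      then have "monom_deg std m = k" for k using Nil.prems(2) unfolding homogeneous_def koszul_map.simps by blast
      from this[of 0] this[of 1] show ?thesis by simp
    next
      case False
      then show ?thesis using \<open>\<forall>m\<in>keys (z []). monom_deg std m + c = d\<close>
        by (metis keys_eq_empty all_not_in_conv le_add2)
    qed
    ultimately show ?case using Nil.prems(2) by (auto simp: homogeneous_def)
  next
    case (Cons j js)
    have "keys (\<Sum>i\<in>I. C i j * koszul_map I C h js (\<lambda>l. z (i # l))) \<subseteq>
        (\<Union>i\<in>I. keys (C i j * koszul_map I C h js (\<lambda>l. z (i # l))))"
      by (rule subsetI, rule ccontr) (simp add: in_keys_iff lookup_sum)
    then obtain i where i: "i \<in> I" "m \<in> keys (C i j * koszul_map I C h js (\<lambda>l. z (i # l)))"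
      using Cons.prems(2) by auto
    then obtain a b where ab: "a \<in> keys (C i j)" "b \<in> keys (koszul_map I C h js (\<lambda>l. z (i # l)))" "m = a + b"
      using keys_mult by blast
    have "monom_deg std b + sum_list (map v' js) + (c + v i) = d"
      by (rule Cons.IH[OF graded_chain_Cons[OF Cons.prems(1)] ab(2)])
    then show ?case using C[OF i(1) ab(1)] ab(3) by simp
  qed
  then show ?thesis using z unfolding graded_chain_def[of v'] by blast
qed

lemma graded_chain_wedge:
  assumes c: "\<And>i m. m \<in> keys (c i) \<Longrightarrow> monom_deg std m + v i = k" and z: "graded_chain v e d z"
  shows "graded_chain v e (d + k) (\<lambda>l. wedge c l z)"
proof -
  have "graded_chain v e d z \<Longrightarrow> m \<in> keys (wedge c l z) \<Longrightarrow> monom_deg std m + sum_list (map v l) + e = d + k"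
    for m l
  proof (induction l arbitrary: e z)
    case (Cons i l)
    have "m \<in> keys (c i * z l) \<or> m \<in> keys (wedge c l (\<lambda>l. z (i # l)))"
      using Cons.prems(2) by (auto simp: in_keys_iff lookup_minus)
    then show ?case
    proof
      assume "m \<in> keys (c i * z l)"
      then obtain a b where ab: "a \<in> keys (c i)" "b \<in> keys (z l)" "m = a + b"
        using keys_mult by blast
      then have "monom_deg std b + sum_list (map v l) + e = d" using Cons.prems(1) unfolding graded_chain_def by blast
      then show ?thesis using c[OF ab(1)] unfolding ab(3) monom_deg_add by simp
    next
      assume "m \<in> keys (wedge c l (\<lambda>l. z (i # l)))"
      from Cons.IH[OF graded_chain_Cons[OF Cons.prems(1)] this] show ?thesis by simp
    qed
  qed simp
  then show ?thesis using z unfolding graded_chain_def[of v e "d + k"] by blast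
qed

lemma polys_wedge:
  assumes "\<And>i. c i \<in> polys X" "\<And>l. z l \<in> polys X"
  shows "wedge c l z \<in> polys X"
  using assms(2)
proof (induction l arbitrary: z)
  case (Cons i l)
  have "wedge c l (\<lambda>l. z (i # l)) \<in> polys X" using Cons.prems by (rule Cons.IH)
  then show ?case using polys_diff[OF polys_mult[OF assms(1) Cons.prems]] by simp
qed simp

lemma sum_list_length_le: "(\<And>w. w \<in> set l \<Longrightarrow> length w \<le> b) \<Longrightarrow> sum_list (map length l) \<le> length l * b"
  by (induction l) (simp_all add: add_le_mono)

context mrep
begin

text \<open>Wedging with the elements \<open>c\<^sub>x\<close> whose differential is \<open>x\<^sup>k\<close> raises the degree so much that all
  monomials lie in the ideal generated by the powers \<open>x\<^sup>k\<close>.\<close>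

theorem koszul_vanishing:
  assumes gen: "subalgebra hull {f \<in> invs. total_deg f \<le> b} = invs"
    and z: "koszul (low_words X b) p z" "\<And>l. z l \<in> polys X" "graded_chain length 0 d z"
      "\<And>l. koszul_d (low_words X b) word_invariant z l = 0"
    and d: "(p + card X) * b < d + card X"
  shows "\<exists>y. koszul (low_words X b) (Suc p) y \<and> z = koszul_d (low_words X b) word_invariant y"
proof -
  let ?U = "low_words X b"
  define k where "k = card (carrier G)"
  have "\<exists>c. (\<forall>u. c u \<in> polys X) \<and> var x ^ k = (\<Sum>u\<in>?U. word_invariant u * c u)" if "x \<in> X" for x
    using power_in_ideal[OF gen that] by (simp add: in_ideal_def k_def)
  then obtain c0 where c0: "\<And>x u. x \<in> X \<Longrightarrow> c0 x u \<in> polys X"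
    "\<And>x. x \<in> X \<Longrightarrow> var x ^ k = (\<Sum>u\<in>?U. word_invariant u * c0 x u)" by metis
  \<comment> \<open>Cutting the coefficients down to degree \<open>k - length u\<close> makes
    \<open>c x\<close> a homogeneous one-chain of degree \<open>k\<close> and leaves its
    differential unchanged.\<close>
  define c where "c x u = (if x \<in> X \<and> u \<in> ?U \<and> length u \<le> k then homog_part std (k - length u) (c0 x u) else 0)" for x u
  have c: "(\<Sum>u\<in>?U. word_invariant u * c x u) = var x ^ k" if x: "x \<in> X" for x
  proof -
    have "homogeneous std k (var x ^ k)" by (simp add: var_power homogeneous_def)
    then have "var x ^ k = homog_part std k (\<Sum>u\<in>?U. word_invariant u * c0 x u)"
      using homog_part_homogeneous c0(2)[OF x] by metis
    also have "\<dots> = (\<Sum>u\<in>?U. word_invariant u * c x u)"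
      unfolding homog_part_sum homog_part_mult[OF homogeneous_word_invariant] c_def
      using x by (intro sum.cong refl) auto
    finally show ?thesis by simp
  qed
  have cX: "c x u \<in> polys X" for x u
    using c0(1)[of x u] by (auto simp: c_def homog_part_conv_restrict_monoms polys_restrict_monoms)
  have cdeg: "monom_deg std m + length u = k" if "m \<in> keys (c x u)" for m x u
    using that by (auto simp: c_def homog_part_conv_restrict_monoms keys_restrict_monoms split: if_splits)
  have cU: "c x u = 0" if "u \<notin> ?U" for x u using that by (simp add: c_def)
  obtain xs where xs: "set xs = X" "distinct xs" using finite_distinct_list[OF fin_X] by blast
  have W: "koszul ?U (length xs + p) (wedges c xs z)" by (rule koszul_wedges[OF z(1) cU])
  have WX: "wedges c ys z l \<in> polys X" for ys l
    by (induction ys arbitrary: l) (auto intro: polys_wedge cX z(2))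
  have Wdeg: "graded_chain length 0 (d + length ys * k) (wedges c ys z)" for ys
  proof (induction ys)
    case (Cons x ys)
    show ?case using graded_chain_wedge[OF cdeg Cons.IH] by (simp add: add_ac)
  qed (simp add: z(3))
  \<comment> \<open>A monomial with all exponents below k has degree at most
    \<open>card X * (k - 1)\<close>. The product has total degree \<open>d + card X * k\<close>, and
    its indices take up at most \<open>(p + card X) * b\<close>; by the assumption on
    \<open>d\<close> too much is left for such a monomial.\<close>
  have "in_powers k X (wedges c xs z l)" for l
  proof (cases "l \<in> words ?U (length xs + p)")
    case True
    have "\<exists>x\<in>X. k \<le> lookup m x" if m: "m \<in> keys (wedges c xs z l)" for m
    proof (rule ccontr)
      assume "\<not> (\<exists>x\<in>X. k \<le> lookup m x)"
      then have less: "lookup m x + 1 \<le> k" if "x \<in> X" for x using that by fastforce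
      have N: "length xs = card X" using xs distinct_card by metis
      have "sum_list (map length l) \<le> length l * b"
        using True by (intro sum_list_length_le) (auto simp: words_def low_words_def)
      then have "sum_list (map length l) \<le> (card X + p) * b" using True N by (simp add: words_def)
      moreover have "monom_deg std m + sum_list (map length l) = d + card X * k"
        using Wdeg[of xs] m N unfolding graded_chain_def by fastforce
      moreover have "keys m \<subseteq> X" using WX[of xs l] m by (auto simp: polys_def)
      then have "monom_deg std m = (\<Sum>x\<in>X. lookup m x)"
        by (simp add: monom_deg_superset[OF fin_X])
      then have "monom_deg std m + card X \<le> card X * k"
        using sum_mono[of X "\<lambda>x. lookup m x + 1" "\<lambda>_. k"] less by (simp add: sum_Suc)
      ultimately show False using d by (simp add: add.commute)
    qed
    then show ?thesis by (simp add: in_powers_def)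
  next
    case False
    then show ?thesis using koszul_outside[OF W] by simp
  qed
  \<comment> \<open>The product is 0 modulo all powers, so the descent can start with the correcting
    chain 0.\<close>
  then show ?thesis
    using xs c
    by (intro koszul_descent[OF z(1,4) cU, where xs = xs and k = k and u = "\<lambda>_. 0"])
      (auto simp: koszul_def koszul_d_def)
qed

end

text \<open>Coefficients with respect to \<open>B\<close> are chosen linearly, by extending
  \<open>B\<close> to a basis, and are unit vectors on \<open>B\<close>. This makes the composite of
  the comparison maps in \<open>koszul_retract\<close> the identity itself and not merely homotopic
  to it.\<close>

lemma linear_section:
  fixes B :: "'x cpoly set"
  assumes B: "cpoly.independent B" "B \<subseteq> V" and V: "cpoly.subspace V"
    and ex: "\<And>h. h \<in> V \<Longrightarrow> \<exists>c. h = (\<Sum>b\<in>B. b * c b)" and fin: "finite B"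
  shows "\<exists>s :: 'x cpoly \<Rightarrow> 'x cpoly \<Rightarrow> 'x cpoly.
    (\<forall>f h b. s (f + h) b = s f b + s h b) \<and> (\<forall>c f b. s (cscale c f) b = cscale c (s f b)) \<and>
    (\<forall>b\<in>B. \<forall>b'. s b b' = (if b = b' then 1 else 0)) \<and> (\<forall>h\<in>V. (\<Sum>b\<in>B. b * s h b) = h)"
proof -
  interpret fs: vector_space "\<lambda>c (f :: 'x cpoly \<Rightarrow> 'x cpoly) i. cscale c (f i)"
    by unfold_locales (auto simp: fun_eq_iff cpoly.scale_right_distrib cpoly.scale_left_distrib)
  interpret vp: vector_space_pair cscale "\<lambda>c (f :: 'x cpoly \<Rightarrow> 'x cpoly) i. cscale c (f i)" ..
  obtain B' where B': "B \<subseteq> B'" "B' \<subseteq> V" "cpoly.independent B'" "V \<subseteq> cpoly.span B'"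
    using cpoly.maximal_independent_subset_extend[OF B(2,1)] by blast
  obtain c where c: "\<And>h. h \<in> V \<Longrightarrow> h = (\<Sum>b\<in>B. b * c h b)" using ex by metis
  define f0 where "f0 v = (if v \<in> B then (\<lambda>b'. if v = b' then 1 else 0) else c v)" for v
  obtain s where s: "Vector_Spaces.linear cscale (\<lambda>c (f :: 'x cpoly \<Rightarrow> 'x cpoly) i. cscale c (f i)) s"
    "\<And>v. v \<in> B' \<Longrightarrow> s v = f0 v"
    using vp.linear_independent_extend[OF B'(3), of f0] by blast
  interpret s: Vector_Spaces.linear cscale "\<lambda>c (f :: 'x cpoly \<Rightarrow> 'x cpoly) i. cscale c (f i)" s by fact
  have lin_subst: "s (f + h) b = s f b + s h b" "s (cscale c f) b = cscale c (s f b)" for f h b c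
    by (simp_all add: s.add s.scale)
  have "(\<Sum>b\<in>B. b * s h b) = h" if "h \<in> cpoly.span B'" for h
    using that
  proof (induction rule: cpoly.span_induct)
    case base
    show ?case
      by (rule cpoly.subspaceI)
        (auto simp: lin_subst s.zero zero_fun_def algebra_simps sum.distrib cscale_mult_right simp flip: cscale_sum_right)
  next
    case (step v)
    show ?case
    proof (cases "v \<in> B")
      case True
      then show ?thesis using s(2)[OF step] fin by (simp add: f0_def if_distrib cong: if_cong)
    next
      case False
      then show ?thesis using s(2)[OF step] c[of v] step B'(2) by (auto simp: f0_def)
    qed
  qed
  then show ?thesis using lin_subst s(2) B'(1,4) by (intro exI[of _ s]) (auto simp: f0_def)
qed

text \<open>The generators in \<open>B\<close> go to word generators by expanding their images under
  \<iota> into words, and come back by expressing the images of word invariants under \<pi> linearly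
  through \<open>B\<close>. The round trip is the identity, so a bounding chain found in the large
  complex returns to one for \<open>z\<close>; its coefficients are then made invariant by the
  Reynolds operator.\<close>

lemma koszul_retract:
  fixes X :: "'x set" and Y :: "'y set"
  assumes V: "mrep G X r" and W: "mrep G Y s"
    and B: "finite B" "cpoly.independent B" "B \<subseteq> mrep.invs G X r" "subalgebra hull B = mrep.invs G X r"
      "\<And>b. b \<in> B \<Longrightarrow> homogeneous std (total_deg b) b \<and> 1 \<le> total_deg b \<and> total_deg b \<le> \<beta>"
    and \<iota>: "\<And>g i j. g \<in> carrier G \<Longrightarrow> i \<in> Y \<Longrightarrow> j \<in> X \<Longrightarrow>
      (\<Sum>k\<in>X. \<iota> i k * r g k j) = (\<Sum>k\<in>Y. s g i k * \<iota> k j)"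
    and \<pi>: "\<And>g i j. g \<in> carrier G \<Longrightarrow> i \<in> X \<Longrightarrow> j \<in> Y \<Longrightarrow>
      (\<Sum>k\<in>Y. \<pi> i k * s g k j) = (\<Sum>k\<in>X. r g i k * \<pi> k j)"
    and \<pi>\<iota>: "\<And>i j. i \<in> X \<Longrightarrow> j \<in> X \<Longrightarrow> (\<Sum>k\<in>Y. \<pi> i k * \<iota> k j) = (if i = j then 1 else 0)"
    and van: "\<And>z. koszul (low_words Y \<beta>) p z \<Longrightarrow> (\<And>l. z l \<in> polys Y) \<Longrightarrow> graded_chain length 0 d z \<Longrightarrow>
      (\<And>l. koszul_d (low_words Y \<beta>) (mrep.word_invariant G Y s) z l = 0) \<Longrightarrow>
      \<exists>y. koszul (low_words Y \<beta>) (Suc p) y \<and> z = koszul_d (low_words Y \<beta>) (mrep.word_invariant G Y s) y"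
    and z: "koszul B p z" "\<And>l. z l \<in> mrep.invs G X r" "graded_chain total_deg 0 d z" "\<And>l. koszul_d B (\<lambda>b. b) z l = 0"
  shows "\<exists>u. koszul B (Suc p) u \<and> (\<forall>l. u l \<in> mrep.invs G X r) \<and> z = koszul_d B (\<lambda>b. b) u"
proof -
  interpret V: mrep G X r by fact
  interpret W: mrep G Y s by fact
  let ?U = "low_words Y \<beta>" and ?h = "lin_subst \<iota> Y" and ?h' = "lin_subst \<pi> X"
  have UF: "finite ?U" by (rule finite_low_words[OF W.fin_X])
  have h'h: "?h' (?h f) = f" if "f \<in> polys X" for f
    unfolding lin_subst_lin_subst[OF W.fin_X] by (rule lin_subst_id[OF that V.fin_X]) (simp add: \<pi>\<iota>)
  have BX: "b \<in> polys X" if "b \<in> B" for b using that B(3) V.inv_polys by blast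
  \<comment> \<open>Constants suffice as coefficients: the image of \<open>b\<close> is invariant,
    hence its own Reynolds image, and so a linear combination of word invariants.\<close>
  define \<alpha> :: "'x cpoly \<Rightarrow> 'y list \<Rightarrow> 'y cpoly" where "\<alpha> b w = (if w \<in> ?U then single 0 (word_coeff (?h b) w) else 0)" for b w
  have hb: "homogeneous std (total_deg b) (?h b)" if "b \<in> B" for b
    using B(5) that by (intro homogeneous_lin_subst) blast
  have inU: "monom_word m \<in> ?U" "length (monom_word m) = total_deg b" if "b \<in> B" "m \<in> keys (?h b)" for b m
  proof -
    have "monom_deg std m = total_deg b" using hb[OF that(1)] that(2) unfolding homogeneous_def by blast
    then show "length (monom_word m) = total_deg b" by (simp only: length_monom_word)
    moreover have "keys m \<subseteq> Y" using polys_lin_subst[of \<iota> Y b] that(2) by (auto simp: polys_def)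
    ultimately show "monom_word m \<in> ?U" using B(5)[OF that(1)] by (auto simp: low_words_def)
  qed
  have hfw: "(\<Sum>w\<in>?U. cscale (word_coeff (?h b) w) (W.word_invariant w)) = ?h b" if "b \<in> B" for b
  proof -
    have "(\<Sum>w\<in>?U. cscale (word_coeff (?h b) w) (W.word_invariant w)) = W.reynolds (?h b)"
      by (rule W.reynolds_words[OF UF, symmetric]) (rule inU(1)[OF that])
    also have "\<dots> = ?h (V.reynolds b)" using lin_subst_reynolds[OF V W \<iota> BX[OF that]] by simp
    also have "\<dots> = ?h b" using V.reynolds_id B(3) that by auto
    finally show ?thesis .
  qed
  have \<alpha>f: "W.word_invariant w * \<alpha> b w = cscale (word_coeff (?h b) w) (W.word_invariant w)" if "w \<in> ?U" for b w
    using that by (simp add: \<alpha>_def cscale_conv_mult mult.commute)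
  have \<alpha>chain: "(\<Sum>w\<in>?U. W.word_invariant w * \<alpha> b w) = ?h b" if "b \<in> B" for b
    using hfw[OF that] by (simp add: \<alpha>f)
  define z1 where "z1 ws = koszul_map B \<alpha> ?h ws z" for ws
  have "koszul ?U p z1"
    unfolding z1_def by (rule koszul_koszul_map[OF ring_hom_fun_lin_subst z(1)]) (simp add: \<alpha>_def)
  moreover have "z1 ws \<in> polys Y" for ws
  proof -
    have "koszul_map B \<alpha> ?h ws z \<in> polys Y" for z
      by (induction ws arbitrary: z) (auto intro!: polys_lin_subst polys_sum polys_mult simp: \<alpha>_def)
    then show ?thesis by (simp add: z1_def)
  qed
  moreover have "graded_chain length 0 d z1"
    unfolding z1_def
  proof (rule graded_chain_koszul_map[OF _ homogeneous_lin_subst z(3)])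
    fix b w m assume b: "b \<in> B" and m: "m \<in> keys (\<alpha> b w)"
    then have "m = 0" "word_coeff (?h b) w \<noteq> 0" "monom_word (word_exponent w) = w" by (auto simp: \<alpha>_def word_coeff_def split: if_splits)
    moreover from this(2) have "length (monom_word (word_exponent w)) = total_deg b" by (rule inU(2)[OF b word_coeff_nonzeroD])
    ultimately show "m = 0 \<and> total_deg b = length w" by simp
  qed
  moreover have "koszul_d ?U W.word_invariant z1 ws = 0" for ws
  proof -
    have "koszul_d ?U W.word_invariant z1 ws = koszul_map B \<alpha> ?h ws (koszul_d B (\<lambda>b. b) z)"
      unfolding z1_def by (rule koszul_d_koszul_map[OF ring_hom_fun_lin_subst]) (rule \<alpha>chain)
    also have "koszul_d B (\<lambda>b. b) z = (\<lambda>l. 0)" using z(4) by (rule ext)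
    finally show ?thesis by (simp add: koszul_map_0[OF ring_hom_fun_lin_subst])
  qed
  ultimately obtain y where y: "koszul ?U (Suc p) y" "z1 = koszul_d ?U W.word_invariant y" using van by blast
  define V0 where "V0 = {h \<in> V.invs. lookup h 0 = 0}"
  have idlB: "in_ideal X B (\<lambda>b. b) h" if "h \<in> V0" for h
  proof (rule in_ideal_subalgebra_hull)
    fix b assume b: "b \<in> B"
    have "lookup b 0 = 0" using B(5)[OF b] V.homogeneous_pos_lookup_0[of "total_deg b" b] by simp
    then show "b \<in> polys X \<and> in_ideal X B (\<lambda>b. b) (b - single 0 (lookup b 0))"
      using in_ideal_gen[OF B(1) b, of X "\<lambda>b. b"] BX[OF b] by simp
  qed (use that B(4) in \<open>auto simp: V0_def\<close>)
  have V0: "cpoly.subspace V0" "B \<subseteq> V0"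
  proof -
    show "cpoly.subspace V0"
      using V.subalgebra_inv unfolding V0_def subalgebra_def
      by (intro cpoly.subspaceI) (auto simp: cpoly.subspace_def lookup_add lookup_cscale)
    show "B \<subseteq> V0"
      using B(3,5) V.homogeneous_pos_lookup_0 by (force simp: V0_def)
  qed
  have ex: "\<exists>c. h = (\<Sum>b\<in>B. b * c b)" if "h \<in> V0" for h using idlB[OF that] by (auto simp: in_ideal_def)
  obtain \<sigma> where "\<forall>f h b. \<sigma> (f + h) b = \<sigma> f b + \<sigma> h b" "\<forall>c f b. \<sigma> (cscale c f) b = cscale c (\<sigma> f b)"
    "\<forall>b\<in>B. \<forall>b'. \<sigma> b b' = (if b = b' then 1 else 0)" "\<forall>h\<in>V0. (\<Sum>b\<in>B. b * \<sigma> h b) = h"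
    using linear_section[OF B(2) V0(2,1) ex B(1)] by blast
  note \<sigma> = this(1,2)[rule_format] this(3,4)[rule_format]
  have \<sigma>0: "\<sigma> 0 b = 0" for b using \<sigma>(2)[of 0 0 b] by simp
  have \<sigma>sum: "\<sigma> (sum f A) b = (\<Sum>a\<in>A. \<sigma> (f a) b)" for f :: "'y list \<Rightarrow> _" and A b
    by (induction A rule: infinite_finite_induct) (simp_all add: \<sigma>0 \<sigma>(1))
  \<comment> \<open>These coefficients need not be constant, but they depend linearly on the word
    invariant, which is how the composite with \<alpha> is computed.\<close>
  define \<gamma> where "\<gamma> w b = (if b \<in> B then \<sigma> (?h' (W.word_invariant w)) b else 0)" for w b
  have \<pi>word_invariant: "?h' (W.word_invariant w) \<in> V0" if "w \<in> ?U" for w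
  proof -
    have w: "set w \<subseteq> Y" "length w > 0" using that by (auto simp: low_words_def)
    have "?h' (W.word_invariant w) = V.reynolds (?h' (word_poly w))"
      unfolding W.word_invariant_def by (rule lin_subst_reynolds[OF W V \<pi> polys_word_poly[OF w(1)]])
    then have "?h' (W.word_invariant w) \<in> V.invs" by (simp add: V.reynolds_inv polys_lin_subst)
    moreover have "lookup (?h' (W.word_invariant w)) 0 = 0"
      by (rule V.homogeneous_pos_lookup_0[OF homogeneous_lin_subst[OF W.homogeneous_word_invariant] w(2)])
    ultimately show ?thesis by (simp add: V0_def)
  qed
  have \<gamma>chain: "(\<Sum>b\<in>B. b * \<gamma> w b) = ?h' (W.word_invariant w)" if "w \<in> ?U" for w
    using \<sigma>(4)[OF \<pi>word_invariant[OF that]] by (simp add: \<gamma>_def)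
  define u0 where "u0 l = koszul_map ?U \<gamma> ?h' l y" for l
  have u0: "koszul B (Suc p) u0"
    unfolding u0_def by (rule koszul_koszul_map[OF ring_hom_fun_lin_subst y(1)]) (simp add: \<gamma>_def)
  have zu0: "z l = koszul_d B (\<lambda>b. b) u0 l" for l
  proof -
    have "koszul_d B (\<lambda>b. b) u0 l = koszul_map ?U \<gamma> ?h' l z1"
      unfolding u0_def y(2) by (rule koszul_d_koszul_map[OF ring_hom_fun_lin_subst]) (rule \<gamma>chain)
    also have "\<dots> = koszul_map B (\<lambda>b b'. \<Sum>w\<in>?U. ?h' (\<alpha> b w) * \<gamma> w b') (\<lambda>a. ?h' (?h a)) l z"
      unfolding z1_def by (rule koszul_map_comp[OF ring_hom_fun_lin_subst])
    also have "\<dots> = z l"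
    proof (rule koszul_map_id[OF B(1) z(1)])
      show "?h' (?h (z l)) = z l" for l using h'h V.inv_polys z(2) by blast
      show "?h' (?h 0) = 0" by (simp add: lin_subst_simps)
      fix b b' assume b: "b \<in> B"
      have h's: "?h' (single 0 c) = single 0 c" for c
        using lin_subst_simps(4)[of \<pi> X c 1] by (simp add: lin_subst_simps cscale_conv_mult)
      show "(\<Sum>w\<in>?U. ?h' (\<alpha> b w) * \<gamma> w b') = (if b = b' then 1 else 0)"
      proof (cases "b' \<in> B")
        case True
        have "(\<Sum>w\<in>?U. ?h' (\<alpha> b w) * \<gamma> w b') = (\<Sum>w\<in>?U. \<sigma> (?h' (cscale (word_coeff (?h b) w) (W.word_invariant w))) b')"
          using True by (intro sum.cong refl)
            (simp add: \<gamma>_def \<alpha>_def h's lin_subst_simps \<sigma>(2) flip: cscale_conv_mult)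
        also have "\<dots> = \<sigma> (?h' (\<Sum>w\<in>?U. cscale (word_coeff (?h b) w) (W.word_invariant w))) b'"
          by (simp add: lin_subst_simps(3) \<sigma>sum)
        also have "\<dots> = \<sigma> b b'" using hfw[OF b] h'h[OF BX[OF b]] by simp
        finally show ?thesis using \<sigma>(3)[OF b] by simp
      next
        case False
        then show ?thesis using b by (auto simp: \<gamma>_def)
      qed
    qed
    finally show ?thesis by simp
  qed
  \<comment> \<open>All variables outside \<open>X\<close> are set to zero, because the coefficients
    chosen by \<sigma> need not be confined to \<open>X\<close>.\<close>
  define \<kappa> where "\<kappa> = lin_subst (\<lambda>i j :: 'x. if i = j then 1 else 0) X"
  have \<kappa>id: "\<kappa> f = f" if "f \<in> polys X" for f
    unfolding \<kappa>_def by (rule lin_subst_id[OF that V.fin_X]) simp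
  define u where "u l = V.reynolds (\<kappa> (u0 l))" for l
  have "koszul B (Suc p) u"
    unfolding u_def
  proof (rule koszul_compose[OF u0])
    have "V.reynolds (- f) = - V.reynolds f" for f using V.reynolds_cscale[of "-1" f] by (simp add: cscale_uminus)
    then show "V.reynolds (\<kappa> (- a)) = - V.reynolds (\<kappa> a)" for a by (simp add: \<kappa>_def lin_subst_simps)
  qed (simp add: \<kappa>_def lin_subst_simps)
  moreover have "u l \<in> V.invs" for l by (simp add: u_def V.reynolds_inv \<kappa>_def polys_lin_subst)
  moreover have "z l = koszul_d B (\<lambda>b. b) u l" for l
  proof -
    \<comment> \<open>The members of \<open>B\<close> are invariant, so averaging commutes with
      multiplication by them and hence with the Koszul differential.\<close>
    have "z l = V.reynolds (\<kappa> (z l))" using \<kappa>id z(2) V.inv_polys V.reynolds_id by metis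
    also have "\<dots> = (\<Sum>b\<in>B. V.reynolds (\<kappa> b * \<kappa> (u0 (b # l))))"
      unfolding zu0 koszul_d_def \<kappa>_def lin_subst_simps V.reynolds_sum ..
    also have "\<dots> = koszul_d B (\<lambda>b. b) u l"
      unfolding koszul_d_def u_def
    proof (intro sum.cong refl)
      fix b assume b: "b \<in> B"
      then have "b \<in> V.invs" using B(3) by blast
      then show "V.reynolds (\<kappa> b * \<kappa> (u0 (b # l))) = b * V.reynolds (\<kappa> (u0 (b # l)))"
        using \<kappa>id[OF BX[OF b]] V.reynolds_mult by simp
    qed
    finally show ?thesis .
  qed
  ultimately show ?thesis by blast
qed

section \<open>Hermitian geometry of spaces of functions on a finite set\<close>

global_interpretation fv: vector_space "\<lambda>(c::complex) (f :: 'k \<Rightarrow> complex) x. c * f x"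
  by unfold_locales (auto simp: fun_eq_iff algebra_simps)

text \<open>A model of C^K inside the space of all functions; subspaces and orthonormal systems can
  then be formed without a separate type for each \<open>K\<close>.\<close>

definition supported_on :: "'k set \<Rightarrow> ('k \<Rightarrow> complex) set" where
  "supported_on K = {f. \<forall>x. x \<notin> K \<longrightarrow> f x = 0}"

definition inner_on :: "'k set \<Rightarrow> ('k \<Rightarrow> complex) \<Rightarrow> ('k \<Rightarrow> complex) \<Rightarrow> complex" where
  "inner_on K f h = (\<Sum>x\<in>K. f x * cnj (h x))"

lemma subspace_supported_on: "fv.subspace (supported_on K)"
  by (rule fv.subspaceI) (auto simp: supported_on_def)

lemma inner_on_add: "inner_on K (f + f') h = inner_on K f h + inner_on K f' h"
  and inner_on_diff: "inner_on K (f - f') h = inner_on K f h - inner_on K f' h"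
  and inner_on_scale: "inner_on K (\<lambda>x. c * f x) h = c * inner_on K f h"
  and inner_on_0 [simp]: "inner_on K 0 h = 0"
  by (simp_all add: inner_on_def algebra_simps sum.distrib sum_subtractf sum_distrib_left)

lemma inner_on_cnj: "cnj (inner_on K f h) = inner_on K h f"
  by (simp add: inner_on_def mult.commute)

lemma inner_on_sum: "inner_on K (\<lambda>x. \<Sum>i\<in>I. c i * f i x) h = (\<Sum>i\<in>I. c i * inner_on K (f i) h)"
  by (simp add: inner_on_def sum_distrib_left sum_distrib_right mult.assoc) (rule sum.swap)

lemma fun_sum_apply: "(\<Sum>i\<in>I. (f i :: 'k \<Rightarrow> complex)) x = (\<Sum>i\<in>I. f i x)"
  by (induction I rule: infinite_finite_induct) simp_all

lemma inner_on_self_eq_0: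
  assumes "finite K" "f \<in> supported_on K" "inner_on K f f = 0"
  shows "f = 0"
proof
  fix x
  have "inner_on K f f = of_real (\<Sum>x\<in>K. (cmod (f x))\<^sup>2)"
    by (simp only: inner_on_def of_real_sum complex_norm_square)
  then have "(\<Sum>x\<in>K. (cmod (f x))\<^sup>2) = 0" using assms(3) by (metis of_real_eq_0_iff)
  then have "\<forall>x\<in>K. (cmod (f x))\<^sup>2 = 0" using assms(1) by (subst (asm) sum_nonneg_eq_0_iff) auto
  then show "f x = 0 x" using assms(2) by (cases "x \<in> K") (auto simp: supported_on_def)
qed

lemma inner_on_self_real: "inner_on K f f = of_real (\<Sum>x\<in>K. (cmod (f x))\<^sup>2)"
  by (simp only: inner_on_def of_real_sum complex_norm_square)

section \<open>Orthonormal systems\<close>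

definition orthonormal :: "'k set \<Rightarrow> (nat \<Rightarrow> 'k \<Rightarrow> complex) \<Rightarrow> nat \<Rightarrow> bool" where
  "orthonormal K v N \<longleftrightarrow> (\<forall>i<N. v i \<in> supported_on K) \<and> (\<forall>i<N. \<forall>j<N. inner_on K (v i) (v j) = (if i = j then 1 else 0))"

definition onb :: "'k set \<Rightarrow> (nat \<Rightarrow> 'k \<Rightarrow> complex) \<Rightarrow> nat \<Rightarrow> ('k \<Rightarrow> complex) set \<Rightarrow> bool" where
  "onb K v N D \<longleftrightarrow> orthonormal K v N \<and> fv.span (v ` {..<N}) = D"

lemma in_span_sum: "(\<lambda>x. \<Sum>i<N. c i * v i x) \<in> fv.span (v ` {..<N})"
proof -
  have "(\<Sum>i<N. (\<lambda>x. c i * v i x)) \<in> fv.span (v ` {..<N})"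
    by (intro fv.span_sum fv.span_scale fv.span_base) auto
  moreover have "(\<Sum>i<N. (\<lambda>x. c i * v i x)) = (\<lambda>x. \<Sum>i<N. c i * v i x)"
    by (rule ext) (simp add: fun_sum_apply)
  ultimately show ?thesis by simp
qed

lemma onb_expand:
  assumes "orthonormal K v N" "f \<in> fv.span (v ` {..<N})"
  shows "f = (\<lambda>x. \<Sum>i<N. inner_on K f (v i) * v i x)"
  using assms(2)
proof (induction rule: fv.span_induct)
  case base
  show ?case
  proof (rule fv.subspaceI)
    fix c f assume f: "f \<in> {f. f = (\<lambda>x. \<Sum>i<N. inner_on K f (v i) * v i x)}"
    have "c * f x = (\<Sum>i<N. inner_on K (\<lambda>x. c * f x) (v i) * v i x)" for x
    proof -
      have "f x = (\<Sum>i<N. inner_on K f (v i) * v i x)" using f fun_cong by fastforce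
      then have "c * f x = c * (\<Sum>i<N. inner_on K f (v i) * v i x)" by (rule arg_cong)
      then show ?thesis by (simp only: inner_on_scale sum_distrib_left mult.assoc)
    qed
    then show "(\<lambda>x. c * f x) \<in> {f. f = (\<lambda>x. \<Sum>i<N. inner_on K f (v i) * v i x)}" by blast
  qed (auto simp: fun_eq_iff inner_on_add algebra_simps sum.distrib)
next
  case (step f)
  then obtain j where j: "j < N" "f = v j" by auto
  show ?case
  proof
    fix x
    have "(\<Sum>i<N. inner_on K f (v i) * v i x) = (\<Sum>i<N. if i = j then v i x else 0)"
      using assms(1) j by (intro sum.cong) (auto simp: orthonormal_def)
    then show "f x = (\<Sum>i<N. inner_on K f (v i) * v i x)" using j by simp
  qed
qed

lemma onbD:
  assumes "onb K v N D"
  shows "orthonormal K v N" "i < N \<Longrightarrow> v i \<in> D" "f \<in> D \<Longrightarrow> f = (\<lambda>x. \<Sum>i<N. inner_on K f (v i) * v i x)"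
    "(\<lambda>x. \<Sum>i<N. c i * v i x) \<in> D" "fv.subspace D" "D \<subseteq> supported_on K"
    "i < N \<Longrightarrow> j < N \<Longrightarrow> inner_on K (v i) (v j) = (if i = j then 1 else 0)"
proof -
  show on: "orthonormal K v N" using assms by (simp add: onb_def)
  have D: "D = fv.span (v ` {..<N})" using assms by (simp add: onb_def)
  show "i < N \<Longrightarrow> v i \<in> D" unfolding D by (auto intro: fv.span_base)
  show "f \<in> D \<Longrightarrow> f = (\<lambda>x. \<Sum>i<N. inner_on K f (v i) * v i x)" unfolding D by (rule onb_expand[OF on])
  show "(\<lambda>x. \<Sum>i<N. c i * v i x) \<in> D" unfolding D by (rule in_span_sum)
  show "fv.subspace D" unfolding D by (rule fv.subspace_span)
  show "D \<subseteq> supported_on K" unfolding D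
    by (rule fv.span_minimal[OF _ subspace_supported_on]) (use on in \<open>auto simp: orthonormal_def\<close>)
  show "i < N \<Longrightarrow> j < N \<Longrightarrow> inner_on K (v i) (v j) = (if i = j then 1 else 0)"
    using on by (simp add: orthonormal_def)
qed

definition residue :: "'k set \<Rightarrow> (nat \<Rightarrow> 'k \<Rightarrow> complex) \<Rightarrow> nat \<Rightarrow> ('k \<Rightarrow> complex) \<Rightarrow> 'k \<Rightarrow> complex" where
  "residue K v N f = f - (\<lambda>x. \<Sum>i<N. inner_on K f (v i) * v i x)"

lemma residue_orth:
  assumes "orthonormal K v N" "h \<in> fv.span (v ` {..<N})"
  shows "inner_on K (residue K v N f) h = 0"
  using assms(2)
proof (induction rule: fv.span_induct)
  case base
  have "inner_on K g (a + b) = inner_on K g a + inner_on K g b" "inner_on K g (\<lambda>x. c * a x) = cnj c * inner_on K g a" "inner_on K g 0 = 0"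
    for g a b c by (simp_all add: inner_on_def algebra_simps sum.distrib sum_distrib_left)
  then show ?case by (intro fv.subspaceI) auto
next
  case (step h)
  then obtain j where j: "j < N" "h = v j" by auto
  have "(\<Sum>i<N. inner_on K f (v i) * inner_on K (v i) (v j)) = (\<Sum>i<N. if i = j then inner_on K f (v i) else 0)"
    using assms(1) j by (intro sum.cong) (auto simp: orthonormal_def)
  then show ?case using j unfolding residue_def inner_on_diff inner_on_sum by simp
qed

lemma orthonormal_extend:
  assumes K: "finite K" and on: "orthonormal K v N" and w: "w \<in> supported_on K" "w \<noteq> 0"
    and orth: "\<And>i. i < N \<Longrightarrow> inner_on K w (v i) = 0"
  shows "\<exists>c. c \<noteq> 0 \<and> orthonormal K (v(N := \<lambda>x. c * w x)) (Suc N)"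
proof -
  define q where "q = sqrt (\<Sum>x\<in>K. (cmod (w x))\<^sup>2)"
  have q2: "inner_on K w w = of_real (q\<^sup>2)"
    by (simp add: q_def inner_on_self_real sum_nonneg)
  have q0: "q \<noteq> 0" using inner_on_self_eq_0[OF K w(1)] w(2) q2 by auto
  have "orthonormal K (v(N := \<lambda>x. of_real (1 / q) * w x)) (Suc N)"
  proof -
    have wv: "inner_on K (\<lambda>x. of_real (1 / q) * w x) (v i) = 0" "inner_on K (v i) (\<lambda>x. of_real (1 / q) * w x) = 0" if "i < N" for i
    proof -
      show 1: "inner_on K (\<lambda>x. of_real (1 / q) * w x) (v i) = 0" by (simp only: inner_on_scale orth[OF that] mult_zero_right)
      show "inner_on K (v i) (\<lambda>x. of_real (1 / q) * w x) = 0" by (subst inner_on_cnj[symmetric]) (simp only: 1 complex_cnj_zero)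
    qed
    have ww: "inner_on K (\<lambda>x. of_real (1 / q) * w x) (\<lambda>x. of_real (1 / q) * w x) = 1"
    proof -
      have "inner_on K (\<lambda>x. of_real (1 / q) * w x) (\<lambda>x. of_real (1 / q) * w x) = of_real (1 / q) * of_real (1 / q) * inner_on K w w"
        by (simp add: inner_on_def sum_distrib_left mult_ac)
      then show ?thesis using q0 by (simp add: q2 power2_eq_square)
    qed
    have "(\<lambda>x. of_real (1 / q) * w x) \<in> supported_on K" using w(1) by (simp add: supported_on_def)
    then show ?thesis
      using on wv ww unfolding orthonormal_def less_Suc_eq by (auto simp: fun_upd_def)
  qed
  then show ?thesis using q0 by (intro exI[of _ "of_real (1 / q)"]) auto
qed

text \<open>The bound on \<open>N\<close> is carried along because it later limits the dimension of
  a span by the number of spanning vectors. A vector that already lies in the span is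
  skipped.\<close>

lemma gram_schmidt:
  assumes K: "finite K" and S: "finite S" "S \<subseteq> supported_on K"
  shows "\<exists>v N. onb K v N (fv.span S) \<and> N \<le> card S"
  using S
proof (induction S)
  case empty
  show ?case by (intro exI[of _ undefined] exI[of _ 0]) (simp add: onb_def orthonormal_def)
next
  case (insert a S)
  then obtain v N where v: "onb K v N (fv.span S)" "N \<le> card S" by auto
  note vD = onbD[OF v(1)]
  define w where "w = residue K v N a"
  have proj: "(\<lambda>x. \<Sum>i<N. inner_on K a (v i) * v i x) \<in> fv.span S" by (rule vD(4))
  have wF: "w \<in> supported_on K"
    unfolding w_def residue_def using insert.prems proj vD(6)
    by (intro fv.subspace_diff[OF subspace_supported_on]) auto
  show ?case
  proof (cases "w = 0")
    case True
    then have "a \<in> fv.span S" using proj by (simp add: w_def residue_def)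
    then have "fv.span (insert a S) = fv.span S" by (rule fv.span_redundant)
    then show ?thesis using v insert.hyps by (intro exI[of _ v] exI[of _ N]) simp
  next
    case False
    have "inner_on K w (v i) = 0" if "i < N" for i
      unfolding w_def by (rule residue_orth[OF vD(1)]) (use that in \<open>auto intro: fv.span_base\<close>)
    then obtain c where c: "c \<noteq> 0" "orthonormal K (v(N := \<lambda>x. c * w x)) (Suc N)"
      using orthonormal_extend[OF K vD(1) wF False] by blast
    let ?v = "v(N := \<lambda>x. c * w x)"
    have img: "?v ` {..<Suc N} = insert (\<lambda>x. c * w x) (v ` {..<N})"
      by (auto simp: lessThan_Suc)
    have spS: "fv.span (v ` {..<N}) = fv.span S" using v(1) by (simp add: onb_def)
    have "fv.span (?v ` {..<Suc N}) = fv.span (insert a S)"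
    proof
      have 1: "fv.span S \<subseteq> fv.span (insert a S)" by (intro fv.span_mono) auto
      then have "w \<in> fv.span (insert a S)"
        unfolding w_def residue_def using proj by (intro fv.span_diff) (auto intro: fv.span_base)
      then have "?v ` {..<Suc N} \<subseteq> fv.span (insert a S)"
        unfolding img using 1 vD(2) by (auto intro: fv.span_scale)
      then show "fv.span (?v ` {..<Suc N}) \<subseteq> fv.span (insert a S)" by (rule fv.span_minimal) simp
      have 2: "fv.span S \<subseteq> fv.span (?v ` {..<Suc N})"
        unfolding img spS[symmetric] by (intro fv.span_mono) auto
      have "(\<lambda>x. (1 / c) * (c * w x)) \<in> fv.span (?v ` {..<Suc N})"
        unfolding img by (intro fv.span_scale fv.span_base) auto
      then have "w \<in> fv.span (?v ` {..<Suc N})" using c(1) by (simp add: mult.assoc[symmetric])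
      moreover have "a = w + (\<lambda>x. \<Sum>i<N. inner_on K a (v i) * v i x)" by (simp add: w_def residue_def)
      ultimately have "a \<in> fv.span (?v ` {..<Suc N})"
        using fv.span_add[of w _ "\<lambda>x. \<Sum>i<N. inner_on K a (v i) * v i x"] proj 2 by (simp only: subset_iff)
      then have "insert a S \<subseteq> fv.span (?v ` {..<Suc N})" using 2 fv.span_superset by blast
      then show "fv.span (insert a S) \<subseteq> fv.span (?v ` {..<Suc N})" by (rule fv.span_minimal) simp
    qed
    then have "onb K ?v (Suc N) (fv.span (insert a S))" using c(2) unfolding onb_def by blast
    moreover have "Suc N \<le> card (insert a S)" using v(2) insert.hyps by simp
    ultimately show ?thesis by blast
  qed
qed

definition delta :: "'k \<Rightarrow> 'k \<Rightarrow> complex" where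
  "delta x = (\<lambda>y. if y = x then 1 else 0)"

lemma supported_on_span: "finite K \<Longrightarrow> supported_on K \<subseteq> fv.span (delta ` K)"
proof
  fix f assume K: "finite K" and f: "f \<in> supported_on K"
  have "(\<Sum>x\<in>K. (\<lambda>y. f x * delta x y)) \<in> fv.span (delta ` K)"
    by (intro fv.span_sum fv.span_scale fv.span_base) auto
  moreover have "(\<Sum>x\<in>K. (\<lambda>y. f x * delta x y)) = f"
    using K f by (auto simp: fun_eq_iff fun_sum_apply delta_def supported_on_def if_distrib cong: if_cong)
  ultimately show "f \<in> fv.span (delta ` K)" by simp
qed

lemma delta_supported_on: "x \<in> K \<Longrightarrow> delta x \<in> supported_on K"
  by (auto simp: delta_def supported_on_def)

lemma ex_onb:
  assumes K: "finite K" and D: "fv.subspace D" "D \<subseteq> supported_on K"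
  shows "\<exists>v N. onb K v N D"
proof -
  obtain B where B: "B \<subseteq> D" "fv.independent B" "D \<subseteq> fv.span B"
    using fv.maximal_independent_subset[of D] by blast
  have "B \<subseteq> fv.span (delta ` K)" using B(1) D(2) supported_on_span[OF K] by blast
  then have "finite B" using fv.independent_span_bound[OF _ B(2)] K by blast
  moreover have "fv.span B = D" using B D(1) fv.span_minimal[of B D] by blast
  ultimately show ?thesis using gram_schmidt[OF K, of B] B(1) D(2) by auto
qed

text \<open>Orthonormal systems are independent; comparing their lengths serves as monotonicity of
  the dimension.\<close>

lemma orthonormal_card_le:
  assumes "onb K v N D" "orthonormal K w M" "\<And>i. i < M \<Longrightarrow> w i \<in> D"
  shows "M \<le> N"
proof -
  have inj: "inj_on w {..<M}"
  proof (rule inj_onI)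
    fix i j assume ij: "i \<in> {..<M}" "j \<in> {..<M}" "w i = w j"
    then have "inner_on K (w i) (w i) = inner_on K (w i) (w j)" by simp
    then show "i = j" using assms(2) ij(1,2) by (auto simp: orthonormal_def split: if_splits)
  qed
  have "fv.independent (w ` {..<M})"
  proof (rule fv.independent_if_scalars_zero)
    fix c a assume c: "(\<Sum>a\<in>w ` {..<M}. (\<lambda>x. c a * a x)) = 0" and a: "a \<in> w ` {..<M}"
    obtain j where j: "j < M" "a = w j" using a by auto
    have "(\<lambda>x. \<Sum>i<M. c (w i) * w i x) = 0"
      using c by (simp add: sum.reindex[OF inj] fun_eq_iff fun_sum_apply)
    then have "0 = inner_on K (\<lambda>x. \<Sum>i<M. c (w i) * w i x) (w j)" by simp
    also have "\<dots> = (\<Sum>i<M. if i = j then c (w i) else 0)"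
      unfolding inner_on_sum using assms(2) j(1) by (intro sum.cong) (auto simp: orthonormal_def)
    finally show "c a = 0" using j by simp
  qed simp
  moreover have "w ` {..<M} \<subseteq> fv.span (v ` {..<N})" using assms(1,3) by (auto simp: onb_def)
  ultimately have "card (w ` {..<M}) \<le> card (v ` {..<N})"
    using fv.independent_span_bound[of "v ` {..<N}" "w ` {..<M}"] by simp
  also have "\<dots> \<le> N" using card_image_le[of "{..<N}" v] by simp
  finally show ?thesis by (simp add: card_image[OF inj])
qed

lemma orth_decomp:
  assumes K: "finite K" and D: "fv.subspace D" "D \<subseteq> supported_on K"
  shows "\<exists>b\<in>D. \<forall>h\<in>D. inner_on K (f - b) h = 0"
proof -
  obtain v N where v: "onb K v N D" using ex_onb[OF assms] by blast
  show ?thesis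
    using onbD(4)[OF v] residue_orth[OF onbD(1)[OF v]] v
    by (intro bexI[of _ "\<lambda>x. \<Sum>i<N. inner_on K f (v i) * v i x"]) (auto simp: onb_def residue_def)
qed

section \<open>Unitary representations\<close>

text \<open>Unitarity makes orthogonal complements of stable subspaces stable. Real entries allow
  complex conjugation to pass from matrices to vectors in \<open>dual_rep_restrict\<close> and
  \<open>dual_rep_extend\<close>. Permutation matrices have both properties.\<close>

locale urep = mrep G X r for G :: "('g, 'b) monoid_scheme" (structure) and X :: "'x set" and r +
  assumes r_inv: "g \<in> carrier G \<Longrightarrow> i \<in> X \<Longrightarrow> j \<in> X \<Longrightarrow> r (inv g) i j = cnj (r g j i)"
    and r_real: "g \<in> carrier G \<Longrightarrow> i \<in> X \<Longrightarrow> j \<in> X \<Longrightarrow> cnj (r g i j) = r g i j"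
begin

definition A :: "'g \<Rightarrow> ('x \<Rightarrow> complex) \<Rightarrow> 'x \<Rightarrow> complex" where
  "A g f = (\<lambda>i. if i \<in> X then \<Sum>j\<in>X. r g i j * f j else 0)"

definition stable :: "('x \<Rightarrow> complex) set \<Rightarrow> bool" where
  "stable D \<longleftrightarrow> fv.subspace D \<and> D \<subseteq> supported_on X \<and> (\<forall>g\<in>carrier G. \<forall>f\<in>D. A g f \<in> D)"

lemma A_FS: "A g f \<in> supported_on X"
  by (simp add: A_def supported_on_def)

lemma A_one: "f \<in> supported_on X \<Longrightarrow> A \<one> f = f"
proof
  fix i assume f: "f \<in> supported_on X"
  have "(\<Sum>j\<in>X. r \<one> i j * f j) = (\<Sum>j\<in>X. if j = i then f j else 0)" if "i \<in> X"
    using that by (intro sum.cong) (auto simp: r_one)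
  then show "A \<one> f i = f i" using f fin_X by (auto simp: A_def supported_on_def)
qed

lemma A_mult:
  assumes "g \<in> carrier G" "h \<in> carrier G"
  shows "A (g \<otimes> h) f = A g (A h f)"
proof
  fix i
  show "A (g \<otimes> h) f i = A g (A h f) i"
  proof (cases "i \<in> X")
    case True
    have "(\<Sum>j\<in>X. r (g \<otimes> h) i j * f j) = (\<Sum>j\<in>X. \<Sum>k\<in>X. r g i k * (r h k j * f j))"
      using True assms by (intro sum.cong) (auto simp: r_mult sum_distrib_right mult.assoc)
    also have "\<dots> = (\<Sum>k\<in>X. r g i k * (\<Sum>j\<in>X. r h k j * f j))"
      by (subst sum.swap) (simp add: sum_distrib_left)
    finally show ?thesis using True by (simp add: A_def)
  qed (simp add: A_def)
qed

lemma A_sum: "A g (\<lambda>x. \<Sum>i\<in>I. c i * f i x) = (\<lambda>x. \<Sum>i\<in>I. c i * A g (f i) x)"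
proof
  fix x
  have "(\<Sum>j\<in>X. r g x j * (\<Sum>i\<in>I. c i * f i j)) = (\<Sum>i\<in>I. c i * (\<Sum>j\<in>X. r g x j * f i j))"
    unfolding sum_distrib_left by (subst sum.swap) (simp add: mult_ac)
  then show "A g (\<lambda>x. \<Sum>i\<in>I. c i * f i x) x = (\<Sum>i\<in>I. c i * A g (f i) x)" by (simp add: A_def)
qed

lemma A_add: "A g (f + h) = A g f + A g h"
  and A_scale: "A g (\<lambda>x. c * f x) = (\<lambda>x. c * A g f x)"
  and A_0: "A g 0 = 0"
  by (auto simp: A_def fun_eq_iff algebra_simps sum.distrib sum_distrib_left)

lemma inner_on_A:
  assumes "g \<in> carrier G"
  shows "inner_on X (A (inv g) f) h = inner_on X f (A g h)"
proof -
  have "inner_on X (A (inv g) f) h = (\<Sum>i\<in>X. \<Sum>j\<in>X. f j * (cnj (r g j i) * cnj (h i)))"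
    unfolding inner_on_def A_def using assms
    by (intro sum.cong) (auto simp: r_inv sum_distrib_right sum_distrib_left mult_ac)
  also have "\<dots> = (\<Sum>j\<in>X. \<Sum>i\<in>X. f j * (cnj (r g j i) * cnj (h i)))" by (rule sum.swap)
  also have "\<dots> = inner_on X f (A g h)"
    unfolding inner_on_def A_def by (intro sum.cong) (auto simp: sum_distrib_left)
  finally show ?thesis .
qed

lemma stableD:
  assumes "stable D"
  shows "fv.subspace D" "D \<subseteq> supported_on X" "g \<in> carrier G \<Longrightarrow> f \<in> D \<Longrightarrow> A g f \<in> D"
  using assms by (auto simp: stable_def)

text \<open>The representation on the dual of a stable subspace, in an orthonormal basis.\<close>

definition dual_rep :: "(nat \<Rightarrow> 'x \<Rightarrow> complex) \<Rightarrow> 'g \<Rightarrow> nat \<Rightarrow> nat \<Rightarrow> complex" where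
  "dual_rep v g k l = inner_on X (A (inv g) (v k)) (v l)"

text \<open>Vectors of a stable subspace transform by \<open>sub_rep\<close>, in terms of which
  irreducibility is expressed. The coordinate functions on it, which are the variables of the
  smaller polynomial ring, transform by \<open>dual_rep\<close>.\<close>

definition sub_rep :: "(nat \<Rightarrow> 'x \<Rightarrow> complex) \<Rightarrow> 'g \<Rightarrow> nat \<Rightarrow> nat \<Rightarrow> complex" where
  "sub_rep v g k l = inner_on X (A g (v l)) (v k)"

lemma A_onb:
  assumes "onb X v N D" "stable D" "g \<in> carrier G" "k < N"
  shows "A g (v k) = (\<lambda>x. \<Sum>l<N. inner_on X (A g (v k)) (v l) * v l x)"
  by (rule onbD(3)[OF assms(1) stableD(3)[OF assms(2,3) onbD(2)[OF assms(1,4)]]])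

lemma mrep_dual_rep:
  assumes v: "onb X v N D" and D: "stable D"
  shows "mrep G {..<N} (dual_rep v)"
proof unfold_locales
  note vD = onbD[OF v]
  have vF: "v k \<in> supported_on X" if "k < N" for k using vD(2,6) that by blast
  fix k l assume k: "k \<in> {..<N}" and l: "l \<in> {..<N}"
  show "dual_rep v \<one> k l = (if k = l then 1 else 0)"
    using k l vF vD(7) by (simp add: dual_rep_def A_one)
  fix g h assume g: "g \<in> carrier G" and h: "h \<in> carrier G"
  have "dual_rep v (g \<otimes> h) k l = inner_on X (A (inv h) (A (inv g) (v k))) (v l)"
    using g h by (simp add: dual_rep_def inv_mult_group A_mult)
  also have "A (inv g) (v k) = (\<lambda>x. \<Sum>m<N. dual_rep v g k m * v m x)"
    unfolding dual_rep_def by (rule A_onb[OF v D]) (use g k in auto)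
  finally show "dual_rep v (g \<otimes> h) k l = (\<Sum>m<N. dual_rep v g k m * dual_rep v h m l)"
    by (simp add: A_sum inner_on_sum dual_rep_def[of v h])
qed (simp_all add: fin_G)

text \<open>Restricting the coordinate functions from C^X to the stable subspace is equivariant; its
  matrix has the vectors \<open>v k\<close> as rows.\<close>

lemma dual_rep_restrict:
  assumes v: "onb X v N D" and D: "stable D" and g: "g \<in> carrier G" and k: "k < N" and j: "j \<in> X"
  shows "(\<Sum>i\<in>X. v k i * r g i j) = (\<Sum>l<N. dual_rep v g k l * v l j)"
proof -
  have "(\<Sum>i\<in>X. v k i * r g i j) = A (inv g) (v k) j"
    unfolding A_def using g j by (auto intro!: sum.cong simp: r_inv r_real mult.commute)
  also have "\<dots> = (\<Sum>l<N. inner_on X (A (inv g) (v k)) (v l) * v l j)"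
    using A_onb[OF v D _ k, of "inv g"] g by (simp add: fun_eq_iff)
  finally show ?thesis by (simp add: dual_rep_def)
qed

text \<open>The adjoint of the restriction is equivariant as well. Following the restriction by it
  gives the orthogonal projection that is used in \<open>koszul_vanishing_large\<close>.\<close>

lemma dual_rep_extend:
  assumes v: "onb X v N D" and D: "stable D" and g: "g \<in> carrier G" and l: "l < N" and i: "i \<in> X"
  shows "(\<Sum>j\<in>X. r g i j * cnj (v l j)) = (\<Sum>m<N. cnj (v m i) * dual_rep v g m l)"
proof -
  have "(\<Sum>j\<in>X. r g i j * cnj (v l j)) = cnj (A g (v l) i)"
    unfolding A_def using g i by (auto intro!: sum.cong simp: r_real)
  also have "A g (v l) i = (\<Sum>m<N. inner_on X (A g (v l)) (v m) * v m i)"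
    using A_onb[OF v D g l] by (simp add: fun_eq_iff)
  also have "cnj \<dots> = (\<Sum>m<N. cnj (v m i) * dual_rep v g m l)"
    by (simp add: dual_rep_def inner_on_A[OF g] inner_on_cnj mult.commute)
  finally show ?thesis .
qed

lemma stable_span:
  assumes "S \<subseteq> supported_on X" "\<And>g f. g \<in> carrier G \<Longrightarrow> f \<in> S \<Longrightarrow> A g f \<in> fv.span S"
  shows "stable (fv.span S)"
  unfolding stable_def
proof (intro conjI ballI)
  show "fv.span S \<subseteq> supported_on X" by (rule fv.span_minimal[OF assms(1) subspace_supported_on])
  fix g f assume g: "g \<in> carrier G" and "f \<in> fv.span S"
  from this(2) show "A g f \<in> fv.span S"
  proof (induction rule: fv.span_induct)
    case base
    show ?case
      by (rule fv.subspaceI) (auto simp: A_add A_scale A_0 fv.span_add fv.span_scale fv.span_zero)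
  qed (use assms(2) g in auto)
qed simp

lemma stable_orth:
  assumes "stable D"
  shows "stable {f \<in> supported_on X. \<forall>h\<in>D. inner_on X f h = 0}"
  unfolding stable_def
proof (intro conjI ballI)
  show "fv.subspace {f \<in> supported_on X. \<forall>h\<in>D. inner_on X f h = 0}"
    using subspace_supported_on by (intro fv.subspaceI) (auto simp: inner_on_add inner_on_scale fv.subspace_def)
  fix g f assume g: "g \<in> carrier G" and f: "f \<in> {f \<in> supported_on X. \<forall>h\<in>D. inner_on X f h = 0}"
  have "inner_on X (A g f) h = 0" if "h \<in> D" for h
    using inner_on_A[of "inv g" f h] g f stableD(3)[OF assms, of "inv g" h] that by simp
  then show "A g f \<in> {f \<in> supported_on X. \<forall>h\<in>D. inner_on X f h = 0}" using A_FS by simp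
qed auto

definition irreducible_subspace :: "('x \<Rightarrow> complex) set \<Rightarrow> bool" where
  "irreducible_subspace D \<longleftrightarrow> stable D \<and> D \<noteq> {0} \<and> (\<forall>D'. stable D' \<and> D' \<subseteq> D \<longrightarrow> D' = {0} \<or> D' = D)"

text \<open>A nonzero stable subspace of least dimension will do: an orthonormal basis of a proper
  nonzero stable part extends within it by one more vector, so that part would have smaller
  dimension.\<close>

lemma ex_irreducible_subspace:
  assumes D: "stable D" "D \<noteq> {0}"
  shows "\<exists>M\<subseteq>D. irreducible_subspace M"
proof -
  define P where "P N \<longleftrightarrow> (\<exists>M v. M \<subseteq> D \<and> stable M \<and> M \<noteq> {0} \<and> onb X v N M)" for N
  have "\<exists>N. P N" using D ex_onb[OF fin_X stableD(1,2)[OF D(1)]] unfolding P_def by blast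
  then have "P (LEAST N. P N)" by (rule LeastI_ex)
  then obtain N M v where N: "N = (LEAST N. P N)" and M: "M \<subseteq> D" "stable M" "M \<noteq> {0}" "onb X v N M"
    unfolding P_def by blast
  have "D' = {0} \<or> D' = M" if D': "stable D'" "D' \<subseteq> M" for D'
  proof (rule ccontr)
    assume neg: "\<not> (D' = {0} \<or> D' = M)"
    obtain v' N' where v': "onb X v' N' D'" using ex_onb[OF fin_X stableD(1,2)[OF D'(1)]] by blast
    have "P N'" unfolding P_def using D' M(1) neg v' by blast
    then have le: "N \<le> N'" unfolding N by (rule Least_le)
    obtain f where f: "f \<in> M" "f \<notin> D'" using neg D'(2) by blast
    obtain b where b: "b \<in> D'" "\<And>h. h \<in> D' \<Longrightarrow> inner_on X (f - b) h = 0"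
      using orth_decomp[OF fin_X stableD(1,2)[OF D'(1)]] by blast
    have w: "f - b \<in> M" using f(1) b(1) D'(2) fv.subspace_diff[OF stableD(1)[OF M(2)]] by blast
    have w0: "f - b \<noteq> 0" using f(2) b(1) by auto
    obtain c where c: "orthonormal X (v'(N' := \<lambda>x. c * (f - b) x)) (Suc N')"
      using orthonormal_extend[OF fin_X onbD(1)[OF v'] _ w0] w stableD(2)[OF M(2)] b(2) onbD(2)[OF v'] by blast
    have "Suc N' \<le> N"
    proof (rule orthonormal_card_le[OF M(4) c])
      fix i assume "i < Suc N'"
      then show "(v'(N' := \<lambda>x. c * (f - b) x)) i \<in> M"
        using onbD(2)[OF v', of i] D'(2) fv.subspace_scale[OF stableD(1)[OF M(2)] w, of c] by auto
    qed
    then show False using le by simp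
  qed
  then show ?thesis using M unfolding irreducible_subspace_def by blast
qed

text \<open>Complete reducibility. If the orthogonal complement of the span, which is stable, were
  not zero, it would contain an irreducible subspace orthogonal to itself.\<close>

lemma span_irreducible_subspace: "supported_on X \<subseteq> fv.span (\<Union> {D. irreducible_subspace D})"
proof
  fix f assume f: "f \<in> supported_on X"
  let ?S = "fv.span (\<Union> {D. irreducible_subspace D})"
  have S: "stable ?S"
    by (rule stable_span) (auto simp: irreducible_subspace_def dest: stableD intro: fv.span_base)
  obtain b where b: "b \<in> ?S" "\<And>h. h \<in> ?S \<Longrightarrow> inner_on X (f - b) h = 0"
    using orth_decomp[OF fin_X stableD(1,2)[OF S]] by blast
  let ?O = "{f \<in> supported_on X. \<forall>h\<in>?S. inner_on X f h = 0}"
  have "f - b \<in> ?O" using f b stableD(2)[OF S] fv.subspace_diff[OF subspace_supported_on] by blast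
  moreover have "?O = {0}"
  proof (rule ccontr)
    assume "?O \<noteq> {0}"
    then obtain M where M: "M \<subseteq> ?O" "irreducible_subspace M" using ex_irreducible_subspace[OF stable_orth[OF S]] by blast
    have "M \<subseteq> \<Union> {D. irreducible_subspace D}" using M(2) by auto
    then have "M \<subseteq> ?S" using fv.span_superset by (rule order_trans)
    have "h = 0" if "h \<in> M" for h
    proof (rule inner_on_self_eq_0[OF fin_X])
      show "h \<in> supported_on X" "inner_on X h h = 0" using that \<open>M \<subseteq> ?S\<close> M(1) by auto
    qed
    then have "M \<subseteq> {0}" by auto
    moreover have "0 \<in> M" using M(2) fv.subspace_0[OF stableD(1)[of M]] by (simp add: irreducible_subspace_def)
    ultimately show False using M(2) by (auto simp: irreducible_subspace_def)
  qed
  ultimately show "f \<in> ?S" using b(1) by auto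
qed

end

text \<open>The basis of \<open>n\<close> copies of the regular representation, of which every
  representation of dimension \<open>n\<close> is a direct summand.\<close>

definition perm_space :: "('g, 'b) monoid_scheme \<Rightarrow> nat \<Rightarrow> ('g \<times> nat) set" where
  "perm_space G n = carrier G \<times> {..<n}"

definition perm_rep :: "('g, 'b) monoid_scheme \<Rightarrow> 'g \<Rightarrow> 'g \<times> nat \<Rightarrow> 'g \<times> nat \<Rightarrow> complex" where
  "perm_rep G g = (\<lambda>(h, i) (h', j). if h = g \<otimes>\<^bsub>G\<^esub> h' \<and> i = j then 1 else 0)"

lemma urep_perm:
  assumes "group G" "finite (carrier G)"
  shows "urep G (perm_space G n) (perm_rep G)"
proof -
  interpret group G by fact
  show ?thesis
  proof unfold_locales
    show "finite (carrier G)" "finite (perm_space G n)" using assms by (simp_all add: perm_space_def)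
    fix i j assume ij: "i \<in> perm_space G n" "j \<in> perm_space G n"
    show "perm_rep G \<one>\<^bsub>G\<^esub> i j = (if i = j then 1 else 0)"
      using ij by (auto simp: perm_rep_def perm_space_def split: if_splits)
    fix g assume g: "g \<in> carrier G"
    show "cnj (perm_rep G g i j) = perm_rep G g i j" by (simp add: perm_rep_def split: prod.splits)
    obtain a k b l where ab: "i = (a, k)" "j = (b, l)" by (cases i, cases j) auto
    have "a = inv\<^bsub>G\<^esub> g \<otimes>\<^bsub>G\<^esub> b \<longleftrightarrow> b = g \<otimes>\<^bsub>G\<^esub> a"
      using ij g ab by (auto simp: perm_space_def inv_solve_left)
    then show "perm_rep G (inv\<^bsub>G\<^esub> g) i j = cnj (perm_rep G g j i)"
      using ab by (auto simp: perm_rep_def)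
    fix h assume h: "h \<in> carrier G"
    have "(\<Sum>x\<in>perm_space G n. perm_rep G g i x * perm_rep G h x j) =
        (\<Sum>x\<in>perm_space G n. if x = (h \<otimes>\<^bsub>G\<^esub> b, l) then perm_rep G g i x else 0)"
      using ab by (intro sum.cong) (auto simp: perm_rep_def split: if_splits)
    also have "\<dots> = perm_rep G g i (h \<otimes>\<^bsub>G\<^esub> b, l)"
      using ab ij h assms(2) by (subst sum.delta) (auto simp: perm_space_def)
    also have "\<dots> = perm_rep G (g \<otimes>\<^bsub>G\<^esub> h) i j"
      using ab ij g h by (auto simp: perm_rep_def perm_space_def m_assoc)
    finally show "perm_rep G (g \<otimes>\<^bsub>G\<^esub> h) i j = (\<Sum>x\<in>perm_space G n. perm_rep G g i x * perm_rep G h x j)"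
      by simp
  qed
qed

section \<open>Irreducible representations\<close>

lemma GL_iff: "P \<in> carrier (GL n) \<longleftrightarrow> P \<in> carrier_mat n n \<and>
    (\<exists>Q\<in>carrier_mat n n. Q * P = 1\<^sub>m n \<and> P * Q = 1\<^sub>m n)"
  by (auto simp: GL_def units_of_def Units_def ring_mat_def)

lemma GL_mult: "P \<otimes>\<^bsub>GL n\<^esub> Q = P * Q"
  by (simp add: GL_def units_of_def ring_mat_def)

lemma mat_mult_sum:
  "mat n m (\<lambda>(i, j). a i j) * mat m l (\<lambda>(i, j). b i j) =
    (mat n l (\<lambda>(i, j). \<Sum>k<m. a i k * b k j) :: complex mat)"
  by (rule eq_matI) (auto simp: scalar_prod_def lessThan_atLeast0)

lemma index_mult_sum:
  assumes "P \<in> carrier_mat n m" "Q \<in> carrier_mat m l" "i < n" "j < l"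
  shows "(P * Q) $$ (i, j) = (\<Sum>k<m. P $$ (i, k) * Q $$ (k, j) :: complex)"
  using assms by (auto simp: scalar_prod_def lessThan_atLeast0)

lemma mrep_of_representation:
  assumes "group G" "finite (carrier G)" "representation G n \<rho>"
  shows "mrep G {..<n} (\<lambda>g i j. \<rho> g $$ (i, j))"
proof -
  interpret group G by fact
  have GL: "\<rho> g \<in> carrier (GL n)" if "g \<in> carrier G" for g
    using assms(3) that by (auto simp: representation_def hom_def)
  then have car: "\<rho> g \<in> carrier_mat n n" if "g \<in> carrier G" for g using that by (simp add: GL_iff)
  have mult: "\<rho> (g \<otimes>\<^bsub>G\<^esub> h) = \<rho> g * \<rho> h" if "g \<in> carrier G" "h \<in> carrier G" for g h
    using assms(3) that by (auto simp: representation_def hom_def GL_mult)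
  obtain Q where Q: "Q \<in> carrier_mat n n" "Q * \<rho> \<one>\<^bsub>G\<^esub> = 1\<^sub>m n" using GL[OF one_closed] by (auto simp: GL_iff)
  have c1: "\<rho> \<one>\<^bsub>G\<^esub> \<in> carrier_mat n n" by (rule car) simp
  \<comment> \<open>Membership in \<open>hom\<close> only speaks of products; the unit goes to the
    identity matrix because its image is idempotent and invertible.\<close>
  have "\<rho> \<one>\<^bsub>G\<^esub> * \<rho> \<one>\<^bsub>G\<^esub> = \<rho> \<one>\<^bsub>G\<^esub>" using mult[of "\<one>\<^bsub>G\<^esub>" "\<one>\<^bsub>G\<^esub>"] by simp
  then have "Q * (\<rho> \<one>\<^bsub>G\<^esub> * \<rho> \<one>\<^bsub>G\<^esub>) = 1\<^sub>m n" using Q by simp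
  then have "\<rho> \<one>\<^bsub>G\<^esub> = 1\<^sub>m n" using Q c1 assoc_mult_mat[OF Q(1) c1 c1] by simp
  then show ?thesis
    using assms(2) by unfold_locales (auto simp: mult index_mult_sum[OF car car])
qed

lemma invariants_eq: "mrep G {..<n} (\<lambda>g i j. \<rho> g $$ (i, j)) \<Longrightarrow>
    invariants G n \<rho> = mrep.invs G {..<n} (\<lambda>g i j. \<rho> g $$ (i, j))"
  by (simp add: invariants_def mrep.invs_def act_def lin_subst_def)

lemma representation_of_mrep:
  assumes "mrep G {..<n} \<tau>"
  shows "representation G n (\<lambda>g. mat n n (\<lambda>(i, j). \<tau> g i j))"
proof -
  interpret mrep G "{..<n}" \<tau> by fact
  let ?R = "\<lambda>g. mat n n (\<lambda>(i, j). \<tau> g i j)"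
  have mult: "?R g * ?R h = ?R (g \<otimes>\<^bsub>G\<^esub> h)" if "g \<in> carrier G" "h \<in> carrier G" for g h
    unfolding mat_mult_sum by (rule eq_matI) (use that in \<open>auto simp: r_mult\<close>)
  have one: "?R \<one>\<^bsub>G\<^esub> = 1\<^sub>m n" by (rule eq_matI) (auto simp: r_one)
  have "?R g \<in> carrier (GL n)" if g: "g \<in> carrier G" for g
    unfolding GL_iff using mult[of g "inv\<^bsub>G\<^esub> g"] mult[of "inv\<^bsub>G\<^esub> g" g] one g
    by (intro conjI bexI[of _ "?R (inv\<^bsub>G\<^esub> g)"]) auto
  then show ?thesis unfolding representation_def hom_def using mult by (auto simp: GL_mult)
qed

context urep
begin

lemma mrep_sub_rep:
  assumes v: "onb X v N D" and D: "stable D"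
  shows "mrep G {..<N} (sub_rep v)"
proof unfold_locales
  note vD = onbD[OF v]
  have vF: "v k \<in> supported_on X" if "k < N" for k using vD(2,6) that by blast
  fix k l assume k: "k \<in> {..<N}" and l: "l \<in> {..<N}"
  show "sub_rep v \<one> k l = (if k = l then 1 else 0)"
    using k l vF vD(7) by (simp add: sub_rep_def A_one)
  fix g h assume g: "g \<in> carrier G" and h: "h \<in> carrier G"
  have "sub_rep v (g \<otimes> h) k l = inner_on X (A g (A h (v l))) (v k)"
    using g h by (simp add: sub_rep_def A_mult)
  also have "A h (v l) = (\<lambda>x. \<Sum>m<N. sub_rep v h m l * v m x)"
    unfolding sub_rep_def by (rule A_onb[OF v D]) (use h l in auto)
  finally show "sub_rep v (g \<otimes> h) k l = (\<Sum>m<N. sub_rep v g k m * sub_rep v h m l)"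
    unfolding A_sum inner_on_sum sub_rep_def[of v g] by (simp add: mult.commute)
qed (simp_all add: fin_G)

text \<open>This leads from irreducible spaces of functions to the matrix representations whose
  degrees are summed in \<open>sum_irrep_degrees\<close>.\<close>

lemma irreducible_sub_rep:
  assumes v: "onb X v N D" and D: "irreducible_subspace D"
  shows "irreducible_rep G N (\<lambda>g. mat N N (\<lambda>(i, j). sub_rep v g i j))"
  unfolding irreducible_rep_def
proof (intro conjI allI impI)
  note vD = onbD[OF v]
  have st: "stable D" using D by (simp add: irreducible_subspace_def)
  let ?R = "\<lambda>g. mat N N (\<lambda>(i, j). sub_rep v g i j)"
  show "representation G N ?R" by (rule representation_of_mrep[OF mrep_sub_rep[OF v st]])
  show "0 < N"
  proof (rule ccontr)
    assume "\<not> 0 < N"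
    then have "D = fv.span {}" using v by (simp add: onb_def)
    then show False using D by (simp add: irreducible_subspace_def)
  qed
  fix W assume W: "vec_subspace N W \<and> (\<forall>g\<in>carrier G. \<forall>w\<in>W. ?R g *\<^sub>v w \<in> W)"
  \<comment> \<open>The isomorphism from coordinate vectors to the subspace. It intertwines the
    matrices with the action, so invariant sets of vectors correspond to stable subspaces.\<close>
  define F where "F w = (\<lambda>x. \<Sum>i<N. w $ i * v i x)" for w :: "complex vec"
  have ipF: "inner_on X (F w) (v j) = w $ j" if "j < N" for w j
  proof -
    have "inner_on X (F w) (v j) = (\<Sum>i<N. if i = j then w $ i else 0)"
      unfolding F_def inner_on_sum using vD(7) that by (intro sum.cong) auto
    then show ?thesis using that by simp
  qed
  have inj: "w = w'" if "w \<in> carrier_vec N" "w' \<in> carrier_vec N" "F w = F w'" for w w'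
    using that ipF by (intro eq_vecI) (auto, metis)
  have WC: "W \<subseteq> carrier_vec N" and W0: "0\<^sub>v N \<in> W"
    and Wadd: "\<And>u w. u \<in> W \<Longrightarrow> w \<in> W \<Longrightarrow> u + w \<in> W" and Wsc: "\<And>c w. w \<in> W \<Longrightarrow> c \<cdot>\<^sub>v w \<in> W"
    using W by (auto simp: vec_subspace_def)
  have FA: "A g (F w) = F (?R g *\<^sub>v w)" if g: "g \<in> carrier G" and w: "w \<in> carrier_vec N" for g w
  proof
    fix x
    have "A g (F w) x = (\<Sum>i<N. w $ i * (\<Sum>k<N. sub_rep v g k i * v k x))"
      unfolding F_def A_sum sub_rep_def using A_onb[OF v st g] by (intro sum.cong refl) (simp add: fun_eq_iff)
    also have "\<dots> = (\<Sum>k<N. (\<Sum>i<N. sub_rep v g k i * w $ i) * v k x)"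
      unfolding sum_distrib_left sum_distrib_right by (subst sum.swap) (simp add: mult_ac)
    also have "\<dots> = F (?R g *\<^sub>v w) x"
      unfolding F_def using w by (intro sum.cong refl) (auto simp: scalar_prod_def lessThan_atLeast0)
    finally show "A g (F w) x = F (?R g *\<^sub>v w) x" .
  qed
  have "stable (F ` W)"
    unfolding stable_def
  proof (intro conjI ballI)
    show "F ` W \<subseteq> supported_on X" unfolding F_def using vD(4,6) by blast
    show "fv.subspace (F ` W)"
    proof (rule fv.subspaceI)
      have "F (0\<^sub>v N) = 0" by (simp add: F_def fun_eq_iff)
      then show "0 \<in> F ` W" using W0 by (metis image_eqI)
      fix f h c assume "f \<in> F ` W"
      then obtain w where w: "w \<in> W" "f = F w" by blast
      have "(\<lambda>x. c * f x) = F (c \<cdot>\<^sub>v w)"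
        unfolding w(2) F_def using w(1) WC by (auto simp: fun_eq_iff sum_distrib_left mult.assoc intro!: sum.cong)
      then show "(\<lambda>x. c * f x) \<in> F ` W" using Wsc[OF w(1)] by blast
      assume "h \<in> F ` W"
      then obtain u where u: "u \<in> W" "h = F u" by blast
      have "f + h = F (w + u)"
        unfolding w(2) u(2) F_def using w(1) u(1) WC
        by (auto simp: fun_eq_iff algebra_simps sum.distrib[symmetric] intro!: sum.cong)
      then show "f + h \<in> F ` W" using Wadd[OF w(1) u(1)] by blast
    qed
    fix g f assume g: "g \<in> carrier G" and "f \<in> F ` W"
    then obtain w where w: "w \<in> W" "f = F w" by blast
    then show "A g f \<in> F ` W" using FA[OF g, of w] W g WC by auto
  qed
  moreover have "F ` W \<subseteq> D" unfolding F_def using vD(4) by blast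
  ultimately consider "F ` W = {0}" | "F ` W = D" using D unfolding irreducible_subspace_def by blast
  then show "W = {0\<^sub>v N} \<or> W = carrier_vec N"
  proof cases
    case 1
    have "w = 0\<^sub>v N" if "w \<in> W" for w
      using inj[of w "0\<^sub>v N"] that WC 1 W0 by (metis image_eqI singletonD subsetD zero_carrier_vec)
    then show ?thesis using W0 by blast
  next
    case 2
    have "u \<in> W" if u: "u \<in> carrier_vec N" for u
    proof -
      have "F u \<in> F ` W" unfolding 2 F_def by (rule vD(4))
      then obtain w where "w \<in> W" "F u = F w" by blast
      then show ?thesis using inj[of u w] u WC by blast
    qed
    then show ?thesis using WC by blast
  qed
qed

end

section \<open>Isomorphism classes of irreducible representations\<close>

lemma equiv_iso: "equiv (irreps G) (iso_rel G \<inter> irreps G \<times> irreps G)"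
proof (rule equivI)
  have car: "\<sigma> g \<in> carrier_mat n n" if "(n, \<sigma>) \<in> irreps G" "g \<in> carrier G" for n \<sigma> g
    using that by (auto simp: irreps_def irreducible_rep_def representation_def hom_def GL_iff)
  show "refl_on (irreps G) (iso_rel G \<inter> irreps G \<times> irreps G)"
  proof (rule refl_onI)
    fix x assume x: "x \<in> irreps G"
    obtain n \<sigma> where x': "x = (n, \<sigma>)" by (cases x)
    have "1\<^sub>m n \<in> carrier (GL n)" by (auto simp: GL_iff intro!: bexI[of _ "1\<^sub>m n"])
    then have "(x, x) \<in> iso_rel G"
      unfolding iso_rel_def x' using left_mult_one_mat[OF car] right_mult_one_mat[OF car] x x'
      by (auto intro!: bexI[of _ "1\<^sub>m n"])
    then show "(x, x) \<in> iso_rel G \<inter> irreps G \<times> irreps G" using x by blast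
  qed
  show "sym (iso_rel G \<inter> irreps G \<times> irreps G)"
  proof (rule symI)
    fix x y assume xy: "(x, y) \<in> iso_rel G \<inter> irreps G \<times> irreps G"
    then obtain n \<rho> \<sigma> P where x: "x = (n, \<rho>)" "y = (n, \<sigma>)" and P: "P \<in> carrier (GL n)"
      "\<And>g. g \<in> carrier G \<Longrightarrow> P * \<rho> g = \<sigma> g * P" by (auto simp: iso_rel_def)
    obtain Q where Q: "Q \<in> carrier_mat n n" "Q * P = 1\<^sub>m n" "P * Q = 1\<^sub>m n" and PC: "P \<in> carrier_mat n n"
      using P(1) by (auto simp: GL_iff)
    have "Q * \<sigma> g = \<rho> g * Q" if g: "g \<in> carrier G" for g
    proof -
      have c: "\<rho> g \<in> carrier_mat n n" "\<sigma> g \<in> carrier_mat n n" using car g xy x by auto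
      have "Q * \<sigma> g = Q * (\<sigma> g * (P * Q))" using c Q by simp
      also have "\<dots> = Q * ((\<sigma> g * P) * Q)" using c Q PC by simp
      also have "\<dots> = Q * ((P * \<rho> g) * Q)" using P(2)[OF g] by simp
      also have "\<dots> = (Q * P) * (\<rho> g * Q)"
        using c Q(1) PC by (simp add: assoc_mult_mat[of _ n n _ n _ n])
      also have "\<dots> = \<rho> g * Q" using Q c by simp
      finally show ?thesis .
    qed
    moreover have "Q \<in> carrier (GL n)" using Q PC by (auto simp: GL_iff)
    ultimately show "(y, x) \<in> iso_rel G \<inter> irreps G \<times> irreps G" using xy unfolding x iso_rel_def by auto
  qed
  show "trans (iso_rel G \<inter> irreps G \<times> irreps G)"
  proof (rule transI)
    fix x y z assume xy: "(x, y) \<in> iso_rel G \<inter> irreps G \<times> irreps G" and yz: "(y, z) \<in> iso_rel G \<inter> irreps G \<times> irreps G"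
    then obtain n \<rho> \<sigma> \<tau> P P' where x: "x = (n, \<rho>)" "y = (n, \<sigma>)" "z = (n, \<tau>)"
      and P: "P \<in> carrier (GL n)" "\<And>g. g \<in> carrier G \<Longrightarrow> P * \<rho> g = \<sigma> g * P"
      and P': "P' \<in> carrier (GL n)" "\<And>g. g \<in> carrier G \<Longrightarrow> P' * \<sigma> g = \<tau> g * P'"
      by (auto simp: iso_rel_def)
    obtain Q where Q: "Q \<in> carrier_mat n n" "Q * P = 1\<^sub>m n" "P * Q = 1\<^sub>m n" and PC: "P \<in> carrier_mat n n"
      using P(1) by (auto simp: GL_iff)
    obtain Q' where Q': "Q' \<in> carrier_mat n n" "Q' * P' = 1\<^sub>m n" "P' * Q' = 1\<^sub>m n" and PC': "P' \<in> carrier_mat n n"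
      using P'(1) by (auto simp: GL_iff)
    note a = assoc_mult_mat[of _ n n _ n _ n]
    have "(P' * P) * \<rho> g = \<tau> g * (P' * P)" if g: "g \<in> carrier G" for g
    proof -
      have c: "\<rho> g \<in> carrier_mat n n" "\<sigma> g \<in> carrier_mat n n" "\<tau> g \<in> carrier_mat n n"
        using car g xy yz x by auto
      have "(P' * P) * \<rho> g = (P' * \<sigma> g) * P" using P(2)[OF g] c PC PC' by (simp add: a)
      also have "\<dots> = \<tau> g * (P' * P)" using P'(2)[OF g] c PC PC' by (simp add: a)
      finally show ?thesis .
    qed
    moreover have "P' * P \<in> carrier (GL n)"
    proof -
      have "(Q * Q') * (P' * P) = Q * ((Q' * P') * P)" using PC PC' Q(1) Q'(1) by (simp add: a)
      also have "\<dots> = 1\<^sub>m n" using Q Q' PC by simp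
      finally have 1: "(Q * Q') * (P' * P) = 1\<^sub>m n" .
      have "(P' * P) * (Q * Q') = P' * ((P * Q) * Q')" using PC PC' Q(1) Q'(1) by (simp add: a)
      also have "\<dots> = 1\<^sub>m n" using Q Q' PC' by simp
      finally show ?thesis
        unfolding GL_iff using 1 PC PC' Q(1) Q'(1) by (intro conjI bexI[of _ "Q * Q'"]) simp_all
    qed
    ultimately show "(x, z) \<in> iso_rel G \<inter> irreps G \<times> irreps G" using xy yz unfolding x iso_rel_def by auto
  qed
qed blast

lemma fv_span_finite:
  assumes "f \<in> fv.span S"
  shows "\<exists>T\<subseteq>S. finite T \<and> f \<in> fv.span T"
proof -
  obtain T c where T: "finite T" "T \<subseteq> S" "f = (\<Sum>a\<in>T. (\<lambda>x. c a * a x))"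
    using assms unfolding fv.span_explicit by blast
  then have "f \<in> fv.span T" by (auto intro: fv.span_sum fv.span_scale fv.span_base)
  then show ?thesis using T by blast
qed

text \<open>Every irreducible representation receives a nonzero equivariant map from the regular
  representation. That map is nonzero on one of finitely many irreducible subspaces spanning the
  regular representation, and there it is an isomorphism.\<close>

lemma finitely_many_irreps:
  assumes G: "group G" "finite (carrier G)"
  shows "\<exists>C. finite C \<and> C \<subseteq> irreps G \<and> (\<forall>x\<in>irreps G. \<exists>c\<in>C. (c, x) \<in> iso_rel G)"
proof -
  define Y where "Y = perm_space G 1"
  interpret U: urep G Y "perm_rep G" unfolding Y_def by (rule urep_perm[OF G])
  have "\<exists>T. T \<subseteq> \<Union> {D. U.irreducible_subspace D} \<and> finite T \<and> delta y \<in> fv.span T" if "y \<in> Y" for y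
    using fv_span_finite[OF subsetD[OF U.span_irreducible_subspace delta_supported_on[OF that]]] by blast
  then obtain T where T: "\<And>y. y \<in> Y \<Longrightarrow> T y \<subseteq> \<Union> {D. U.irreducible_subspace D}" "\<And>y. y \<in> Y \<Longrightarrow> finite (T y)"
    "\<And>y. y \<in> Y \<Longrightarrow> delta y \<in> fv.span (T y)" by metis
  define S where "S = (\<Union>y\<in>Y. T y)"
  have finS: "finite S" using T(2) U.fin_X by (auto simp: S_def)
  have "\<forall>t\<in>S. \<exists>D. U.irreducible_subspace D \<and> t \<in> D" using T(1) by (fastforce simp: S_def)
  then obtain Dt where Dt: "\<And>t. t \<in> S \<Longrightarrow> U.irreducible_subspace (Dt t) \<and> t \<in> Dt t" by metis
  have ons: "\<exists>v N. onb Y v N (Dt t)" if "t \<in> S" for t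
    using Dt[OF that] ex_onb[OF U.fin_X] U.stableD unfolding U.irreducible_subspace_def by meson
  then obtain v N where v: "\<And>t. t \<in> S \<Longrightarrow> onb Y (v t) (N t) (Dt t)" by metis
  define rp where "rp t = (N t, \<lambda>g. mat (N t) (N t) (\<lambda>(i, j). U.sub_rep (v t) g i j))" for t
  have rp: "rp t \<in> irreps G" if "t \<in> S" for t
    unfolding rp_def irreps_def using U.irreducible_sub_rep[OF v[OF that]] Dt[OF that] by simp
  have "\<exists>t\<in>S. (rp t, x) \<in> iso_rel G" if x: "x \<in> irreps G" for x
  proof -
    obtain M \<sigma> where xM: "x = (M, \<sigma>)" by (cases x)
    have \<sigma>: "irreducible_rep G M \<sigma>" using x xM by (simp add: irreps_def)
    then have M: "0 < M" by (simp add: irreducible_rep_def)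
    interpret s: mrep G "{..<M}" "\<lambda>g i j. \<sigma> g $$ (i, j)"
      by (rule mrep_of_representation[OF G]) (use \<sigma> in \<open>simp add: irreducible_rep_def\<close>)
    have \<sigma>c: "\<sigma> g \<in> carrier_mat M M" if "g \<in> carrier G" for g
      using \<sigma> that by (auto simp: irreducible_rep_def representation_def hom_def GL_iff)
    \<comment> \<open>The equivariant map from the regular representation that sends the delta
      function at h to the first column of \<sigma> h. It is not zero, since the unit goes to the
      first unit vector.\<close>
    define F where "F f k = (\<Sum>h\<in>carrier G. f (h, 0::nat) * \<sigma> h $$ (k, 0))" for f k
    have F_add: "F (f + f') k = F f k + F f' k" and F_scale: "F (\<lambda>x. c * f x) k = c * F f k"
      and F_0: "F 0 k = 0" for f f' c k
      by (simp_all add: F_def algebra_simps sum.distrib sum_distrib_left)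
    have F_sum: "F (\<lambda>x. \<Sum>i\<in>I. c i * f i x) k = (\<Sum>i\<in>I. c i * F (f i) k)" for I :: "nat set" and c f k
      by (simp add: F_def sum_distrib_left sum_distrib_right mult.assoc) (rule sum.swap)
    have F_A: "F (U.A g f) k = (\<Sum>j<M. \<sigma> g $$ (k, j) * F f j)" if g: "g \<in> carrier G" and k: "k < M" for g f k
    proof -
      have "U.A g f (h, 0) = (\<Sum>h'\<in>carrier G. (if h = g \<otimes>\<^bsub>G\<^esub> h' then f (h', 0) else 0))" if "h \<in> carrier G" for h
      proof -
        have "Y = (\<lambda>h. (h, 0)) ` carrier G" by (auto simp: perm_space_def Y_def)
        moreover have "inj_on (\<lambda>h. (h, 0::nat)) (carrier G)" by (simp add: inj_on_def)
        moreover have "(h, 0) \<in> Y" using that by (simp add: perm_space_def Y_def)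
        then have "U.A g f (h, 0) = (\<Sum>y\<in>Y. perm_rep G g (h, 0) y * f y)" by (simp add: U.A_def)
        ultimately have "U.A g f (h, 0) = (\<Sum>h'\<in>carrier G. perm_rep G g (h, 0) (h', 0) * f (h', 0))"
          by (simp only: sum.reindex o_def)
        also have "\<dots> = (\<Sum>h'\<in>carrier G. (if h = g \<otimes>\<^bsub>G\<^esub> h' then f (h', 0) else 0))"
          by (intro sum.cong refl) (simp add: perm_rep_def)
        finally show ?thesis .
      qed
      then have "F (U.A g f) k =
          (\<Sum>h\<in>carrier G. \<Sum>h'\<in>carrier G. (if h = g \<otimes>\<^bsub>G\<^esub> h' then f (h', 0) * \<sigma> h $$ (k, 0) else 0))"
        unfolding F_def by (intro sum.cong refl) (auto simp: sum_distrib_right intro!: sum.cong)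
      also have "\<dots> = (\<Sum>h'\<in>carrier G. \<Sum>h\<in>carrier G. (if h = g \<otimes>\<^bsub>G\<^esub> h' then f (h', 0) * \<sigma> h $$ (k, 0) else 0))"
        by (rule sum.swap)
      also have "\<dots> = (\<Sum>h'\<in>carrier G. f (h', 0) * \<sigma> (g \<otimes>\<^bsub>G\<^esub> h') $$ (k, 0))"
        using g G(2) by (intro sum.cong refl) simp
      also have "\<dots> = (\<Sum>h'\<in>carrier G. \<Sum>j<M. \<sigma> g $$ (k, j) * (f (h', 0) * \<sigma> h' $$ (j, 0)))"
        using g k M s.r_mult by (intro sum.cong refl) (simp add: sum_distrib_left mult_ac)
      also have "\<dots> = (\<Sum>j<M. \<sigma> g $$ (k, j) * F f j)"
        unfolding F_def by (subst sum.swap) (simp add: sum_distrib_left)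
      finally show ?thesis .
    qed
    have "\<exists>t\<in>S. \<exists>k<M. F t k \<noteq> 0"
    proof (rule ccontr)
      assume neg: "\<not> (\<exists>t\<in>S. \<exists>k<M. F t k \<noteq> 0)"
      have y: "(\<one>\<^bsub>G\<^esub>, 0) \<in> Y" by (simp add: perm_space_def Y_def)
      have "delta (\<one>\<^bsub>G\<^esub>, 0) \<in> fv.span S"
        using T(3)[OF y] fv.span_mono[of "T (\<one>\<^bsub>G\<^esub>, 0)" S] y by (auto simp: S_def)
      then have "\<forall>k<M. F (delta (\<one>\<^bsub>G\<^esub>, 0)) k = 0"
      proof (induction rule: fv.span_induct)
        case base
        show ?case by (rule fv.subspaceI) (auto simp: F_add F_scale F_0)
      qed (use neg in auto)
      moreover have "F (delta (\<one>\<^bsub>G\<^esub>, 0)) 0 = (\<Sum>h\<in>carrier G. if h = \<one>\<^bsub>G\<^esub> then \<sigma> h $$ (0, 0) else 0)"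
        unfolding F_def delta_def by (intro sum.cong) auto
      ultimately show False using M s.r_one[of 0 0] G(2) by simp
    qed
    then obtain t k0 where t: "t \<in> S" "k0 < M" "F t k0 \<noteq> 0" by blast
    let ?D = "Dt t"
    have D: "U.irreducible_subspace ?D" "t \<in> ?D" using Dt[OF t(1)] by auto
    have st: "U.stable ?D" using D(1) by (simp add: U.irreducible_subspace_def)
    note Ds = U.stableD[OF st]
    note vD = onbD[OF v[OF t(1)]]
    \<comment> \<open>Schur's argument: the kernel of \<open>F\<close> on \<open>?D\<close> is
      stable, hence zero, and the image is an invariant subspace different from zero, hence
      everything.\<close>
    have "U.stable {f \<in> ?D. \<forall>k<M. F f k = 0}"
      unfolding U.stable_def
    proof (intro conjI ballI)
      show "fv.subspace {f \<in> ?D. \<forall>k<M. F f k = 0}"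
        using Ds(1) by (intro fv.subspaceI) (auto simp: F_add F_scale F_0 fv.subspace_def)
      show "{f \<in> ?D. \<forall>k<M. F f k = 0} \<subseteq> supported_on Y" using Ds(2) by blast
      fix g f assume "g \<in> carrier G" "f \<in> {f \<in> ?D. \<forall>k<M. F f k = 0}"
      then show "U.A g f \<in> {f \<in> ?D. \<forall>k<M. F f k = 0}" using Ds(3) by (simp add: F_A)
    qed
    moreover have "{f \<in> ?D. \<forall>k<M. F f k = 0} \<noteq> ?D" using t D(2) by blast
    ultimately have ker: "{f \<in> ?D. \<forall>k<M. F f k = 0} = {0}" using D(1) unfolding U.irreducible_subspace_def by blast
    define W where "W = (\<lambda>f. vec M (F f)) ` ?D"
    have "vec_subspace M W"
      unfolding vec_subspace_def
    proof (intro conjI ballI allI)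
      show "W \<subseteq> carrier_vec M" by (auto simp: W_def)
      have "vec M (F 0) = 0\<^sub>v M" by (auto simp: F_0)
      then show "0\<^sub>v M \<in> W" using fv.subspace_0[OF Ds(1)] unfolding W_def by (metis image_eqI)
      fix u w c assume "u \<in> W"
      then obtain f where f: "f \<in> ?D" "u = vec M (F f)" by (auto simp: W_def)
      have "c \<cdot>\<^sub>v u = vec M (F (\<lambda>x. c * f x))" using f by (auto simp: F_scale)
      then show "c \<cdot>\<^sub>v u \<in> W" using fv.subspace_scale[OF Ds(1) f(1)] unfolding W_def by blast
      assume "w \<in> W"
      then obtain h where h: "h \<in> ?D" "w = vec M (F h)" by (auto simp: W_def)
      have "u + w = vec M (F (f + h))" using f h by (auto simp: F_add)
      then show "u + w \<in> W" using fv.subspace_add[OF Ds(1) f(1) h(1)] unfolding W_def by blast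
    qed
    moreover have "\<sigma> g *\<^sub>v w \<in> W" if g: "g \<in> carrier G" and w: "w \<in> W" for g w
    proof -
      obtain f where f: "f \<in> ?D" "w = vec M (F f)" using w by (auto simp: W_def)
      have "\<sigma> g *\<^sub>v w = vec M (F (U.A g f))"
        unfolding f(2) using \<sigma>c[OF g] by (intro eq_vecI) (auto simp: F_A[OF g] scalar_prod_def lessThan_atLeast0)
      then show ?thesis using Ds(3)[OF g f(1)] unfolding W_def by blast
    qed
    ultimately have "W = {0\<^sub>v M} \<or> W = carrier_vec M" using \<sigma> unfolding irreducible_rep_def by blast
    moreover have "W \<noteq> {0\<^sub>v M}"
    proof
      assume "W = {0\<^sub>v M}"
      then have "vec M (F t) = 0\<^sub>v M" using D(2) by (auto simp: W_def)
      then show False using t(2,3) by (metis index_vec index_zero_vec(1))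
    qed
    ultimately have "unit_vec M k \<in> W" for k by simp
    then have "\<exists>f\<in>?D. \<forall>i<M. F f i = (if i = k then 1 else 0)" if "k < M" for k
      using that unfolding W_def by (auto simp: image_iff dest!: arg_cong[of _ _ "\<lambda>v i. v $ i"] dest: spec[of _ k])
        (metis index_unit_vec(1) index_vec)
    then obtain \<xi> where \<xi>: "\<And>k. k < M \<Longrightarrow> \<xi> k \<in> ?D" "\<And>k i. k < M \<Longrightarrow> i < M \<Longrightarrow> F (\<xi> k) i = (if i = k then 1 else 0)"
      by metis
    \<comment> \<open>\<open>Q\<close> is the matrix of \<open>F\<close> from the orthonormal basis
      to the standard basis, and \<open>R\<close> that of its inverse, read off from the preimages
      \<xi> of the unit vectors.\<close>
    define Q where "Q i l = F (v t l) i" for i l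
    define R where "R l k = inner_on Y (\<xi> k) (v t l)" for l k
    have QR: "(\<Sum>l<N t. Q i l * R l k) = (if i = k then 1 else 0)" if "i < M" "k < M" for i k
    proof -
      have "F (\<xi> k) i = F (\<lambda>x. \<Sum>l<N t. R l k * v t l x) i"
        using vD(3)[OF \<xi>(1)[OF that(2)]] unfolding R_def by simp
      also have "\<dots> = (\<Sum>l<N t. Q i l * R l k)" unfolding F_sum Q_def by (simp add: mult.commute)
      finally show ?thesis using \<xi>(2) that by simp
    qed
    have RQ: "(\<Sum>i<M. R l i * Q i m) = (if l = m then 1 else 0)" if lm: "l < N t" "m < N t" for l m
    proof -
      define \<eta> where "\<eta> = (\<lambda>x. \<Sum>i<M. Q i m * \<xi> i x)"
      have "(\<Sum>i<M. (\<lambda>x. Q i m * \<xi> i x)) \<in> ?D"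
        using \<xi>(1) by (intro fv.subspace_sum[OF Ds(1)] fv.subspace_scale[OF Ds(1)]) auto
      moreover have "(\<Sum>i<M. (\<lambda>x. Q i m * \<xi> i x)) = \<eta>" by (simp add: \<eta>_def fun_eq_iff fun_sum_apply)
      ultimately have "\<eta> \<in> ?D" by simp
      then have "\<eta> - v t m \<in> ?D" using vD(2)[OF lm(2)] by (rule fv.subspace_diff[OF Ds(1)])
      moreover have "F (\<eta> - v t m) k = 0" if "k < M" for k
      proof -
        have diff: "F (\<eta> - v t m) k = F \<eta> k - F (v t m) k" by (simp add: F_def algebra_simps sum_subtractf)
        have "F \<eta> k = (\<Sum>i<M. if i = k then Q i m else 0)"
          unfolding \<eta>_def F_sum using \<xi>(2) that by (intro sum.cong) auto
        then show ?thesis unfolding diff using that by (simp add: Q_def)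
      qed
      ultimately have "\<eta> - v t m \<in> {0}" unfolding ker[symmetric] by blast
      then have "\<eta> = v t m" by simp
      then have "inner_on Y \<eta> (v t l) = (if m = l then 1 else 0)" using vD(7) lm by simp
      then show ?thesis unfolding \<eta>_def inner_on_sum R_def by (auto simp: mult.commute)
    qed
    \<comment> \<open>The traces of QR and RQ agree, and they are the two dimensions.\<close>
    have "of_nat M = (\<Sum>i<M. \<Sum>l<N t. Q i l * R l i)" by (simp add: QR)
    also have "\<dots> = (\<Sum>l<N t. \<Sum>i<M. R l i * Q i l)" by (subst sum.swap) (simp add: mult.commute)
    also have "\<dots> = (of_nat (N t) :: complex)" by (simp add: RQ)
    finally have NM: "N t = M" by simp
    let ?P = "mat M M (\<lambda>(i, j). Q i j)"
    have "?P \<in> carrier (GL M)"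
      unfolding GL_iff
    proof (intro conjI bexI[of _ "mat M M (\<lambda>(i, j). R i j)"])
      show "mat M M (\<lambda>(i, j). R i j) * ?P = 1\<^sub>m M"
        unfolding mat_mult_sum using RQ NM by (intro eq_matI) auto
      show "?P * mat M M (\<lambda>(i, j). R i j) = 1\<^sub>m M"
        unfolding mat_mult_sum using QR NM by (intro eq_matI) auto
    qed auto
    moreover have "?P * mat M M (\<lambda>(i, j). U.sub_rep (v t) g i j) = \<sigma> g * ?P" if g: "g \<in> carrier G" for g
    proof (rule eq_matI)
      fix i m assume "i < dim_row (\<sigma> g * ?P)" "m < dim_col (\<sigma> g * ?P)"
      then have im: "i < M" "m < M" using \<sigma>c[OF g] by auto
      have "(\<Sum>l<M. Q i l * U.sub_rep (v t) g l m) = F (\<lambda>x. \<Sum>l<M. U.sub_rep (v t) g l m * v t l x) i"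
        unfolding F_sum Q_def by (simp add: mult.commute)
      also have "\<dots> = F (U.A g (v t m)) i"
        using U.A_onb[OF v[OF t(1)] st g, of m] im NM unfolding U.sub_rep_def by simp
      also have "\<dots> = (\<Sum>j<M. \<sigma> g $$ (i, j) * Q j m)" unfolding F_A[OF g im(1)] Q_def ..
      finally show "(?P * mat M M (\<lambda>(i, j). U.sub_rep (v t) g i j)) $$ (i, m) = (\<sigma> g * ?P) $$ (i, m)"
        using im index_mult_sum[OF \<sigma>c[OF g], of ?P M i m] by (simp add: mat_mult_sum)
    qed (use \<sigma>c[OF g] in auto)
    ultimately have "(rp t, x) \<in> iso_rel G" unfolding rp_def xM iso_rel_def using NM by auto
    then show ?thesis using t(1) by blast
  qed
  then show ?thesis using finS rp by (intro exI[of _ "rp ` S"]) auto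
qed

text \<open>One summand is bounded by the whole sum because there are only finitely many classes;
  over an infinite set the sum would be 0.\<close>

lemma irrep_degree_le:
  assumes G: "group G" "finite (carrier G)" and x: "(n, \<rho>) \<in> irreps G"
  shows "n \<le> sum_irrep_degrees G"
proof -
  let ?E = "iso_rel G \<inter> irreps G \<times> irreps G"
  note E = equiv_iso[of G]
  obtain C where C: "finite C" "C \<subseteq> irreps G" "\<And>x. x \<in> irreps G \<Longrightarrow> \<exists>c\<in>C. (c, x) \<in> iso_rel G"
    using finitely_many_irreps[OF G] by blast
  have "irreps G // ?E \<subseteq> (\<lambda>c. ?E `` {c}) ` C"
  proof
    fix K assume "K \<in> irreps G // ?E"
    then obtain y where y: "y \<in> irreps G" "K = ?E `` {y}" by (auto elim: quotientE)
    obtain c where c: "c \<in> C" "(c, y) \<in> iso_rel G" using C(3)[OF y(1)] by blast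
    then have "(c, y) \<in> ?E" using C(2) y(1) by blast
    then show "K \<in> (\<lambda>c. ?E `` {c}) ` C" using equiv_class_eq[OF E] y(2) c(1) by blast
  qed
  then have fin: "finite (irreps G // ?E)" using C(1) finite_surj by blast
  let ?K = "?E `` {(n, \<rho>)}"
  have "fst ` ?K = {n}"
  proof -
    have "(n, \<rho>) \<in> ?K" using equiv_class_self[OF E x] .
    moreover have "fst y = n" if "y \<in> ?K" for y using that by (auto simp: iso_rel_def)
    ultimately show ?thesis by force
  qed
  moreover have "?K \<in> irreps G // ?E" using x by (rule quotientI)
  ultimately have "n \<le> (\<Sum>C\<in>irreps G // ?E. the_elem (fst ` C))"
    using member_le_sum[of ?K "irreps G // ?E" "\<lambda>C. the_elem (fst ` C)"] fin by simp
  then show ?thesis by (simp add: sum_irrep_degrees_def)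
qed

lemma (in urep) irreducible_subspace_onb_le:
  assumes "irreducible_subspace D" "onb X v N D"
  shows "N \<le> sum_irrep_degrees G"
  using irrep_degree_le[OF is_group fin_G] irreducible_sub_rep[OF assms(2,1)] by (auto simp: irreps_def)

section \<open>Reduction to representations of bounded dimension\<close>

text \<open>Evaluation at a point, expressed as the constant term after substituting constants so
  that the laws of \<open>subst_poly\<close> carry over.\<close>

definition eval_at :: "('x \<Rightarrow> complex) \<Rightarrow> 'x cpoly \<Rightarrow> complex" where
  "eval_at \<xi> f = lookup (subst_poly (\<lambda>x. single 0 (\<xi> x)) f :: 'x cpoly) 0"

lemma eval_at_add: "eval_at \<xi> (f + h) = eval_at \<xi> f + eval_at \<xi> h"
  and eval_at_mult: "eval_at \<xi> (f * h) = eval_at \<xi> f * eval_at \<xi> h"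
  and eval_at_cscale: "eval_at \<xi> (cscale c f) = c * eval_at \<xi> f"
  and eval_at_0 [simp]: "eval_at \<xi> 0 = 0"
  and eval_at_1 [simp]: "eval_at \<xi> 1 = 1"
  and eval_at_var [simp]: "eval_at \<xi> (var x) = \<xi> x"
  by (simp_all add: eval_at_def subst_poly_add subst_poly_mult subst_poly_cscale lookup_add lookup_mult_0 lookup_cscale)

lemma eval_at_sum: "eval_at \<xi> (sum f I) = (\<Sum>i\<in>I. eval_at \<xi> (f i))"
  by (induction I rule: infinite_finite_induct) (simp_all add: eval_at_add)

lemma eval_at_power: "eval_at \<xi> (f ^ k) = eval_at \<xi> f ^ k"
  by (induction k) (simp_all add: eval_at_mult)

lemma eval_at_cong: "f \<in> polys X \<Longrightarrow> (\<And>x. x \<in> X \<Longrightarrow> \<xi> x = \<eta> x) \<Longrightarrow> eval_at \<xi> f = eval_at \<eta> f"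
proof -
  assume "f \<in> polys X" "\<And>x. x \<in> X \<Longrightarrow> \<xi> x = \<eta> x"
  then have "subst_poly (\<lambda>x. single 0 (\<xi> x) :: 'a cpoly) f = subst_poly (\<lambda>x. single 0 (\<eta> x)) f"
    by (intro subst_poly_cong) auto
  then show ?thesis by (simp add: eval_at_def)
qed

text \<open>On points the substitution acts by the transpose of \<open>a\<close>; at a point fixed
  by the transpose it has no effect on values.\<close>

lemma eval_at_lin_subst: "eval_at \<xi> (lin_subst a Y f) = eval_at (\<lambda>j. \<Sum>i\<in>Y. a i j * \<xi> i) (f :: 'x cpoly)"
  for \<xi> :: "'x \<Rightarrow> complex"
proof -
  have "(\<Sum>i\<in>Y. cscale (a i j) (single 0 (\<xi> i))) = (single 0 (\<Sum>i\<in>Y. a i j * \<xi> i) :: 'x cpoly)" for j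
    by (rule poly_mapping_eqI) (simp add: lookup_sum lookup_cscale lookup_single when_def)
  then show ?thesis by (simp add: eval_at_def lin_subst_def subst_poly_comp subst_poly_sum subst_poly_cscale)
qed

lemma times_divide_power:
  assumes "\<And>m. m \<in> keys f \<Longrightarrow> k \<le> lookup m x"
  shows "var x ^ k * divide_power k x f = f"
proof (rule poly_mapping_eqI)
  fix n
  show "lookup (var x ^ k * divide_power k x f) n = lookup f n"
  proof (cases "k \<le> lookup n x")
    case True
    then have "n = single x k + (n - single x k)"
      by (intro poly_mapping_eqI) (auto simp: lookup_add lookup_minus lookup_single when_def)
    then obtain n' where n: "n = single x k + n'" by (rule that)
    show ?thesis unfolding n var_power lookup_single_mult lookup_divide_power by simp
  next
    case False
    have "n \<notin> keys (var x ^ k * divide_power k x f)"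
    proof
      assume "n \<in> keys (var x ^ k * divide_power k x f)"
      then obtain m m' where "m \<in> keys (var x ^ k)" "n = m + m'"
        using keys_mult[of "var x ^ k" "divide_power k x f"] by blast
      then show False using False by (simp add: var_power lookup_add)
    qed
    moreover have "n \<notin> keys f" using assms False by blast
    ultimately show ?thesis by (simp add: in_keys_iff)
  qed
qed

text \<open>Expand in powers of one variable, take a point at which some coefficient does not
  vanish, and give the variable a value avoiding the finitely many roots of the resulting
  polynomial.\<close>

lemma ex_eval_at_nonzero:
  assumes "finite X" "f \<in> polys X" "f \<noteq> 0"
  shows "\<exists>\<xi>\<in>supported_on X. eval_at \<xi> f \<noteq> 0"
  using assms
proof (induction X arbitrary: f)
  case empty
  then have "keys f \<subseteq> {0}" by (auto simp: polys_def)
  then have "f = single 0 (lookup f 0)"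
    by (intro poly_mapping_eqI) (auto simp: lookup_single when_def in_keys_iff)
  then obtain c where c: "f = cscale c 1" using cscale_single[of c 0 1] by (simp add: single_one cscale_conv_mult)
  then have "eval_at (\<lambda>_. 0) f \<noteq> 0" using empty by (auto simp: eval_at_cscale)
  then show ?case by (intro bexI[of _ "\<lambda>_. 0"]) (auto simp: supported_on_def)
next
  case (insert x X)
  define h where "h k = divide_power k x (restrict_monoms (\<lambda>m. lookup m x = k) f)" for k
  define K where "K = (\<lambda>m. lookup m x) ` keys f"
  have K: "finite K" by (simp add: K_def)
  have h: "var x ^ k * h k = restrict_monoms (\<lambda>m. lookup m x = k) f" for k
    unfolding h_def by (rule times_divide_power) (auto simp: keys_restrict_monoms)
  have f: "f = (\<Sum>k\<in>K. var x ^ k * h k)"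
    unfolding h by (rule poly_mapping_eqI) (auto simp: lookup_sum lookup_restrict_monoms K_def sum.delta in_keys_iff)
  have hX: "h k \<in> polys X" for k
    unfolding polys_def
  proof (intro CollectI ballI)
    fix m assume "m \<in> keys (h k)"
    then have m: "single x k + m \<in> keys f" "lookup (single x k + m) x = k"
      by (auto simp: h_def in_keys_iff lookup_divide_power lookup_restrict_monoms split: if_splits)
    then have "keys (single x k + m) \<subseteq> insert x X" using insert.prems(1) by (auto simp: polys_def)
    moreover have "lookup m x = 0" using m(2) by (simp add: lookup_add)
    moreover have "keys m \<subseteq> keys (single x k + m)" by (auto simp: in_keys_iff lookup_add)
    moreover have "x \<notin> keys m" using \<open>lookup m x = 0\<close> by (simp add: in_keys_iff)
    ultimately show "keys m \<subseteq> X" by blast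
  qed
  have "\<exists>k\<in>K. h k \<noteq> 0"
  proof (rule ccontr)
    assume "\<not> (\<exists>k\<in>K. h k \<noteq> 0)"
    then have "(\<Sum>k\<in>K. var x ^ k * h k) = 0" by simp
    then show False using insert.prems(2) f by (rule_tac notE) (assumption, rule trans)
  qed
  then obtain k0 where k0: "k0 \<in> K" "h k0 \<noteq> 0" by blast
  then obtain \<xi> where \<xi>: "\<xi> \<in> supported_on X" "eval_at \<xi> (h k0) \<noteq> 0" using insert.IH[OF hX] by blast
  define e where "e k = (if k \<in> K then eval_at \<xi> (h k) else 0)" for k
  have KM: "K \<subseteq> {..Max K}" using K by auto
  have "finite {t. (\<Sum>k\<le>Max K. e k * t ^ k) = 0}"
    unfolding polyfun_finite_roots using k0(1) \<xi>(2) KM by (intro exI[of _ k0]) (auto simp: e_def)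
  then obtain t where t: "(\<Sum>k\<le>Max K. e k * t ^ k) \<noteq> 0"
    using infinite_UNIV_char_0[where 'a = complex] by (metis (mono_tags, lifting) UNIV_eq_I mem_Collect_eq)
  have "eval_at (\<xi>(x := t)) (h k) = eval_at \<xi> (h k)" for k
    by (rule eval_at_cong[OF hX]) (use insert.hyps(2) in auto)
  then have "eval_at (\<xi>(x := t)) f = (\<Sum>k\<in>K. t ^ k * eval_at \<xi> (h k))"
    by (subst f) (simp add: eval_at_sum eval_at_mult eval_at_power)
  also have "\<dots> = (\<Sum>k\<le>Max K. e k * t ^ k)"
    by (rule sum.mono_neutral_cong_left) (use KM in \<open>auto simp: e_def\<close>)
  finally have "eval_at (\<xi>(x := t)) f \<noteq> 0" using t by simp
  moreover have "\<xi>(x := t) \<in> supported_on (insert x X)" using \<xi>(1) by (auto simp: supported_on_def)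
  ultimately show ?case by blast
qed

subsection \<open>Matrices acting on words and on lists of words\<close>

lemma word_mat_comp:
  "length w = k \<Longrightarrow> (\<Sum>u\<in>words Z k. word_mat b w' u * word_mat a u w) = word_mat (\<lambda>i j. \<Sum>l\<in>Z. b i l * a l j) w' w"
proof (induction w arbitrary: k w')
  case Nil
  then show ?case by (cases w') (auto simp: word_mat_length)
next
  case (Cons j w)
  then obtain k' where k: "k = Suc k'" "length w = k'" by auto
  show ?case
  proof (cases w')
    case Nil
    then show ?thesis by (auto simp: k words_def word_mat_length intro!: sum.neutral)
  next
    case (Cons i v)
    have "(\<Sum>u\<in>words Z k. word_mat b w' u * word_mat a u (j # w)) =
        (\<Sum>l\<in>Z. \<Sum>u\<in>words Z k'. (b i l * a l j) * (word_mat b v u * word_mat a u w))"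
      unfolding k Cons sum_words_Suc by (simp add: mult_ac)
    also have "\<dots> = (\<Sum>l\<in>Z. b i l * a l j) * word_mat (\<lambda>i j. \<Sum>l\<in>Z. b i l * a l j) v w"
      unfolding Cons.IH[OF k(2), symmetric] sum_product by simp
    finally show ?thesis by (simp add: Cons)
  qed
qed

lemma word_mat_adj: "word_mat (\<lambda>i j. cnj (a j i)) u w = cnj (word_mat a w u)"
proof (induction u arbitrary: w)
  case Nil
  then show ?case by (cases w) auto
next
  case (Cons i u)
  then show ?case by (cases w) auto
qed

text \<open>The matrix of \<open>a\<close> on tensors indexed by lists of words; entries vanish
  unless the word lengths agree position by position.\<close>

primrec words_mat :: "('y \<Rightarrow> 'x \<Rightarrow> complex) \<Rightarrow> 'y list list \<Rightarrow> 'x list list \<Rightarrow> complex" where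
  "words_mat a [] v = (if v = [] then 1 else 0)"
| "words_mat a (u # us) v = (case v of [] \<Rightarrow> 0 | w # ws \<Rightarrow> word_mat a u w * words_mat a us ws)"

lemma words_mat_adj: "words_mat (\<lambda>i j. cnj (a j i)) us ws = cnj (words_mat a ws us)"
proof (induction us arbitrary: ws)
  case Nil
  then show ?case by (cases ws) auto
next
  case (Cons u us)
  then show ?case by (cases ws) (auto simp: word_mat_adj)
qed

lemma words_mat_length: "words_mat a us ws \<noteq> 0 \<Longrightarrow> map length us = map length ws"
proof (induction us arbitrary: ws)
  case Nil
  then show ?case by (cases ws) auto
next
  case (Cons u us)
  then obtain w v where ws: "ws = w # v" "word_mat a u w \<noteq> 0" "words_mat a us v \<noteq> 0"
    by (auto split: list.splits)
  then show ?case using word_mat_length[of u w a] Cons.IH[of v] by auto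
qed

text \<open>The effect of \<open>a\<close> on the Koszul generators, in the form required by
  \<open>koszul_map\<close>: the generator at w goes to a combination of generators with constant
  coefficients from a tensor power of \<open>a\<close>.\<close>

definition word_chain_mat :: "'y list set \<Rightarrow> ('y \<Rightarrow> 'x \<Rightarrow> complex) \<Rightarrow> 'x list \<Rightarrow> 'y list \<Rightarrow> 'y cpoly" where
  "word_chain_mat U a w w' = (if w' \<in> U then single 0 (word_mat a w' w) else 0)"

lemma words_low: "w \<in> low_words X b \<Longrightarrow> words Y (length w) \<subseteq> low_words Y b"
  by (auto simp: words_def low_words_def)

lemma sum_low_words:
  assumes "finite Y" "w \<in> low_words X b" "\<And>u. u \<in> low_words Y b \<Longrightarrow> length u \<noteq> length w \<Longrightarrow> F u = 0"
  shows "sum F (low_words Y b) = sum F (words Y (length w))"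
  by (rule sum.mono_neutral_right[OF finite_low_words[OF assms(1)] words_low[OF assms(2)]])
    (use assms(3) in \<open>auto simp: low_words_def words_def\<close>)

text \<open>The functoriality that words provide. An intertwiner commutes with averaging, so word
  invariants transform with the same coefficients as words.\<close>

lemma word_chain_mat_chain:
  assumes "mrep G X r" "mrep G Y s"
    and eq: "\<And>g i j. g \<in> carrier G \<Longrightarrow> i \<in> Y \<Longrightarrow> j \<in> X \<Longrightarrow>
      (\<Sum>k\<in>X. a i k * r g k j) = (\<Sum>k\<in>Y. s g i k * a k j)"
    and w: "w \<in> low_words X b"
  shows "(\<Sum>u\<in>low_words Y b. mrep.word_invariant G Y s u * word_chain_mat (low_words Y b) a w u) = lin_subst a Y (mrep.word_invariant G X r w)"
proof -
  interpret V: mrep G X r by fact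
  interpret W: mrep G Y s by fact
  have wX: "set w \<subseteq> X" using w by (simp add: low_words_def)
  have "lin_subst a Y (V.word_invariant w) = W.reynolds (lin_subst a Y (word_poly w))"
    unfolding V.word_invariant_def by (rule lin_subst_reynolds[OF assms(1,2) eq polys_word_poly[OF wX]])
  also have "\<dots> = (\<Sum>u\<in>words Y (length w). cscale (word_mat a u w) (W.word_invariant u))"
    by (simp add: lin_subst_word_poly W.reynolds_sum W.reynolds_cscale W.word_invariant_def)
  also have "\<dots> = (\<Sum>u\<in>low_words Y b. cscale (word_mat a u w) (W.word_invariant u))"
    by (rule sum_low_words[OF W.fin_X w, symmetric]) (simp add: word_mat_length)
  also have "\<dots> = (\<Sum>u\<in>low_words Y b. W.word_invariant u * word_chain_mat (low_words Y b) a w u)"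
    by (intro sum.cong refl) (simp add: word_chain_mat_def cscale_conv_mult mult.commute)
  finally show ?thesis by simp
qed

lemma koszul_map_word_chain_mat:
  assumes "set js \<subseteq> U'"
  shows "koszul_map U (word_chain_mat U' a) h js z = (\<Sum>l\<in>words U (length js). cscale (words_mat a js l) (h (z l)))"
  using assms
proof (induction js arbitrary: z)
  case (Cons j js)
  have "koszul_map U (word_chain_mat U' a) h (j # js) z =
      (\<Sum>i\<in>U. \<Sum>l\<in>words U (length js). cscale (word_mat a j i * words_mat a js l) (h (z (i # l))))"
  proof -
    have j: "j \<in> U'" "set js \<subseteq> U'" using Cons.prems by auto
    show ?thesis
      unfolding koszul_map.simps Cons.IH[OF j(2)]
      by (simp add: word_chain_mat_def j cscale_sum_right flip: cscale_conv_mult)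
  qed
  also have "\<dots> = (\<Sum>l\<in>words U (length (j # js)). cscale (words_mat a (j # js) l) (h (z l)))"
    unfolding length_Cons sum_words_Suc by simp
  finally show ?case .
qed simp

subsection \<open>Detecting tensors by vectors from a spanning set\<close>

text \<open>The entry at \<open>w\<close> of the decomposable tensor formed from the vectors in the
  list; \<open>pair_words\<close> is the same for lists of words.\<close>

primrec pair_word :: "('y \<Rightarrow> complex) list \<Rightarrow> 'y list \<Rightarrow> complex" where
  "pair_word [] w = (if w = [] then 1 else 0)"
| "pair_word (\<eta> # ys) w = (case w of [] \<Rightarrow> 0 | x # w' \<Rightarrow> \<eta> x * pair_word ys w')"

primrec pair_words :: "('y \<Rightarrow> complex) list list \<Rightarrow> 'y list list \<Rightarrow> complex" where
  "pair_words [] l = (if l = [] then 1 else 0)"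
| "pair_words (ys # yss) l = (case l of [] \<Rightarrow> 0 | w # l' \<Rightarrow> pair_word ys w * pair_words yss l')"

lemma pair_word_length: "length ys \<noteq> length w \<Longrightarrow> pair_word ys w = 0"
  by (induction ys arbitrary: w) (auto split: list.split)

text \<open>Decomposable tensors with factors from a spanning set span the tensor power, so a tensor
  orthogonal to all of them is zero.\<close>

lemma pair_word_detect:
  assumes Y: "finite Y" and S: "supported_on Y \<subseteq> fv.span S"
  shows "(\<And>ys. ys \<in> words S k \<Longrightarrow> (\<Sum>w\<in>words Y k. pair_word ys w * c w) = 0) \<Longrightarrow> w \<in> words Y k \<Longrightarrow> c w = 0"
proof (induction k arbitrary: c w)
  case 0
  then show ?case using "0.prems"(1)[of "[]"] by simp
next
  case (Suc k)
  obtain x v where w: "w = x # v" "x \<in> Y" "v \<in> words Y k"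
    using Suc.prems(2) by (cases w) (auto simp: words_def)
  have 1: "(\<Sum>x\<in>Y. \<eta> x * c (x # v)) = 0" if \<eta>: "\<eta> \<in> S" for \<eta>
  proof (rule Suc.IH[OF _ w(3)])
    fix ys assume ys: "ys \<in> words S k"
    have "(\<Sum>w\<in>words Y k. pair_word ys w * (\<Sum>x\<in>Y. \<eta> x * c (x # w))) =
        (\<Sum>x\<in>Y. \<Sum>w\<in>words Y k. \<eta> x * pair_word ys w * c (x # w))"
      unfolding sum_distrib_left by (subst sum.swap) (simp add: mult_ac)
    also have "\<dots> = 0" using Suc.prems(1)[of "\<eta> # ys"] \<eta> ys by (simp add: sum_words_Suc)
    finally show "(\<Sum>w\<in>words Y k. pair_word ys w * (\<Sum>x\<in>Y. \<eta> x * c (x # w))) = 0" .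
  qed
  have "(\<Sum>x\<in>Y. \<eta> x * c (x # v)) = 0" if "\<eta> \<in> fv.span S" for \<eta>
    using that
  proof (induction rule: fv.span_induct)
    case base
    show ?case by (rule fv.subspaceI) (auto simp: algebra_simps sum.distrib simp flip: sum_distrib_left)
  qed (rule 1)
  then have "(\<Sum>y\<in>Y. delta x y * c (y # v)) = 0" using S delta_supported_on[OF w(2)] by blast
  then show ?case using Y w by (simp add: delta_def if_distrib[of "\<lambda>t. t * _"] cong: if_cong)
qed

text \<open>The detecting vectors come in the shape of \<open>l\<close>. Their number is therefore
  the total length of the words in \<open>l\<close>, which becomes the factor p b of the
  bound.\<close>

lemma pair_words_detect:
  assumes Y: "finite Y" and S: "supported_on Y \<subseteq> fv.span S"
  shows "l \<in> words (low_words Y b) p \<Longrightarrow> c l \<noteq> 0 \<Longrightarrow>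
    \<exists>yss. map length yss = map length l \<and> (\<forall>ys\<in>set yss. set ys \<subseteq> S) \<and>
      (\<Sum>l\<in>words (low_words Y b) p. pair_words yss l * c l) \<noteq> 0"
proof (induction p arbitrary: l c)
  case 0
  then show ?case by (intro exI[of _ "[]"]) auto
next
  case (Suc p)
  let ?U = "low_words Y b"
  obtain w v where l: "l = w # v" "w \<in> ?U" "v \<in> words ?U p"
    using Suc.prems(1) by (cases l) (auto simp: words_def)
  have "w \<in> words Y (length w)" using l(2) by (auto simp: words_def low_words_def)
  then obtain ys where ys: "ys \<in> words S (length w)" "(\<Sum>u\<in>words Y (length w). pair_word ys u * c (u # v)) \<noteq> 0"
    using pair_word_detect[OF Y S, of "length w" "\<lambda>u. c (u # v)" w] Suc.prems(2) l(1) by blast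
  define c' where "c' l = (\<Sum>u\<in>?U. pair_word ys u * c (u # l))" for l
  have "c' v = (\<Sum>u\<in>words Y (length w). pair_word ys u * c (u # v))"
    unfolding c'_def by (rule sum_low_words[OF Y l(2)]) (use ys(1) in \<open>simp add: pair_word_length words_def\<close>)
  then have "c' v \<noteq> 0" using ys(2) by simp
  then obtain yss where yss: "map length yss = map length v" "\<forall>ys\<in>set yss. set ys \<subseteq> S"
    "(\<Sum>l\<in>words ?U p. pair_words yss l * c' l) \<noteq> 0" using Suc.IH[OF l(3)] by blast
  have "(\<Sum>l\<in>words ?U p. pair_words yss l * c' l) = (\<Sum>l\<in>words ?U (Suc p). pair_words (ys # yss) l * c l)"
    unfolding c'_def sum_words_Suc sum_distrib_left by (subst sum.swap) (simp add: mult_ac)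
  then show ?case using yss ys(1) l(1) by (intro exI[of _ "ys # yss"]) (auto simp: words_def)
qed

text \<open>If the transpose of \<open>a\<close> fixes every factor, its tensor power fixes their
  product.\<close>

lemma pair_word_word_mat:
  assumes "\<And>\<eta>. \<eta> \<in> set ys \<Longrightarrow> (\<lambda>j. \<Sum>i\<in>Y. a i j * \<eta> i) = \<eta>"
  shows "length w = k \<Longrightarrow> (\<Sum>u\<in>words Y k. pair_word ys u * word_mat a u w) = pair_word ys w"
  using assms
proof (induction ys arbitrary: w k)
  case Nil
  show ?case
  proof (cases w)
    case (Cons x v)
    then show ?thesis using Nil by (auto simp: words_def intro!: sum.neutral)
  qed (use Nil in simp)
next
  case (Cons \<eta> ys)
  show ?case
  proof (cases w)
    case (Cons x v)
    then obtain k' where k: "k = Suc k'" "length v = k'" using Cons.prems(1) by auto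
    have "(\<Sum>u\<in>words Y k. pair_word (\<eta> # ys) u * word_mat a u w) =
        (\<Sum>y\<in>Y. a y x * \<eta> y) * (\<Sum>u\<in>words Y k'. pair_word ys u * word_mat a u v)"
      unfolding k sum_words_Suc sum_product by (simp add: Cons mult_ac)
    also have "(\<Sum>y\<in>Y. a y x * \<eta> y) = \<eta> x" using Cons.prems(2)[of \<eta>] by (simp add: fun_eq_iff)
    also have "(\<Sum>u\<in>words Y k'. pair_word ys u * word_mat a u v) = pair_word ys v"
      by (rule Cons.IH[OF k(2)]) (use Cons.prems(2) in auto)
    finally show ?thesis by (simp add: Cons)
  qed (use Cons.prems in simp)
qed

lemma pair_words_words_mat:
  assumes Y: "finite Y" and a: "\<And>ys \<eta>. ys \<in> set yss \<Longrightarrow> \<eta> \<in> set ys \<Longrightarrow> (\<lambda>j. \<Sum>i\<in>Y. a i j * \<eta> i) = \<eta>"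
  shows "l \<in> words (low_words Y b) p \<Longrightarrow>
    (\<Sum>l'\<in>words (low_words Y b) p. pair_words yss l' * words_mat a l' l) = pair_words yss l"
  using a
proof (induction yss arbitrary: l p)
  case Nil
  show ?case
  proof (cases p)
    case (Suc p')
    then have "l \<noteq> []" using Nil.prems by (auto simp: words_def)
    then show ?thesis by (auto simp: Suc words_def intro!: sum.neutral)
  qed (use Nil.prems in simp)
next
  case (Cons ys yss)
  let ?U = "low_words Y b"
  show ?case
  proof (cases p)
    case (Suc p')
    obtain w v where l: "l = w # v" "w \<in> ?U" "v \<in> words ?U p'"
      using Cons.prems(1) Suc by (cases l) (auto simp: words_def)
    have "(\<Sum>l'\<in>words ?U p. pair_words (ys # yss) l' * words_mat a l' l) =
        (\<Sum>u\<in>?U. pair_word ys u * word_mat a u w) * (\<Sum>l'\<in>words ?U p'. pair_words yss l' * words_mat a l' v)"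
      unfolding Suc sum_words_Suc sum_product l(1) by (simp add: mult_ac)
    also have "(\<Sum>u\<in>?U. pair_word ys u * word_mat a u w) = (\<Sum>u\<in>words Y (length w). pair_word ys u * word_mat a u w)"
      by (rule sum_low_words[OF Y l(2)]) (simp add: word_mat_length)
    also have "\<dots> = pair_word ys w" by (rule pair_word_word_mat) (use Cons.prems(2) in auto)
    also have "(\<Sum>l'\<in>words ?U p'. pair_words yss l' * words_mat a l' v) = pair_words yss v"
      by (rule Cons.IH[OF l(3)]) (use Cons.prems(2) in auto)
    finally show ?thesis by (simp add: l)
  qed (use Cons.prems in simp)
qed

context urep
begin

text \<open>Origin of g + \<beta> p m: the orbit of \<xi> has at most
  \<open>card (carrier G)\<close> elements, and each further vector lies in an irreducible subspace
  of dimension at most \<open>sum_irrep_degrees G\<close>.\<close>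

lemma small_stable_subspace:
  assumes \<xi>: "\<xi> \<in> supported_on X" and L: "set ys \<subseteq> \<Union> {D. irreducible_subspace D}"
  shows "\<exists>v N D. stable D \<and> onb X v N D \<and> \<xi> \<in> D \<and> set ys \<subseteq> D \<and>
    N \<le> card (carrier G) + length ys * sum_irrep_degrees G"
proof -
  have "\<exists>D v N. irreducible_subspace D \<and> \<eta> \<in> D \<and> onb X v N D \<and> N \<le> sum_irrep_degrees G" if \<eta>: "\<eta> \<in> set ys" for \<eta>
  proof -
    obtain D where D: "irreducible_subspace D" "\<eta> \<in> D" using L \<eta> by blast
    have st: "stable D" using D(1) by (simp add: irreducible_subspace_def)
    obtain v N where v: "onb X v N D" using ex_onb[OF fin_X stableD(1,2)[OF st]] by blast
    show ?thesis using D v irreducible_subspace_onb_le[OF D(1) v] by blast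
  qed
  then obtain D v N where D: "\<And>\<eta>. \<eta> \<in> set ys \<Longrightarrow> irreducible_subspace (D \<eta>)" "\<And>\<eta>. \<eta> \<in> set ys \<Longrightarrow> \<eta> \<in> D \<eta>"
    "\<And>\<eta>. \<eta> \<in> set ys \<Longrightarrow> onb X (v \<eta>) (N \<eta>) (D \<eta>)" "\<And>\<eta>. \<eta> \<in> set ys \<Longrightarrow> N \<eta> \<le> sum_irrep_degrees G"
    by metis
  define S where "S = (\<lambda>g. A g \<xi>) ` carrier G \<union> (\<Union>\<eta>\<in>set ys. v \<eta> ` {..<N \<eta>})"
  have SF: "S \<subseteq> supported_on X" using onbD(2,6)[OF D(3)] A_FS by (auto simp: S_def)
  have DS: "D \<eta> \<subseteq> fv.span S" if "\<eta> \<in> set ys" for \<eta>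
    using D(3)[OF that] that fv.span_mono[of "v \<eta> ` {..<N \<eta>}" S] by (auto simp: onb_def S_def)
  have "stable (fv.span S)"
  proof (rule stable_span[OF SF])
    fix g f assume g: "g \<in> carrier G" and "f \<in> S"
    then consider h where "h \<in> carrier G" "f = A h \<xi>" | \<eta> i where "\<eta> \<in> set ys" "i < N \<eta>" "f = v \<eta> i"
      by (auto simp: S_def)
    then show "A g f \<in> fv.span S"
    proof cases
      case 1
      then have "A g f = A (g \<otimes> h) \<xi>" using A_mult[OF g] by simp
      then show ?thesis using g 1 by (auto intro!: fv.span_base simp: S_def)
    next
      case 2
      have "f \<in> D \<eta>" using onbD(2)[OF D(3)[OF 2(1)] 2(2)] 2(3) by simp
      moreover have "stable (D \<eta>)" using D(1)[OF 2(1)] by (simp add: irreducible_subspace_def)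
      ultimately have "A g f \<in> D \<eta>" using stableD(3)[OF _ g] by blast
      then show ?thesis using DS[OF 2(1)] by blast
    qed
  qed
  moreover have fS: "finite S" using fin_G by (simp add: S_def)
  moreover have "card S \<le> card (carrier G) + length ys * sum_irrep_degrees G"
  proof -
    have "card S \<le> card ((\<lambda>g. A g \<xi>) ` carrier G) + card (\<Union>\<eta>\<in>set ys. v \<eta> ` {..<N \<eta>})"
      unfolding S_def by (rule card_Un_le)
    also have "\<dots> \<le> card (carrier G) + (\<Sum>\<eta>\<in>set ys. card (v \<eta> ` {..<N \<eta>}))"
      by (intro add_mono card_image_le fin_G card_UN_le) simp
    also have "(\<Sum>\<eta>\<in>set ys. card (v \<eta> ` {..<N \<eta>})) \<le> (\<Sum>\<eta>\<in>set ys. sum_irrep_degrees G)"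
    proof (rule sum_mono)
      fix \<eta> assume "\<eta> \<in> set ys"
      then show "card (v \<eta> ` {..<N \<eta>}) \<le> sum_irrep_degrees G"
        using D(4) card_image_le[of "{..<N \<eta>}" "v \<eta>"] by fastforce
    qed
    also have "\<dots> \<le> length ys * sum_irrep_degrees G" by (simp add: card_length)
    finally show ?thesis by simp
  qed
  moreover obtain v' N' where v': "onb X v' N' (fv.span S)" "N' \<le> card S"
    using gram_schmidt[OF fin_X fS SF] by blast
  moreover have "\<xi> \<in> fv.span S"
    using A_one[OF \<xi>] one_closed by (auto intro!: fv.span_base simp: S_def intro: image_eqI[of _ _ \<one>])
  moreover have "set ys \<subseteq> fv.span S" using D(2) DS by blast
  ultimately show ?thesis by (meson le_trans)
qed

text \<open>If \<open>z\<close> is not a boundary, replace it by its component orthogonal to the boundaries, in a space of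
  tensors mapping onto the Koszul complex. Orthogonal projections of \<open>V\<close> to stable subspaces act on
  this space by self-adjoint maps preserving the boundaries, so this component stays orthogonal to the
  boundaries under such projections. Some projection to a subspace of bounded dimension does not kill
  it, which contradicts the vanishing for that subspace.\<close>

theorem koszul_vanishing_large:
  fixes b p d :: nat
  defines "N0 \<equiv> card (carrier G) + (p * b) * sum_irrep_degrees G"
  assumes gen: "\<And>(N :: nat) \<sigma>. mrep G {..<N} \<sigma> \<Longrightarrow>
      subalgebra hull {f \<in> mrep.invs G {..<N} \<sigma>. total_deg f \<le> b} = mrep.invs G {..<N} \<sigma>"
    and b: "1 \<le> b" and d: "p * b + N0 * (b - 1) < d"
    and z: "koszul (low_words X b) p z" "\<And>l. z l \<in> polys X" "graded_chain length 0 d z"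
      "\<And>l. koszul_d (low_words X b) word_invariant z l = 0"
  shows "\<exists>y. koszul (low_words X b) (Suc p) y \<and> z = koszul_d (low_words X b) word_invariant y"
proof (rule ccontr)
  assume notbd: "\<not> (\<exists>y. koszul (low_words X b) (Suc p) y \<and> z = koszul_d (low_words X b) word_invariant y)"
  let ?U = "low_words X b"
  define Wd where "Wd = {w. set w \<subseteq> X \<and> length w \<le> d}"
  \<comment> \<open>In a basis tensor the first word stands for a monomial of the coefficient and
    the remaining words are the Koszul indices. Tensors need not be alternating, so every basis list
    is an independent coordinate.\<close>
  define KK where "KK = (\<lambda>(w, l). w # l) ` (Wd \<times> words ?U p)"
  have finU: "finite ?U" by (rule finite_low_words[OF fin_X])
  have finWd: "finite Wd" unfolding Wd_def by (rule finite_lists_length_le[OF fin_X])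
  have finKK: "finite KK" by (simp add: KK_def finWd finite_words finU)
  have inKK: "w # l \<in> KK \<longleftrightarrow> w \<in> Wd \<and> l \<in> words ?U p" for w l by (auto simp: KK_def)
  have sumKK: "(\<Sum>ws\<in>KK. H ws) = (\<Sum>w\<in>Wd. \<Sum>l\<in>words ?U p. H (w # l))" for H :: "'x list list \<Rightarrow> complex"
  proof -
    have "inj_on (\<lambda>(w, l). w # l) (Wd \<times> words ?U p)" by (auto simp: inj_on_def)
    then show ?thesis unfolding KK_def by (simp add: sum.reindex sum.cartesian_product case_prod_unfold)
  qed
  define FSd where "FSd = {t \<in> supported_on KK. \<forall>ws. t ws \<noteq> 0 \<longrightarrow> sum_list (map length ws) = d}"
  \<comment> \<open>Multiplying out the first word turns a tensor into a function on lists of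
    indices. This function is a Koszul chain only for some tensors, whence the assumption in
    \<open>q_T\<close>.\<close>
  define q where "q t l = (\<Sum>w\<in>Wd. cscale (t (w # l)) (word_poly w))" for t l
  have q_add: "q (t + t') l = q t l + q t' l" and q_scale: "q (\<lambda>x. c * t x) l = cscale c (q t l)"
    and q_0: "q 0 l = 0" and q_diff: "q (t - t') l = q t l - q t' l" for t t' c l
    by (simp_all add: q_def cpoly.scale_left_distrib cpoly.scale_left_diff_distrib sum.distrib
        sum_subtractf cscale_sum_right)
  have q_polys: "q t l \<in> polys X" for t l
    unfolding q_def by (intro polys_sum polys_cscale polys_word_poly) (simp add: Wd_def)
  have q_graded_chain: "graded_chain length 0 d (q t)" if "t \<in> FSd" for t
    unfolding graded_chain_def
  proof (intro allI ballI)
    fix l m assume "m \<in> keys (q t l)"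
    then have "\<exists>w\<in>Wd. lookup (cscale (t (w # l)) (word_poly w)) m \<noteq> 0"
      unfolding q_def in_keys_iff lookup_sum by (meson sum.neutral)
    then obtain w where "t (w # l) \<noteq> 0" "m = word_exponent w"
      by (auto simp: lookup_cscale word_poly_conv_single lookup_single when_def split: if_splits)
    moreover have "sum_list (map length (w # l)) = d" using calculation(1) that by (auto simp: FSd_def)
    ultimately show "monom_deg std m + sum_list (map length l) + 0 = d" by simp
  qed
  define T where "T a t ws' = (if ws' \<in> KK then \<Sum>ws\<in>KK. words_mat a ws' ws * t ws else 0)"
    for a :: "'x \<Rightarrow> 'x \<Rightarrow> complex" and t ws'
  have T_FSd: "T a t \<in> FSd" if t: "t \<in> FSd" for a t
  proof -
    have "sum_list (map length ws') = d" if "T a t ws' \<noteq> 0" for ws'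
    proof -
      have "\<exists>ws. words_mat a ws' ws * t ws \<noteq> 0"
        using that sum.neutral[of KK "\<lambda>ws. words_mat a ws' ws * t ws"] unfolding T_def by metis
      then obtain ws where "words_mat a ws' ws * t ws \<noteq> 0" by blast
      then have "words_mat a ws' ws \<noteq> 0" "t ws \<noteq> 0" by auto
      then show ?thesis using words_mat_length[of a ws' ws] t by (auto simp: FSd_def)
    qed
    moreover have "T a t \<in> supported_on KK" by (simp add: T_def supported_on_def)
    ultimately show ?thesis by (simp add: FSd_def)
  qed
  \<comment> \<open>Tensor powers turn conjugate transposes into conjugate transposes; for a
    Hermitian matrix \<open>a\<close> the map \<open>T a\<close> is self-adjoint.\<close>
  have T_adj: "inner_on KK (T a t) s = inner_on KK t (T (\<lambda>i j. cnj (a j i)) s)" for a t s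
  proof -
    have "inner_on KK (T a t) s = (\<Sum>ws'\<in>KK. \<Sum>ws\<in>KK. t ws * (words_mat a ws' ws * cnj (s ws')))"
      unfolding inner_on_def T_def by (intro sum.cong refl) (simp add: sum_distrib_right sum_distrib_left mult_ac)
    also have "\<dots> = (\<Sum>ws\<in>KK. \<Sum>ws'\<in>KK. t ws * (words_mat a ws' ws * cnj (s ws')))" by (rule sum.swap)
    also have "\<dots> = inner_on KK t (T (\<lambda>i j. cnj (a j i)) s)"
      unfolding inner_on_def T_def by (intro sum.cong refl) (simp add: words_mat_adj sum_distrib_left)
    finally show ?thesis .
  qed
  have q_T: "q (T a t) l' = koszul_map ?U (word_chain_mat ?U a) (lin_subst a X) l' (q t)" if kt: "koszul ?U p (q t)" for a t l'
  proof (cases "l' \<in> words ?U p")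
    case True
    then have len: "length l' = p" "set l' \<subseteq> ?U" by (auto simp: words_def)
    have "q (T a t) l' = (\<Sum>u\<in>Wd. \<Sum>w\<in>Wd. \<Sum>l\<in>words ?U p.
        cscale (word_mat a u w * words_mat a l' l * t (w # l)) (word_poly u))"
      unfolding q_def T_def using True
      by (intro sum.cong refl) (simp add: inKK sumKK cpoly.scale_sum_left)
    also have "\<dots> = (\<Sum>w\<in>Wd. \<Sum>l\<in>words ?U p. \<Sum>u\<in>Wd.
        cscale (word_mat a u w * words_mat a l' l * t (w # l)) (word_poly u))"
      by (subst sum.swap) (intro sum.cong refl, rule sum.swap)
    also have "\<dots> = (\<Sum>l\<in>words ?U p. \<Sum>w\<in>Wd. \<Sum>u\<in>Wd.
        cscale (word_mat a u w * words_mat a l' l * t (w # l)) (word_poly u))" by (rule sum.swap)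
    also have "\<dots> = (\<Sum>l\<in>words ?U p. cscale (words_mat a l' l) (lin_subst a X (q t l)))"
    proof (intro sum.cong refl)
      fix l assume "l \<in> words ?U p"
      have "lin_subst a X (word_poly w) = (\<Sum>u\<in>Wd. cscale (word_mat a u w) (word_poly u))" if "w \<in> Wd" for w
        unfolding lin_subst_word_poly
        by (rule sum.mono_neutral_left[OF finWd]) (use that in \<open>auto simp: words_def Wd_def word_mat_length\<close>)
      then show "(\<Sum>w\<in>Wd. \<Sum>u\<in>Wd. cscale (word_mat a u w * words_mat a l' l * t (w # l)) (word_poly u)) =
          cscale (words_mat a l' l) (lin_subst a X (q t l))"
        unfolding q_def lin_subst_simps cscale_sum_right by (intro sum.cong refl) (simp add: cscale_sum_right mult_ac)
    qed
    also have "\<dots> = koszul_map ?U (word_chain_mat ?U a) (lin_subst a X) l' (q t)" unfolding koszul_map_word_chain_mat[OF len(2)] len(1) ..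
    finally show ?thesis .
  next
    case False
    have "koszul ?U p (\<lambda>l'. koszul_map ?U (word_chain_mat ?U a) (lin_subst a X) l' (q t))"
      by (rule koszul_koszul_map[OF ring_hom_fun_lin_subst kt]) (simp add: word_chain_mat_def)
    then have "koszul_map ?U (word_chain_mat ?U a) (lin_subst a X) l' (q t) = 0" using False by (rule koszul_outside)
    moreover have "q (T a t) l' = 0" using False by (simp add: q_def T_def inKK)
    ultimately show ?thesis by simp
  qed
  define bd where "bd y' \<longleftrightarrow> (\<exists>y. koszul ?U (Suc p) y \<and> y' = koszul_d ?U word_invariant y)" for y'
  \<comment> \<open>The full preimage of the boundaries. It contains all tensors of degree
    \<open>d\<close> that \<open>q\<close> sends to 0, so a tensor outside of it has a nonzero
    image.\<close>
  define B where "B = {t \<in> FSd. bd (q t)}"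
  have bd_koszul: "koszul ?U p y'" if "bd y'" for y' using that koszul_koszul_d by (auto simp: bd_def)
  have FSd: "fv.subspace FSd"
    by (rule fv.subspaceI) (auto simp: FSd_def supported_on_def, (metis add_0)+)
  have B: "fv.subspace B"
  proof (rule fv.subspaceI)
    have "bd (q 0)"
      unfolding bd_def by (intro exI[of _ "\<lambda>_. 0"]) (auto simp: koszul_def koszul_d_def q_0)
    then show "0 \<in> B" using fv.subspace_0[OF FSd] by (simp add: B_def)
    fix t t' c assume t: "t \<in> B"
    then obtain y where y: "koszul ?U (Suc p) y" "q t = koszul_d ?U word_invariant y" by (auto simp: B_def bd_def)
    have "koszul ?U (Suc p) (\<lambda>l. cscale c (y l))" by (rule koszul_compose[OF y(1)]) (simp_all add: cscale_uminus)
    moreover have "q (\<lambda>x. c * t x) = koszul_d ?U word_invariant (\<lambda>l. cscale c (y l))"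
      unfolding koszul_d_def by (rule ext) (simp add: q_scale y(2) koszul_d_def cscale_sum_right cscale_mult_right)
    ultimately have "bd (q (\<lambda>x. c * t x))" by (auto simp: bd_def)
    then show "(\<lambda>x. c * t x) \<in> B" using t fv.subspace_scale[OF FSd] by (simp add: B_def)
    assume t': "t' \<in> B"
    then obtain y' where y': "koszul ?U (Suc p) y'" "q t' = koszul_d ?U word_invariant y'" by (auto simp: B_def bd_def)
    have "q (t + t') = koszul_d ?U word_invariant (\<lambda>l. y l + y' l)"
      by (rule ext) (simp only: q_add y(2) y'(2) koszul_d_add)
    then have "bd (q (t + t'))" using koszul_add[OF y(1) y'(1)] by (auto simp: bd_def)
    then show "t + t' \<in> B" using t t' fv.subspace_add[OF FSd] by (simp add: B_def)
  qed
  have BK: "B \<subseteq> supported_on KK" by (auto simp: B_def FSd_def)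
  have T_B: "T a t \<in> B" if t: "t \<in> B"
    and eq: "\<And>g i j. g \<in> carrier G \<Longrightarrow> i \<in> X \<Longrightarrow> j \<in> X \<Longrightarrow>
      (\<Sum>k\<in>X. a i k * r g k j) = (\<Sum>k\<in>X. r g i k * a k j)" for a t
  proof -
    obtain y where y: "koszul ?U (Suc p) y" "q t = koszul_d ?U word_invariant y" using t by (auto simp: B_def bd_def)
    have "q (T a t) l = koszul_d ?U word_invariant (\<lambda>l. koszul_map ?U (word_chain_mat ?U a) (lin_subst a X) l y) l" for l
      unfolding q_T[OF koszul_koszul_d[OF y(1), of word_invariant, folded y(2)]] unfolding y(2)
      by (rule koszul_d_koszul_map[OF ring_hom_fun_lin_subst, symmetric]) (rule word_chain_mat_chain[OF mrep_axioms mrep_axioms eq])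
    moreover have "koszul ?U (Suc p) (\<lambda>l. koszul_map ?U (word_chain_mat ?U a) (lin_subst a X) l y)"
      by (rule koszul_koszul_map[OF ring_hom_fun_lin_subst y(1)]) (simp add: word_chain_mat_def)
    ultimately have "bd (q (T a t))" unfolding bd_def by blast
    then show ?thesis using T_FSd t by (simp add: B_def)
  qed
  define t0 where "t0 ws = (case ws of [] \<Rightarrow> 0 | w # l \<Rightarrow> if w # l \<in> KK then word_coeff (z l) w else 0)" for ws
  have qt0: "q t0 l = z l" for l
  proof (cases "l \<in> words ?U p")
    case True
    have "z l = (\<Sum>w\<in>Wd. cscale (word_coeff (z l) w) (word_poly w))"
    proof (rule poly_words[OF finWd])
      fix m assume m: "m \<in> keys (z l)"
      then have "monom_deg std m \<le> d" using z(3) unfolding graded_chain_def by fastforce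
      moreover have "keys m \<subseteq> X" using z(2)[of l] m by (auto simp: polys_def)
      ultimately show "monom_word m \<in> Wd" by (simp add: Wd_def length_monom_word)
    qed
    then show ?thesis using True by (simp add: q_def t0_def inKK)
  next
    case False
    then show ?thesis using koszul_outside[OF z(1) False] by (simp add: q_def t0_def inKK)
  qed
  have t0: "t0 \<in> FSd"
  proof -
    have "sum_list (map length ws) = d" if nz: "t0 ws \<noteq> 0" for ws
    proof -
      obtain w l where ws: "ws = w # l" "word_coeff (z l) w \<noteq> 0" using nz by (auto simp: t0_def split: list.splits if_splits)
      then have "monom_deg std (word_exponent w) + sum_list (map length l) = d"
        using z(3) word_coeff_nonzeroD[OF ws(2)] unfolding graded_chain_def by fastforce
      then show ?thesis by (simp add: ws(1))
    qed
    moreover have "t0 \<in> supported_on KK" by (auto simp: supported_on_def t0_def split: list.splits)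
    ultimately show ?thesis by (simp add: FSd_def)
  qed
  obtain t1 where t1: "t1 \<in> B" "\<And>h. h \<in> B \<Longrightarrow> inner_on KK (t0 - t1) h = 0"
    using orth_decomp[OF finKK B BK] by blast
  \<comment> \<open>Subtracting \<open>t1\<close> changes the chain by a boundary only: the image of
    \<zeta> is still a cycle that does not bound.\<close>
  define \<zeta> where "\<zeta> = t0 - t1"
  have \<zeta>d: "\<zeta> \<in> FSd" unfolding \<zeta>_def using t0 t1(1) by (intro fv.subspace_diff[OF FSd]) (auto simp: B_def)
  have \<zeta>B: "\<zeta> \<notin> B"
  proof
    assume "\<zeta> \<in> B"
    then have "\<zeta> + t1 \<in> B" using t1(1) fv.subspace_add[OF B] by blast
    then have "bd (q t0)" by (simp add: B_def \<zeta>_def)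
    moreover have "q t0 = z" using qt0 by (rule ext)
    ultimately show False using notbd by (simp add: bd_def)
  qed
  obtain y1 where y1: "koszul ?U (Suc p) y1" "q t1 = koszul_d ?U word_invariant y1" using t1(1) by (auto simp: B_def bd_def)
  have q\<zeta>: "q \<zeta> = (\<lambda>l. z l - koszul_d ?U word_invariant y1 l)" by (rule ext) (simp only: \<zeta>_def q_diff qt0 y1(2))
  have k\<zeta>: "koszul ?U p (q \<zeta>)" unfolding q\<zeta> by (rule koszul_diff[OF z(1) koszul_koszul_d[OF y1(1)]])
  have c\<zeta>: "koszul_d ?U word_invariant (q \<zeta>) l = 0" for l
    unfolding q\<zeta> by (simp only: koszul_d_diff z(4) koszul_d_koszul_d[OF koszul_alternating[OF y1(1)]] diff_0 minus_zero)
  have "\<exists>l. q \<zeta> l \<noteq> 0"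
  proof (rule ccontr)
    assume "\<not> (\<exists>l. q \<zeta> l \<noteq> 0)"
    then have "q \<zeta> = q 0" by (auto simp: q_0)
    then have "bd (q \<zeta>)" using fv.subspace_0[OF B] by (simp add: B_def)
    then show False using \<zeta>B \<zeta>d by (simp add: B_def)
  qed
  then obtain l0 where l0: "q \<zeta> l0 \<noteq> 0" by blast
  then have l0U: "l0 \<in> words ?U p" using koszul_outside[OF k\<zeta>] by blast
  \<comment> \<open>One point detects a nonzero coefficient. Its values at all lists of indices form
    a scalar tensor, which is then detected by vectors from irreducible subspaces.\<close>
  obtain \<xi> where \<xi>: "\<xi> \<in> supported_on X" "eval_at \<xi> (q \<zeta> l0) \<noteq> 0"
    using ex_eval_at_nonzero[OF fin_X q_polys l0] by blast
  define c where "c l = eval_at \<xi> (q \<zeta> l)" for l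
  obtain yss where yss: "map length yss = map length l0" "\<forall>ys\<in>set yss. set ys \<subseteq> \<Union> {D. irreducible_subspace D}"
    "(\<Sum>l\<in>words ?U p. pair_words yss l * c l) \<noteq> 0"
    using pair_words_detect[OF fin_X span_irreducible_subspace l0U, of c] \<xi>(2) unfolding c_def by blast
  have "length (concat yss) = sum_list (map length l0)" by (simp add: length_concat yss(1))
  also have "\<dots> \<le> length l0 * b"
    using l0U by (intro sum_list_length_le) (auto simp: words_def low_words_def)
  also have "\<dots> = p * b" using l0U by (simp add: words_def)
  finally have len: "length (concat yss) \<le> p * b" .
  obtain v N D where D: "stable D" "onb X v N D" "\<xi> \<in> D" "set (concat yss) \<subseteq> D"
    "N \<le> card (carrier G) + length (concat yss) * sum_irrep_degrees G"
  proof -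
    have "set (concat yss) \<subseteq> \<Union> {D. irreducible_subspace D}" using yss(2) by auto
    then show thesis using small_stable_subspace[OF \<xi>(1)] that by blast
  qed
  have "N \<le> N0" using D(5) len unfolding N0_def by (meson add_le_mono1 add_left_mono le_trans mult_le_mono1)
  note vD = onbD[OF D(2)]
  \<comment> \<open>The transpose of the orthogonal projection to \<open>D\<close>, since points
    transform by the transpose. It is Hermitian and factors through the coordinates of
    \<open>D\<close>.\<close>
  define a where "a i j = (\<Sum>k<N. cnj (v k i) * v k j)" for i j
  have fix_D: "(\<lambda>j. \<Sum>i\<in>X. a i j * \<eta> i) = \<eta>" if "\<eta> \<in> D" for \<eta>
  proof
    fix j
    have "(\<Sum>i\<in>X. a i j * \<eta> i) = (\<Sum>k<N. inner_on X \<eta> (v k) * v k j)"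
      unfolding a_def inner_on_def sum_distrib_right by (subst sum.swap) (simp add: mult_ac)
    then show "(\<Sum>i\<in>X. a i j * \<eta> i) = \<eta> j" using vD(3)[OF that] by (simp add: fun_eq_iff)
  qed
  let ?\<sigma> = "dual_rep v" and ?UN = "low_words {..<N} b"
  interpret N: mrep G "{..<N}" ?\<sigma> by (rule mrep_dual_rep[OF D(2,1)])
  define \<pi> where "\<pi> k j = v k j" for k :: nat and j
  define \<iota> where "\<iota> i k = cnj (v k i)" for i and k :: nat
  have \<pi>eq: "(\<Sum>k\<in>X. \<pi> i k * r g k j) = (\<Sum>k\<in>{..<N}. ?\<sigma> g i k * \<pi> k j)"
    if "g \<in> carrier G" "i \<in> {..<N}" "j \<in> X" for g i j
    unfolding \<pi>_def by (rule dual_rep_restrict[OF D(2,1)]) (use that in auto)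
  have \<iota>eq: "(\<Sum>k\<in>{..<N}. \<iota> i k * ?\<sigma> g k j) = (\<Sum>k\<in>X. r g i k * \<iota> k j)"
    if "g \<in> carrier G" "i \<in> X" "j \<in> {..<N}" for g i j
    unfolding \<iota>_def by (rule dual_rep_extend[OF D(2,1), symmetric]) (use that in auto)
  have a_comp: "a = (\<lambda>i j. \<Sum>l\<in>{..<N}. \<iota> i l * \<pi> l j)" by (simp add: a_def \<iota>_def \<pi>_def fun_eq_iff)
  have a_eq: "(\<Sum>k\<in>X. a i k * r g k j) = (\<Sum>k\<in>X. r g i k * a k j)"
    if g: "g \<in> carrier G" and i: "i \<in> X" and j: "j \<in> X" for g i j
  proof -
    have "(\<Sum>k\<in>X. a i k * r g k j) = (\<Sum>l<N. \<iota> i l * (\<Sum>k\<in>X. \<pi> l k * r g k j))"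
      unfolding a_comp sum_distrib_left sum_distrib_right by (subst sum.swap) (simp add: mult_ac)
    also have "\<dots> = (\<Sum>l<N. \<iota> i l * (\<Sum>k<N. ?\<sigma> g l k * \<pi> k j))"
      using \<pi>eq[OF g _ j] by (intro sum.cong refl) simp
    also have "\<dots> = (\<Sum>k<N. (\<Sum>l<N. \<iota> i l * ?\<sigma> g l k) * \<pi> k j)"
      unfolding sum_distrib_left sum_distrib_right by (subst sum.swap) (simp add: mult_ac)
    also have "\<dots> = (\<Sum>k<N. (\<Sum>l\<in>X. r g i l * \<iota> l k) * \<pi> k j)"
      using \<iota>eq[OF g i] by (intro sum.cong refl) simp
    also have "\<dots> = (\<Sum>k\<in>X. r g i k * a k j)"
      unfolding a_comp sum_distrib_left sum_distrib_right by (subst sum.swap) (simp add: mult_ac)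
    finally show ?thesis .
  qed
  have a_adj: "(\<lambda>i j. cnj (a j i)) = a" by (simp add: a_def fun_eq_iff mult.commute)
  define z2 where "z2 l = koszul_map ?U (word_chain_mat ?UN \<pi>) (lin_subst \<pi> {..<N}) l (q \<zeta>)" for l
  have "koszul ?UN p z2"
    unfolding z2_def by (rule koszul_koszul_map[OF ring_hom_fun_lin_subst k\<zeta>]) (simp add: word_chain_mat_def)
  moreover have "z2 l \<in> polys {..<N}" for l
  proof -
    have "koszul_map ?U (word_chain_mat ?UN \<pi>) (lin_subst \<pi> {..<N}) l y \<in> polys {..<N}" for y
      by (induction l arbitrary: y) (auto intro!: polys_lin_subst polys_sum polys_mult simp: word_chain_mat_def)
    then show ?thesis by (simp add: z2_def)
  qed
  moreover have "graded_chain length 0 d z2"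
    unfolding z2_def
  proof (rule graded_chain_koszul_map[OF _ homogeneous_lin_subst q_graded_chain[OF \<zeta>d]])
    fix w w' m assume "m \<in> keys (word_chain_mat ?UN \<pi> w w')"
    then have "m = 0" "word_mat \<pi> w' w \<noteq> 0" by (auto simp: word_chain_mat_def split: if_splits)
    then show "m = 0 \<and> length w = length w'" using word_mat_length[of w' w \<pi>] by metis
  qed
  moreover have "koszul_d ?UN N.word_invariant z2 l = 0" for l
  proof -
    have "koszul_d ?UN N.word_invariant z2 l = koszul_map ?U (word_chain_mat ?UN \<pi>) (lin_subst \<pi> {..<N}) l (koszul_d ?U word_invariant (q \<zeta>))"
      unfolding z2_def
      by (rule koszul_d_koszul_map[OF ring_hom_fun_lin_subst]) (rule word_chain_mat_chain[OF mrep_axioms N.mrep_axioms \<pi>eq])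
    also have "koszul_d ?U word_invariant (q \<zeta>) = (\<lambda>l. 0)" using c\<zeta> by (rule ext)
    finally show ?thesis by (simp add: koszul_map_0[OF ring_hom_fun_lin_subst])
  qed
  \<comment> \<open>After cancelling N on both sides this reads p b + N (b - 1) < d, which follows
    from the assumption on \<open>d\<close> as N is at most \<open>N0\<close>.\<close>
  moreover have "(p + card {..<N}) * b < d + card {..<N}"
  proof -
    obtain b' where b': "b = Suc b'" using b by (cases b) auto
    have "N * b' \<le> N0 * b'" using \<open>N \<le> N0\<close> by (rule mult_le_mono1)
    moreover have "(p + card {..<N}) * b = p * b + N * b' + N" by (simp add: b' algebra_simps)
    moreover have "p * b + N0 * b' < d" using d by (simp add: b')
    ultimately show ?thesis unfolding card_lessThan by linarith
  qed
  ultimately obtain y2 where y2: "koszul ?UN (Suc p) y2" "z2 = koszul_d ?UN N.word_invariant y2"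
    using N.koszul_vanishing[OF gen[OF N.mrep_axioms]] by blast
  \<comment> \<open>The projection is \<pi> followed by \<iota>, so the bounding chain
    \<open>y2\<close> found over \<open>D\<close> is carried back by \<iota> and bounds the image of
    the projected tensor.\<close>
  have qT\<zeta>: "q (T a \<zeta>) l = koszul_d ?U word_invariant (\<lambda>l. koszul_map ?UN (word_chain_mat ?U \<iota>) (lin_subst \<iota> X) l y2) l" for l
  proof (cases "l \<in> words ?U p")
    case True
    then have lU: "set l \<subseteq> ?U" "length l = p" by (auto simp: words_def)
    have "koszul_d ?U word_invariant (\<lambda>l. koszul_map ?UN (word_chain_mat ?U \<iota>) (lin_subst \<iota> X) l y2) l = koszul_map ?UN (word_chain_mat ?U \<iota>) (lin_subst \<iota> X) l z2"
      unfolding y2(2) by (rule koszul_d_koszul_map[OF ring_hom_fun_lin_subst]) (rule word_chain_mat_chain[OF N.mrep_axioms mrep_axioms \<iota>eq])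
    also have "\<dots> = koszul_map ?U (\<lambda>w w'. \<Sum>u\<in>?UN. lin_subst \<iota> X (word_chain_mat ?UN \<pi> w u) * word_chain_mat ?U \<iota> u w') (\<lambda>f. lin_subst \<iota> X (lin_subst \<pi> {..<N} f)) l (q \<zeta>)"
      unfolding z2_def by (rule koszul_map_comp[OF ring_hom_fun_lin_subst])
    also have "\<dots> = koszul_map ?U (word_chain_mat ?U a) (lin_subst a X) l (q \<zeta>)"
    proof -
      have h: "(\<lambda>f. lin_subst \<iota> X (lin_subst \<pi> {..<N} f)) = lin_subst a X"
        unfolding a_comp by (rule ext) (rule lin_subst_lin_subst, simp)
      have cong: "koszul_map ?U C (lin_subst a X) l y = koszul_map ?U (word_chain_mat ?U a) (lin_subst a X) l y"
        if "\<And>w w'. w \<in> ?U \<Longrightarrow> C w w' = word_chain_mat ?U a w w'" for C y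
        by (induction l arbitrary: y) (simp_all add: that)
      have "(\<Sum>u\<in>?UN. lin_subst \<iota> X (word_chain_mat ?UN \<pi> w u) * word_chain_mat ?U \<iota> u w') = word_chain_mat ?U a w w'" if w: "w \<in> ?U" for w w'
      proof (cases "w' \<in> ?U")
        case True
        have h's: "lin_subst \<iota> X (single 0 e) = single 0 e" for e
          using lin_subst_simps(4)[of \<iota> X e 1] by (simp add: lin_subst_simps cscale_conv_mult)
        have "(\<Sum>u\<in>?UN. lin_subst \<iota> X (word_chain_mat ?UN \<pi> w u) * word_chain_mat ?U \<iota> u w') = (\<Sum>u\<in>?UN. single 0 (word_mat \<iota> w' u * word_mat \<pi> u w))"
          using True by (intro sum.cong refl) (simp add: word_chain_mat_def h's mult_single mult.commute)
        also have "\<dots> = (\<Sum>u\<in>words {..<N} (length w). single 0 (word_mat \<iota> w' u * word_mat \<pi> u w))"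
          by (rule sum_low_words[OF _ w]) (simp_all add: word_mat_length)
        also have "\<dots> = single 0 (word_mat a w' w)"
          unfolding a_comp word_mat_comp[OF refl, symmetric]
          by (rule poly_mapping_eqI) (simp add: lookup_sum lookup_single when_def)
        finally show ?thesis using True by (simp add: word_chain_mat_def)
      qed (simp add: word_chain_mat_def)
      then show ?thesis unfolding h by (rule cong)
    qed
    also have "\<dots> = q (T a \<zeta>) l" by (rule q_T[OF k\<zeta>, symmetric])
    finally show ?thesis by simp
  next
    case False
    have "koszul ?U p (koszul_d ?U word_invariant (\<lambda>l. koszul_map ?UN (word_chain_mat ?U \<iota>) (lin_subst \<iota> X) l y2))"
      by (rule koszul_koszul_d) (rule koszul_koszul_map[OF ring_hom_fun_lin_subst y2(1)], simp add: word_chain_mat_def)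
    then have "koszul_d ?U word_invariant (\<lambda>l. koszul_map ?UN (word_chain_mat ?U \<iota>) (lin_subst \<iota> X) l y2) l = 0" using False by (rule koszul_outside)
    moreover have "q (T a \<zeta>) l = 0" using False by (simp add: q_def T_def inKK)
    ultimately show ?thesis by simp
  qed
  moreover have "koszul ?U (Suc p) (\<lambda>l. koszul_map ?UN (word_chain_mat ?U \<iota>) (lin_subst \<iota> X) l y2)"
    by (rule koszul_koszul_map[OF ring_hom_fun_lin_subst y2(1)]) (simp add: word_chain_mat_def)
  ultimately have "bd (q (T a \<zeta>))" unfolding bd_def by blast
  then have TB: "T a \<zeta> \<in> B" using T_FSd[OF \<zeta>d] by (simp add: B_def)
  \<comment> \<open>The projected tensor lies in \<open>B\<close> by the case of bounded dimension
    and is orthogonal to \<open>B\<close> by self-adjointness; so it is orthogonal to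
    itself.\<close>
  have "inner_on KK (T a \<zeta>) (T a \<zeta>) = inner_on KK \<zeta> (T a (T a \<zeta>))" using T_adj[of a \<zeta> "T a \<zeta>"] a_adj by simp
  also have "\<dots> = 0" unfolding \<zeta>_def by (rule t1(2)) (use T_B[OF TB a_eq] in \<open>simp add: \<zeta>_def\<close>)
  finally have "T a \<zeta> = 0" using inner_on_self_eq_0[OF finKK] TB BK by blast
  then have q0: "q (T a \<zeta>) l = 0" for l by (simp add: q_0)
  \<comment> \<open>All detecting vectors lie in \<open>D\<close> and are fixed by the transpose of
    \<open>a\<close>, so they see no difference between \<zeta> and its projection.\<close>
  have "(\<Sum>l\<in>words ?U p. pair_words yss l * eval_at \<xi> (q (T a \<zeta>) l)) = (\<Sum>l\<in>words ?U p. pair_words yss l * c l)"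
  proof -
    have e: "eval_at \<xi> (q (T a \<zeta>) l') = (\<Sum>l\<in>words ?U p. words_mat a l' l * c l)" if "l' \<in> words ?U p" for l'
    proof -
      have "q (T a \<zeta>) l' = (\<Sum>l\<in>words ?U p. cscale (words_mat a l' l) (lin_subst a X (q \<zeta> l)))"
        using q_T[OF k\<zeta>, of a l'] koszul_map_word_chain_mat[of l' ?U ?U a "lin_subst a X" "q \<zeta>"] that by (auto simp: words_def)
      then show ?thesis by (simp add: eval_at_sum eval_at_cscale eval_at_lin_subst fix_D[OF D(3)] c_def)
    qed
    have "(\<Sum>l'\<in>words ?U p. pair_words yss l' * eval_at \<xi> (q (T a \<zeta>) l')) =
        (\<Sum>l\<in>words ?U p. (\<Sum>l'\<in>words ?U p. pair_words yss l' * words_mat a l' l) * c l)"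
      by (simp add: e sum_distrib_left sum_distrib_right mult.assoc) (rule sum.swap)
    also have "\<dots> = (\<Sum>l\<in>words ?U p. pair_words yss l * c l)"
    proof (intro sum.cong refl)
      fix l assume l: "l \<in> words ?U p"
      have "(\<Sum>l'\<in>words ?U p. pair_words yss l' * words_mat a l' l) = pair_words yss l"
        by (rule pair_words_words_mat[OF fin_X _ l], rule fix_D) (use D(4) in auto)
      then show "(\<Sum>l'\<in>words ?U p. pair_words yss l' * words_mat a l' l) * c l = pair_words yss l * c l" by simp
    qed
    finally show ?thesis .
  qed
  then show False using yss(3) by (simp add: q0)
qed

end

section \<open>The bound\<close>

text \<open>Noether's bound guarantees that the LEAST in the definition is attained, and it bounds
  the set whose maximum is \<open>noether_number G\<close>.\<close>

lemma noether_number_rep_le: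
  assumes G: "group G" "finite (carrier G)" and \<rho>: "representation G n \<rho>"
  shows "subalgebra hull {f \<in> invariants G n \<rho>. total_deg f \<le> noether_number_rep G n \<rho>} = invariants G n \<rho>"
    and "noether_number_rep G n \<rho> \<le> card (carrier G)"
proof -
  interpret V: mrep G "{..<n}" "\<lambda>g i j. \<rho> g $$ (i, j)" by (rule mrep_of_representation[OF G \<rho>])
  have R: "invariants G n \<rho> = V.invs" by (rule invariants_eq[OF V.mrep_axioms])
  let ?P = "\<lambda>d. subalgebra hull {f \<in> invariants G n \<rho>. total_deg f \<le> d} = invariants G n \<rho>"
  have "?P (card (carrier G))" unfolding R by (rule V.noether_bound)
  then show "?P (noether_number_rep G n \<rho>)" "noether_number_rep G n \<rho> \<le> card (carrier G)"
    unfolding noether_number_rep_def by (rule LeastI, rule Least_le)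
qed

text \<open>The entries of \<open>r\<close> below \<open>n\<close> form a genuine matrix
  representation with the same invariants, and enlarging the degree bound from its own Noether
  number to the maximum is harmless.\<close>

lemma generated_noether_number:
  assumes G: "group G" "finite (carrier G)" and V: "mrep G {..<n::nat} r"
  shows "subalgebra hull {f \<in> mrep.invs G {..<n} r. total_deg f \<le> noether_number G} = mrep.invs G {..<n} r"
proof -
  interpret V: mrep G "{..<n}" r by fact
  define \<rho> where "\<rho> g = mat n n (\<lambda>(i, j). r g i j)" for g
  have \<rho>: "representation G n \<rho>" unfolding \<rho>_def by (rule representation_of_mrep[OF V])
  interpret W: mrep G "{..<n}" "\<lambda>g i j. \<rho> g $$ (i, j)" by (rule mrep_of_representation[OF G \<rho>])
  have "lin_subst (r g) {..<n} f = lin_subst (\<lambda>i j. \<rho> g $$ (i, j)) {..<n} f" if "f \<in> polys {..<n}" for g f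
    by (rule lin_subst_cong[OF that]) (simp add: \<rho>_def)
  then have R: "V.invs = invariants G n \<rho>"
    unfolding invariants_eq[OF W.mrep_axioms] V.invs_def W.invs_def by auto
  let ?S = "{noether_number_rep G n \<rho> | n \<rho>. representation G n \<rho>}"
  have "?S \<subseteq> {..card (carrier G)}" using noether_number_rep_le(2)[OF G] by auto
  then have "finite ?S" by (rule finite_subset) simp
  then have le: "noether_number_rep G n \<rho> \<le> noether_number G"
    unfolding noether_number_def using \<rho> by (intro Max_ge) auto
  show ?thesis
  proof
    show "subalgebra hull {f \<in> V.invs. total_deg f \<le> noether_number G} \<subseteq> V.invs"
      by (rule hull_minimal) (auto simp: V.subalgebra_inv)
    have "V.invs = subalgebra hull {f \<in> V.invs. total_deg f \<le> noether_number_rep G n \<rho>}"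
      using noether_number_rep_le(1)[OF G \<rho>] unfolding R by simp
    also have "\<dots> \<subseteq> subalgebra hull {f \<in> V.invs. total_deg f \<le> noether_number G}"
      using le by (intro hull_mono) auto
    finally show "V.invs \<subseteq> subalgebra hull {f \<in> V.invs. total_deg f \<le> noether_number G}" .
  qed
qed

section \<open>Minimal generating spaces\<close>

lemma subalgebraI:
  assumes "0 \<in> S" "1 \<in> S" "\<And>f h. f \<in> S \<Longrightarrow> h \<in> S \<Longrightarrow> f + h \<in> S"
    "\<And>f h. f \<in> S \<Longrightarrow> h \<in> S \<Longrightarrow> f * h \<in> S" "\<And>c f. f \<in> S \<Longrightarrow> cscale c f \<in> S"
  shows "subalgebra S"
  unfolding subalgebra_def by (intro conjI cpoly.subspaceI ballI assms)

text \<open>The elements of \<open>E\<close> of degree at most \<open>b\<close> already form a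
  generating space, so by minimality they are all of \<open>E\<close>.\<close>

lemma minimal_generating_space_degree:
  assumes E: "minimal_generating_space R E" and R: "subalgebra R"
    and gen: "subalgebra hull {f \<in> R. total_deg f \<le> b} = R"
    and f: "f \<in> E"
  shows "total_deg f \<le> b"
proof -
  have Es: "cpoly.subspace E" "E \<subseteq> R" "\<And>f d. f \<in> E \<Longrightarrow> homog_part std d f \<in> E"
    "\<And>f. f \<in> E \<Longrightarrow> homog_part std 0 f = 0" "subalgebra hull E = R"
    using E by (auto simp: minimal_generating_space_def generating_space_def)
  define E' where "E' = {f \<in> E. total_deg f \<le> b}"
  let ?H = "subalgebra hull E'"
  note H = subalgebraD[OF subalgebra_hull[of E']]
  \<comment> \<open>These polynomials are closed under products, because a part of degree at most
    \<open>b\<close> of a product only involves parts of the factors of degree at most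
    \<open>b\<close>.\<close>
  let ?T = "{f. \<forall>d\<le>b. homog_part std d f \<in> ?H}"
  have H0: "0 \<in> ?H" using H(3)[OF H(4), of 0] by simp
  have "homog_part std d (1 :: nat cpoly) = (if d = 0 then 1 else 0)" for d
    by (rule homog_part_homogeneous) (simp add: homogeneous_def)
  then have one: "1 \<in> ?T" using H(4) H0 by simp
  have "subalgebra ?T"
  proof (rule subalgebraI)
    fix f h assume f: "f \<in> ?T" and h: "h \<in> ?T"
    show "f + h \<in> ?T" using f h H(1) by (simp add: homog_part_add)
    show "f * h \<in> ?T"
    proof (intro CollectI allI impI)
      fix d assume d: "d \<le> b"
      have "f = (\<Sum>e\<in>monom_deg std ` keys f. homog_part std e f)" by (rule sum_homog_parts) auto
      then have "f * h = (\<Sum>e\<in>monom_deg std ` keys f. homog_part std e f * h)"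
        by (metis sum_distrib_right)
      then have "homog_part std d (f * h) =
          (\<Sum>e\<in>monom_deg std ` keys f. if e \<le> d then homog_part std e f * homog_part std (d - e) h else 0)"
        by (simp only: homog_part_sum homog_part_mult[OF homogeneous_homog_part])
      also have "\<dots> \<in> ?H"
        by (rule H(5)) (use f h d H(2) H0 in auto)
      finally show "homog_part std d (f * h) \<in> ?H" .
    qed
  next
    fix c f assume "f \<in> ?T"
    then show "cscale c f \<in> ?T" using H(3) by (simp add: homog_part_cscale)
  qed (use H0 one in simp_all)
  moreover have "E \<subseteq> ?T"
  proof (intro subsetI CollectI allI impI)
    fix f d assume "f \<in> E" "d \<le> b"
    then have "homog_part std d f \<in> E'"
      using Es(3) homogeneous_total_deg_le[OF homogeneous_homog_part, of d f] by (simp add: E'_def)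
    then show "homog_part std d f \<in> ?H" by (rule hull_inc)
  qed
  ultimately have RT: "R \<subseteq> ?T" using Es(5) hull_minimal[of E ?T subalgebra] by simp
  have "{f \<in> R. total_deg f \<le> b} \<subseteq> ?H"
  proof
    fix f assume f: "f \<in> {f \<in> R. total_deg f \<le> b}"
    have "f = (\<Sum>d\<in>monom_deg std ` keys f. homog_part std d f)" by (rule sum_homog_parts) auto
    also have "\<dots> \<in> ?H"
    proof (rule H(5))
      fix d assume "d \<in> monom_deg std ` keys f"
      then have "d \<le> b" using f unfolding mem_Collect_eq total_deg_le_iff by blast
      then show "homog_part std d f \<in> ?H" using f RT by blast
    qed
    finally show "f \<in> ?H" .
  qed
  then have "subalgebra hull {f \<in> R. total_deg f \<le> b} \<subseteq> ?H"
    by (rule hull_minimal) (rule subalgebra_hull)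
  then have "R \<subseteq> ?H" unfolding gen .
  moreover have "?H \<subseteq> R" by (rule hull_minimal) (use Es(2) R in \<open>auto simp: E'_def\<close>)
  moreover have "homog_part std d f \<in> E'" if "f \<in> E'" for f d
  proof -
    have "keys (homog_part std d f) \<subseteq> keys f" unfolding homog_part_conv_restrict_monoms by (auto simp: keys_restrict_monoms)
    then show ?thesis using that Es(3) unfolding E'_def total_deg_le_iff by blast
  qed
  moreover have "cpoly.subspace E'"
  proof (rule cpoly.subspaceI)
    show "0 \<in> E'" using cpoly.subspace_0[OF Es(1)] by (simp add: E'_def total_deg_def)
    fix f h c assume f: "f \<in> E'"
    show "cscale c f \<in> E'"
      using f cpoly.subspace_scale[OF Es(1)] keys_cscale_subset unfolding E'_def total_deg_le_iff by blast
    assume "h \<in> E'"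
    then show "f + h \<in> E'"
      using f cpoly.subspace_add[OF Es(1)] keys_add[of f h] unfolding E'_def total_deg_le_iff by blast
  qed
  moreover have "E' \<subseteq> R" "\<And>f. f \<in> E' \<Longrightarrow> homog_part std 0 f = 0" using Es(2,4) by (auto simp: E'_def)
  ultimately have "generating_space R E'" unfolding generating_space_def by blast
  then have "E' = E" using E by (auto simp: minimal_generating_space_def E'_def)
  then show ?thesis using f by (auto simp: E'_def)
qed

lemma abelian_invariant_gmod:
  assumes R: "subalgebra R" and B: "B \<subseteq> R"
  shows "abelian_gmod B (invariant_gmod R)"
proof -
  note Rs = subalgebraD[OF R]
  have pow: "f ^ k \<in> R" if "f \<in> R" for f k using that by (induction k) (auto intro: Rs)
  have prd: "prod f I \<in> R" if "\<And>i. i \<in> I \<Longrightarrow> f i \<in> R" for f and I :: "nat cpoly set"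
    using that by (induction I rule: infinite_finite_induct) (auto intro: Rs)
  have "subst_poly (\<lambda>b. b) s \<in> R" if "s \<in> polys B" for s
    unfolding subst_poly_def using that B by (intro Rs(5) Rs(3) prd pow) (auto simp: polys_def)
  moreover have "subst_poly (\<lambda>b. b) (single 0 (1 / 2)) * (x + x) = x" for x :: "nat cpoly"
    unfolding subst_poly_single mon_val_0 cscale_mult_left mult_1 cpoly.scale_right_distrib
      cpoly.scale_left_distrib[symmetric] by simp
  moreover have "0 \<in> R" "\<And>x y. x \<in> R \<Longrightarrow> y \<in> R \<Longrightarrow> x - y \<in> R"
    using R unfolding subalgebra_def by (auto intro: cpoly.subspace_0 cpoly.subspace_diff)
  ultimately show ?thesis
    unfolding abelian_gmod_def invariant_gmod_def by (simp add: Rs(2) right_diff_distrib del: mult_2)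
qed

text \<open>The conjunct \<open>1 \<le> b\<close> ensures that \<open>b - 1\<close> is a true
  difference when the bound is rewritten over the integers.\<close>

lemma syzygy_degree_bound:
  assumes G: "group G" "finite (carrier G)" and \<rho>: "representation G n \<rho>" and p: "p \<ge> 1"
    and E: "minimal_generating_space (invariants G n \<rho>) E" and B: "homogeneous_basis E B"
    and tor: "tor_nonzero B total_deg (invariant_gmod (invariants G n \<rho>)) p d"
  defines "b \<equiv> noether_number G"
  shows "1 \<le> b \<and> d \<le> p * b + (card (carrier G) + p * b * sum_irrep_degrees G) * (b - 1)"
proof (rule ccontr)
  assume neg: "\<not> ?thesis"
  define r where "r g i j = \<rho> g $$ (i, j)" for g i j
  have mV: "mrep G {..<n} r" unfolding r_def by (rule mrep_of_representation[OF G \<rho>])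
  interpret V: mrep G "{..<n}" r by fact
  interpret W: urep G "perm_space G n" "perm_rep G" by (rule urep_perm[OF G])
  have R: "invariants G n \<rho> = V.invs" unfolding r_def using mV by (intro invariants_eq) (simp add: r_def[abs_def])
  have gen: "subalgebra hull {f \<in> V.invs. total_deg f \<le> b} = V.invs"
    unfolding b_def by (rule generated_noether_number[OF G mV])
  note E' = E[unfolded R]
  have Es: "cpoly.subspace E" "E \<subseteq> V.invs" "\<And>f. f \<in> E \<Longrightarrow> homog_part std 0 f = 0" "subalgebra hull E = V.invs"
    using E' by (auto simp: minimal_generating_space_def generating_space_def)
  have Bs: "cpoly.independent B" "cpoly.span B = E" "\<And>b. b \<in> B \<Longrightarrow> \<exists>d. homogeneous std d b"
    using B by (auto simp: homogeneous_basis_def)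
  have BE: "B \<subseteq> E" using Bs(2) cpoly.span_superset by blast
  have Bdeg: "homogeneous std (total_deg f) f \<and> 1 \<le> total_deg f \<and> total_deg f \<le> b" if f: "f \<in> B" for f
  proof -
    obtain e where e: "homogeneous std e f" using Bs(3)[OF f] by blast
    have f0: "f \<noteq> 0" using f Bs(1) cpoly.dependent_zero by blast
    then have td: "total_deg f = e" using e homogeneous_total_deg by blast
    have "e \<noteq> 0"
    proof
      assume "e = 0"
      then have "homog_part std 0 f = f" using homog_part_homogeneous[OF e, of 0] by simp
      then show False using Es(3)[of f] f BE f0 by auto
    qed
    moreover have "total_deg f \<le> b"
      by (rule minimal_generating_space_degree[OF E' V.subalgebra_inv gen]) (use f BE in blast)
    ultimately show ?thesis using e td by simp
  qed
  \<comment> \<open>\<open>B\<close> is independent in the finite-dimensional space of polynomials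
    of degree at most \<open>b\<close> in \<open>n\<close> variables.\<close>
  have finB: "finite B"
  proof -
    define Ws where "Ws = {w. set w \<subseteq> {..<n} \<and> length w \<le> b}"
    have Ws: "finite Ws" unfolding Ws_def by (rule finite_lists_length_le) simp
    have "B \<subseteq> cpoly.span (word_poly ` Ws)"
    proof
      fix f assume f: "f \<in> B"
      have "f = (\<Sum>w\<in>Ws. cscale (word_coeff f w) (word_poly w))"
      proof (rule poly_words[OF Ws])
        fix m assume m: "m \<in> keys f"
        have "f \<in> polys {..<n}" using f BE Es(2) V.inv_polys by blast
        moreover have "monom_deg std m \<le> b" using Bdeg[OF f] m unfolding total_deg_le_iff by blast
        ultimately show "monom_word m \<in> Ws" using m by (auto simp: Ws_def length_monom_word polys_def)
      qed
      also have "\<dots> \<in> cpoly.span (word_poly ` Ws)"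
        by (intro cpoly.span_sum cpoly.span_scale cpoly.span_base) auto
      finally show "f \<in> cpoly.span (word_poly ` Ws)" .
    qed
    then show ?thesis using cpoly.independent_span_bound[OF _ Bs(1)] Ws by blast
  qed
  have hullB: "subalgebra hull B = V.invs"
  proof
    show "subalgebra hull B \<subseteq> V.invs" by (rule hull_minimal) (use BE Es(2) V.subalgebra_inv in auto)
    have "cpoly.subspace (subalgebra hull B)" using subalgebra_hull[of B] by (simp add: subalgebra_def)
    then have "E \<subseteq> subalgebra hull B"
      unfolding Bs(2)[symmetric] by (intro cpoly.span_minimal hull_subset)
    then show "V.invs \<subseteq> subalgebra hull B"
      unfolding Es(4)[symmetric] by (rule hull_minimal) (rule subalgebra_hull)
  qed
  let ?M = "invariant_gmod (invariants G n \<rho>)"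
  have kdM: "koszul_d_mod ?M B z = koszul_d B (\<lambda>b. b) z" for z
    by (rule ext) (simp add: koszul_d_mod_def koszul_d_def invariant_gmod_def)
  have "tor_cycles B total_deg F p d \<subseteq> tor_boundaries B total_deg F p d"
    if F: "graded_free_resolution B total_deg ?M F" for F
  proof (rule tor_vanishes_if_koszul[OF finB F])
    show "abelian_gmod B ?M"
      unfolding R by (rule abelian_invariant_gmod[OF V.subalgebra_inv]) (use BE Es(2) in blast)
    show "p > 0" using p by simp
    fix z assume z: "koszul_mod ?M B p z" "graded_fun ?M total_deg d z" "\<And>l. koszul_d_mod ?M B z l = 0"
    have zk: "koszul B p z" and zR: "z l \<in> V.invs" for l
      using z(1) by (auto simp: koszul_mod_def invariant_gmod_def R)
    have zdeg: "graded_chain total_deg 0 d z"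
      unfolding graded_chain_def
    proof (intro allI ballI)
      fix l m assume m: "m \<in> keys (z l)"
      then have "z l \<noteq> 0" by auto
      then obtain e where "e + sum_list (map total_deg l) = d" "homogeneous std e (z l)"
        using z(2) by (auto simp: graded_fun_def invariant_gmod_def)
      moreover from this(2) have "monom_deg std m = e" using m unfolding homogeneous_def by blast
      ultimately show "monom_deg std m + sum_list (map total_deg l) + 0 = d" by simp
    qed
    have "\<exists>u. koszul B (Suc p) u \<and> (\<forall>l. u l \<in> V.invs) \<and> z = koszul_d B (\<lambda>b. b) u"
    \<comment> \<open>Without generators there are no lists of positive length and every chain is
      zero. Otherwise the degree of some generator shows that \<open>b\<close> is positive.\<close>
    proof (cases "B = {}")
      case True
      then have "words B p = {}" using p by (auto simp: words_def)
      then have "z = koszul_d B (\<lambda>b. b) (\<lambda>_. 0)" using koszul_outside[OF zk] by (auto simp: koszul_d_def)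
      then show ?thesis
        by (intro exI[of _ "\<lambda>_. 0"]) (auto simp: koszul_def V.invs_def lin_subst_simps)
    next
      case False
      then have b: "1 \<le> b" using Bdeg by force
      then have d: "p * b + (card (carrier G) + p * b * sum_irrep_degrees G) * (b - 1) < d" using neg by auto
      \<comment> \<open>A vector v goes to the sum over h of h times (h^-1 v) in n copies of the
        regular representation, where the group acts on the first factor only. The retraction \<pi>
        sends h times w to h w divided by the group order.\<close>
      define \<iota> where "\<iota> = (\<lambda>(h, i) j. r (inv\<^bsub>G\<^esub> h) i j)"
      define \<pi> where "\<pi> i = (\<lambda>(h, j). r h i j / of_nat (card (carrier G)))" for i
      have sumY: "(\<Sum>y\<in>perm_space G n. f y) = (\<Sum>h\<in>carrier G. \<Sum>i<n. f (h, i))" for f :: "_ \<Rightarrow> complex"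
        by (simp add: perm_space_def sum.cartesian_product)
      show ?thesis
      proof (rule koszul_retract[OF mV W.mrep_axioms finB Bs(1) _ hullB Bdeg _ _ _ _ zk zR zdeg])
        show "B \<subseteq> V.invs" using BE Es(2) by blast
        show "koszul_d B (\<lambda>b. b) z l = 0" for l using z(3)[of l] by (simp add: kdM)
        fix g y j assume g: "g \<in> carrier G" and y: "y \<in> perm_space G n" and j: "j \<in> {..<n}"
        obtain h i where hi: "y = (h, i)" "h \<in> carrier G" "i < n" using y by (auto simp: perm_space_def)
        have "(\<Sum>k\<in>perm_space G n. perm_rep G g y k * \<iota> k j) =
            (\<Sum>k\<in>perm_space G n. if k = (inv\<^bsub>G\<^esub> g \<otimes>\<^bsub>G\<^esub> h, i) then \<iota> k j else 0)"
        proof (rule sum.cong[OF refl])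
          fix k assume k: "k \<in> perm_space G n"
          obtain h' i' where k': "k = (h', i')" "h' \<in> carrier G" using k by (auto simp: perm_space_def)
          have "h = g \<otimes>\<^bsub>G\<^esub> h' \<longleftrightarrow> h' = inv\<^bsub>G\<^esub> g \<otimes>\<^bsub>G\<^esub> h"
            using g hi(2) k'(2) by (auto simp: V.inv_solve_left)
          then show "perm_rep G g y k * \<iota> k j = (if k = (inv\<^bsub>G\<^esub> g \<otimes>\<^bsub>G\<^esub> h, i) then \<iota> k j else 0)"
            using hi k' by (auto simp: perm_rep_def)
        qed
        also have "\<dots> = \<iota> (inv\<^bsub>G\<^esub> g \<otimes>\<^bsub>G\<^esub> h, i) j"
          using g hi W.fin_X by (simp add: perm_space_def)
        also have "\<dots> = r (inv\<^bsub>G\<^esub> h \<otimes>\<^bsub>G\<^esub> g) i j"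
          using g hi by (simp add: \<iota>_def V.inv_mult_group)
        also have "\<dots> = (\<Sum>k\<in>{..<n}. \<iota> y k * r g k j)"
          using g hi j by (simp add: V.r_mult \<iota>_def)
        finally show "(\<Sum>k\<in>{..<n}. \<iota> y k * r g k j) = (\<Sum>k\<in>perm_space G n. perm_rep G g y k * \<iota> k j)"
          by simp
      next
        fix g i y assume g: "g \<in> carrier G" and i: "i \<in> {..<n}" and y: "y \<in> perm_space G n"
        obtain h j where hj: "y = (h, j)" "h \<in> carrier G" "j < n" using y by (auto simp: perm_space_def)
        have "(\<Sum>k\<in>perm_space G n. \<pi> i k * perm_rep G g k y) =
            (\<Sum>k\<in>perm_space G n. if k = (g \<otimes>\<^bsub>G\<^esub> h, j) then \<pi> i k else 0)"
          using hj by (intro sum.cong) (auto simp: perm_rep_def split: if_splits)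
        also have "\<dots> = \<pi> i (g \<otimes>\<^bsub>G\<^esub> h, j)" using g hj W.fin_X by (simp add: perm_space_def)
        also have "\<dots> = (\<Sum>k\<in>{..<n}. r g i k * \<pi> k y)"
          using g hj i by (simp add: \<pi>_def V.r_mult sum_divide_distrib)
        finally show "(\<Sum>k\<in>perm_space G n. \<pi> i k * perm_rep G g k y) = (\<Sum>k\<in>{..<n}. r g i k * \<pi> k y)" .
      next
        fix i j assume ij: "i \<in> {..<n}" "j \<in> {..<n}"
        have "(\<Sum>k\<in>perm_space G n. \<pi> i k * \<iota> k j) =
            (\<Sum>h\<in>carrier G. (\<Sum>k<n. r h i k * r (inv\<^bsub>G\<^esub> h) k j) / of_nat (card (carrier G)))"
          unfolding sumY by (simp add: \<pi>_def \<iota>_def sum_divide_distrib)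
        also have "\<dots> = (\<Sum>h\<in>carrier G. r \<one>\<^bsub>G\<^esub> i j / of_nat (card (carrier G)))"
          using ij by (intro sum.cong refl) (simp flip: V.r_mult)
        also have "\<dots> = (if i = j then 1 else 0)" using ij V.card_G by (simp add: V.r_one)
        finally show "(\<Sum>k\<in>perm_space G n. \<pi> i k * \<iota> k j) = (if i = j then 1 else 0)" .
      next
        fix z' :: "('a \<times> nat) list list \<Rightarrow> _"
        assume z': "koszul (low_words (perm_space G n) b) p z'" "\<And>l. z' l \<in> polys (perm_space G n)"
          "graded_chain length 0 d z'" "\<And>l. koszul_d (low_words (perm_space G n) b) W.word_invariant z' l = 0"
        show "\<exists>y. koszul (low_words (perm_space G n) b) (Suc p) y \<and> z' = koszul_d (low_words (perm_space G n) b) W.word_invariant y"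
          by (rule W.koszul_vanishing_large[OF generated_noether_number[OF G, folded b_def] b d z'])
      qed
    qed
    then show "\<exists>u. koszul_mod ?M B (Suc p) u \<and> z = koszul_d_mod ?M B u"
      unfolding kdM by (simp add: koszul_mod_def invariant_gmod_def R)
  qed
  then show False using tor by (auto simp: tor_nonzero_def)
qed

theorem theorem2:
  fixes G :: "('g, 'b) monoid_scheme"
    and n p :: nat
    and \<rho> :: "'g \<Rightarrow> complex mat"
    and g \<beta> m :: int
    and \<delta> :: "nat \<Rightarrow> int"
  assumes "group G" and "finite (carrier G)"
    and "g = int (order G)"
    and "\<beta> = int (noether_number G)"
    and "m = int (sum_irrep_degrees G)"
    and "\<And>p. \<delta> p = (\<beta> - 1) * g - (m - 1) * \<beta> * int p"
    and "p \<ge> 1"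
    and "representation G n \<rho>"
  shows "syz_degree G n \<rho> p \<le> ereal (real_of_int (\<beta>\<^sup>2 * m * int p + \<delta> p))"
proof -
  have "ereal (real d) \<le> ereal (real_of_int (\<beta>\<^sup>2 * m * int p + \<delta> p))"
    if "minimal_generating_space (invariants G n \<rho>) E" "homogeneous_basis E B"
      "tor_nonzero B total_deg (invariant_gmod (invariants G n \<rho>)) p d" for E B d
  proof -
    have bd: "1 \<le> noether_number G"
      "d \<le> p * noether_number G + (order G + p * noether_number G * sum_irrep_degrees G) * (noether_number G - 1)"
      using syzygy_degree_bound[OF assms(1,2,8,7) that] by (auto simp: order_def)
    have "int d \<le> int (p * noether_number G + (order G + p * noether_number G * sum_irrep_degrees G) * (noether_number G - 1))"
      using bd(2) by (simp only: of_nat_le_iff)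
    also have "\<dots> = int p * \<beta> + (g + int p * \<beta> * m) * (\<beta> - 1)"
      using bd(1) by (simp add: assms(3,4,5) of_nat_diff)
    also have "\<dots> = \<beta>\<^sup>2 * m * int p + \<delta> p"
      unfolding assms(6) by (simp add: power2_eq_square algebra_simps)
    finally have "real d \<le> real_of_int (\<beta>\<^sup>2 * m * int p + \<delta> p)"
      by (metis of_int_le_iff of_int_of_nat_eq)
    then show ?thesis by simp
  qed
  then show ?thesis
    unfolding syz_degree_def syz_degree_wrt_def by (intro SUP_least Sup_least) auto
qed

end
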